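(* Let $F$ be a free group of finite rank $k\ge 3$. Then $\mathcal{M}^{\mathbb{P}Curr}\subseteq \mathbb{P}Curr(F)$ is the unique smallest non-empty closed $Out(F)$-invariant subset of $\mathbb{P}Curr(F)$; that is, $\mathcal{M}^{\mathbb{P}Curr}$ is a non-empty closed $Out(F)$-invariant subset of $\mathbb{P}Curr(F)$, and it is contained in every non-empty closed $Out(F)$-invariant subset of $\mathbb{P}Curr(F)$.
   Context: Currents. $\partial F$ is the hyperbolic (Gromov) boundary of $F$, and $\partial^2F=\{(\zeta,\xi): \zeta,\xi\in\partial F,\ \zeta\neq\xi\}$, with flip map $\sigma(\zeta,\xi)=(\xi,\zeta)$. A geodesic current on $F$ is a positive Radon measure on $\partial^2F$ that is $F$-invariant and $\sigma$-invariant. $Curr(F)$ is the space of all geodesic currents with the weak topology: $\nu_n\to\nu$ iff $\nu_n(S\times S')\to\nu(S\times S')$ for all disjoint closed-open $S,S'\subseteq\partial F$. $\mathbb{P}Curr(F)$ is the set of non-zero currents modulo multiplication by non-zero (necessarily positive) scalars, with the quotient topology; the class of $\nu$ is $[\nu]$. An automorphism $\phi\in Aut(F)$ induces a homeomorphism $\hat\phi$ of $\partial^2F$, and $(\phi\nu)(S)=\nu(\hat\phi^{-1}(S))$; this induces a continuous left action of $Out(F)$ on $\mathbb{P}Curr(F)$. Rational currents. For $g\in F$ non-trivial and not a proper power, let $g_\pm=\lim_{n\to\infty}g^{\pm n}\in\partial F$ and $\mu_g=\sum_{h\in[g]}(\delta_{(h_-,h_+)}+\delta_{(h_+,h_-)})$,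 where $[g]$ is the conjugacy class of $g$. If $g=f^m$ with $m>1$ and $f$ not a proper power, $\mu_g=m\mu_f$. An element of $F$ is primitive if it belongs to some free basis of $F$. $\mathcal{M}^{\mathbb{P}Curr}$ is the closure in $\mathbb{P}Curr(F)$ of $\{[\mu_g]: g\in F \text{ primitive}\}$. *)

theory Defs
  imports "HOL-Analysis.Analysis" "HOL-Algebra.Bij" "HOL-Algebra.Coset"
begin

section \<open>Free groups and their automorphisms\<close>

text \<open>A letter \<open>(x, True)\<close> stands for \<open>x\<close> and \<open>(x, False)\<close> for its inverse.\<close>

type_synonym 'a word = "('a \<times> bool) list"

definition letter_val :: "('a, 'b) monoid_scheme \<Rightarrow> 'a \<times> bool \<Rightarrow> 'a" where
  "letter_val F l = (if snd l then fst l else inv\<^bsub>F\<^esub> (fst l))"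

definition word_val :: "('a, 'b) monoid_scheme \<Rightarrow> 'a word \<Rightarrow> 'a" where
  "word_val F w = foldr (\<lambda>l g. letter_val F l \<otimes>\<^bsub>F\<^esub> g) w \<one>\<^bsub>F\<^esub>"

definition reduced :: "'a word \<Rightarrow> bool" where
  "reduced w \<longleftrightarrow> successively (\<lambda>l l'. l' \<noteq> (fst l, \<not> snd l)) w"

definition free_basis :: "('a, 'b) monoid_scheme \<Rightarrow> 'a set \<Rightarrow> bool" where
  "free_basis F X \<longleftrightarrow> X \<subseteq> carrier F \<and>
     (\<forall>g\<in>carrier F. \<exists>!w. w \<in> lists (X \<times> UNIV) \<and> reduced w \<and> word_val F w = g)"

definition primitive_element :: "('a, 'b) monoid_scheme \<Rightarrow> 'a \<Rightarrow> bool" where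
  "primitive_element F g \<longleftrightarrow> (\<exists>Y. free_basis F Y \<and> g \<in> Y)"

definition proper_power :: "('a, 'b) monoid_scheme \<Rightarrow> 'a \<Rightarrow> bool" where
  "proper_power F g \<longleftrightarrow> (\<exists>f\<in>carrier F. \<exists>m::nat. m > 1 \<and> g = f [^]\<^bsub>F\<^esub> m)"

definition conj_class :: "('a, 'b) monoid_scheme \<Rightarrow> 'a \<Rightarrow> 'a set" where
  "conj_class F g = {h \<otimes>\<^bsub>F\<^esub> g \<otimes>\<^bsub>F\<^esub> inv\<^bsub>F\<^esub> h |h. h \<in> carrier F}"

definition Inn :: "('a, 'b) monoid_scheme \<Rightarrow> ('a \<Rightarrow> 'a) set" where
  "Inn F = {(\<lambda>x\<in>carrier F. h \<otimes>\<^bsub>F\<^esub> x \<otimes>\<^bsub>F\<^esub> inv\<^bsub>F\<^esub> h) |h. h \<in> carrier F}"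

definition OutGroup :: "('a, 'b) monoid_scheme \<Rightarrow> ('a \<Rightarrow> 'a) set monoid" where
  "OutGroup F = AutoGroup F Mod Inn F"


section \<open>The Gromov boundary\<close>

text \<open>Here \<open>M\<close> is the point set of a hyperbolic space with metric \<open>d\<close>, and \<open>b\<close> is a base point.
  Boundary points are equivalence classes of sequences converging to infinity.\<close>

definition gromov_product :: "('a \<Rightarrow> 'a \<Rightarrow> real) \<Rightarrow> 'a \<Rightarrow> 'a \<Rightarrow> 'a \<Rightarrow> real" where
  "gromov_product d b x y = (d b x + d b y - d x y) / 2"

definition gromov_seqs :: "'a set \<Rightarrow> ('a \<Rightarrow> 'a \<Rightarrow> real) \<Rightarrow> 'a \<Rightarrow> (nat \<Rightarrow> 'a) set" where
  "gromov_seqs M d b = {s. range s \<subseteq> M \<and>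
     filterlim (\<lambda>(i, j). gromov_product d b (s i) (s j)) at_top (sequentially \<times>\<^sub>F sequentially)}"

definition gromov_rel ::
  "'a set \<Rightarrow> ('a \<Rightarrow> 'a \<Rightarrow> real) \<Rightarrow> 'a \<Rightarrow> ((nat \<Rightarrow> 'a) \<times> (nat \<Rightarrow> 'a)) set" where
  "gromov_rel M d b = {(s, t). s \<in> gromov_seqs M d b \<and> t \<in> gromov_seqs M d b \<and>
     filterlim (\<lambda>(i, j). gromov_product d b (s i) (t j)) at_top (sequentially \<times>\<^sub>F sequentially)}"

definition gromov_boundary ::
  "'a set \<Rightarrow> ('a \<Rightarrow> 'a \<Rightarrow> real) \<Rightarrow> 'a \<Rightarrow> (nat \<Rightarrow> 'a) set set" where
  "gromov_boundary M d b = gromov_seqs M d b // gromov_rel M d b"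

definition gromov_nbhd ::
  "'a set \<Rightarrow> ('a \<Rightarrow> 'a \<Rightarrow> real) \<Rightarrow> 'a \<Rightarrow> (nat \<Rightarrow> 'a) set \<Rightarrow> real \<Rightarrow> (nat \<Rightarrow> 'a) set set" where
  "gromov_nbhd M d b \<zeta> r = {\<xi> \<in> gromov_boundary M d b. \<exists>s\<in>\<zeta>. \<exists>t\<in>\<xi>.
     Liminf (sequentially \<times>\<^sub>F sequentially)
       (\<lambda>(i, j). ereal (gromov_product d b (s i) (t j))) \<ge> ereal r}"

text \<open>The topology in which the sets \<open>gromov_nbhd M d b \<zeta> r\<close>, for \<open>r\<close> in the reals, form a
  neighbourhood basis at \<open>\<zeta>\<close>.\<close>

definition gromov_topology ::
  "'a set \<Rightarrow> ('a \<Rightarrow> 'a \<Rightarrow> real) \<Rightarrow> 'a \<Rightarrow> (nat \<Rightarrow> 'a) set topology" where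
  "gromov_topology M d b = topology (\<lambda>U. U \<subseteq> gromov_boundary M d b \<and>
     (\<forall>\<zeta>\<in>U. \<exists>r. gromov_nbhd M d b \<zeta> r \<subseteq> U))"

lemma gromov_nbhd_mono:
  assumes "r \<le> r'"
  shows "gromov_nbhd M d b \<zeta> r' \<subseteq> gromov_nbhd M d b \<zeta> r"
proof -
  have "ereal r \<le> u" if "ereal r' \<le> u" for u
    using assms that by (meson ereal_less_eq(3) order_trans)
  then show ?thesis
    unfolding gromov_nbhd_def by blast
qed

lemma openin_gromov_topology:
  "openin (gromov_topology M d b) U \<longleftrightarrow> U \<subseteq> gromov_boundary M d b \<and>
     (\<forall>\<zeta>\<in>U. \<exists>r. gromov_nbhd M d b \<zeta> r \<subseteq> U)"
proof -
  have "istopology (\<lambda>U. U \<subseteq> gromov_boundary M d b \<and>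
     (\<forall>\<zeta>\<in>U. \<exists>r. gromov_nbhd M d b \<zeta> r \<subseteq> U))"
    unfolding istopology_def
  proof (intro conjI allI impI ballI)
    fix S T \<zeta>
    assume S: "S \<subseteq> gromov_boundary M d b \<and> (\<forall>\<zeta>\<in>S. \<exists>r. gromov_nbhd M d b \<zeta> r \<subseteq> S)"
      and T: "T \<subseteq> gromov_boundary M d b \<and> (\<forall>\<zeta>\<in>T. \<exists>r. gromov_nbhd M d b \<zeta> r \<subseteq> T)"
      and \<zeta>: "\<zeta> \<in> S \<inter> T"
    obtain r r' where "gromov_nbhd M d b \<zeta> r \<subseteq> S" "gromov_nbhd M d b \<zeta> r' \<subseteq> T"
      using S T \<zeta> by blast
    then have "gromov_nbhd M d b \<zeta> (max r r') \<subseteq> S \<inter> T"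
      using gromov_nbhd_mono[of r "max r r'" M d b \<zeta>] gromov_nbhd_mono[of r' "max r r'" M d b \<zeta>]
      by auto
    then show "\<exists>r. gromov_nbhd M d b \<zeta> r \<subseteq> S \<inter> T" ..
  next
    fix K \<zeta>
    assume K: "\<forall>U\<in>K. U \<subseteq> gromov_boundary M d b \<and> (\<forall>\<zeta>\<in>U. \<exists>r. gromov_nbhd M d b \<zeta> r \<subseteq> U)"
      and "\<zeta> \<in> \<Union>K"
    then obtain U r where "U \<in> K" "gromov_nbhd M d b \<zeta> r \<subseteq> U"
      by blast
    then show "\<exists>r. gromov_nbhd M d b \<zeta> r \<subseteq> \<Union>K" by blast
  qed auto
  then show ?thesis
    by (simp add: gromov_topology_def topology_inverse')
qed

lemma topspace_gromov_topology [simp]: "topspace (gromov_topology M d b) = gromov_boundary M d b"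
proof -
  have "openin (gromov_topology M d b) (gromov_boundary M d b)"
    by (auto simp: openin_gromov_topology gromov_nbhd_def)
  then show ?thesis
    using openin_subset openin_topspace openin_gromov_topology by (metis subset_antisym)
qed


section \<open>The boundary of a free group\<close>

text \<open>The Gromov boundary of \<open>F\<close> is formed in the word metric of a chosen free basis \<open>X\<close>, with
  base point the neutral element.\<close>

definition word_length :: "('a, 'b) monoid_scheme \<Rightarrow> 'a set \<Rightarrow> 'a \<Rightarrow> nat" where
  "word_length F X g = (LEAST n. \<exists>w. w \<in> lists (X \<times> UNIV) \<and> length w = n \<and> word_val F w = g)"

definition word_dist :: "('a, 'b) monoid_scheme \<Rightarrow> 'a set \<Rightarrow> 'a \<Rightarrow> 'a \<Rightarrow> real" where
  "word_dist F X x y = real (word_length F X (inv\<^bsub>F\<^esub> x \<otimes>\<^bsub>F\<^esub> y))"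

definition bd_rel ::
  "('a, 'b) monoid_scheme \<Rightarrow> 'a set \<Rightarrow> ((nat \<Rightarrow> 'a) \<times> (nat \<Rightarrow> 'a)) set" where
  "bd_rel F X = gromov_rel (carrier F) (word_dist F X) \<one>\<^bsub>F\<^esub>"

definition bd_topology ::
  "('a, 'b) monoid_scheme \<Rightarrow> 'a set \<Rightarrow> (nat \<Rightarrow> 'a) set topology" where
  "bd_topology F X = gromov_topology (carrier F) (word_dist F X) \<one>\<^bsub>F\<^esub>"

text \<open>The limit in the boundary of a sequence converging to infinity.\<close>

definition bd_limit :: "('a, 'b) monoid_scheme \<Rightarrow> 'a set \<Rightarrow> (nat \<Rightarrow> 'a) \<Rightarrow> (nat \<Rightarrow> 'a) set" where
  "bd_limit F X s = bd_rel F X `` {s}"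

text \<open>The extension of \<open>f\<close> to the boundary, sending the limit of \<open>s\<close> to the limit of \<open>f \<circ> s\<close>;
  it is used for automorphisms of \<open>F\<close> and for left translations.\<close>

definition bd_map ::
  "('a, 'b) monoid_scheme \<Rightarrow> 'a set \<Rightarrow> ('a \<Rightarrow> 'a) \<Rightarrow> (nat \<Rightarrow> 'a) set \<Rightarrow> (nat \<Rightarrow> 'a) set" where
  "bd_map F X f \<zeta> = (\<Union>s\<in>\<zeta>. bd_limit F X (f \<circ> s))"

type_synonym 'a bd_pair = "(nat \<Rightarrow> 'a) set \<times> (nat \<Rightarrow> 'a) set"

definition bd2_topology :: "('a, 'b) monoid_scheme \<Rightarrow> 'a set \<Rightarrow> 'a bd_pair topology" where
  "bd2_topology F X =
     subtopology (prod_topology (bd_topology F X) (bd_topology F X)) {(\<zeta>, \<xi>). \<zeta> \<noteq> \<xi>}"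


section \<open>Geodesic currents\<close>

definition borel_of :: "'a topology \<Rightarrow> 'a measure" where
  "borel_of T = sigma (topspace T) {U. openin T U}"

text \<open>This is meant for locally compact Hausdorff spaces, where finiteness on compact sets is
  the same as local finiteness and compact sets are Borel.\<close>

definition radon_measure :: "'a topology \<Rightarrow> 'a measure \<Rightarrow> bool" where
  "radon_measure T \<mu> \<longleftrightarrow> sets \<mu> = sets (borel_of T) \<and>
     (\<forall>K. compactin T K \<longrightarrow> emeasure \<mu> K < \<infinity>) \<and>
     (\<forall>A\<in>sets \<mu>. emeasure \<mu> A = (SUP K\<in>{K. compactin T K \<and> K \<subseteq> A}. emeasure \<mu> K))"

text \<open>The push-forward \<open>S \<mapsto> \<nu> (f\<^sup>-\<^sup>1 S)\<close> under the map induced on pairs of boundary points.\<close>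

definition push ::
  "('a, 'b) monoid_scheme \<Rightarrow> 'a set \<Rightarrow> ('a \<Rightarrow> 'a) \<Rightarrow> 'a bd_pair measure \<Rightarrow> 'a bd_pair measure" where
  "push F X f \<nu> =
     distr \<nu> (borel_of (bd2_topology F X)) (map_prod (bd_map F X f) (bd_map F X f))"

definition currents :: "('a, 'b) monoid_scheme \<Rightarrow> 'a set \<Rightarrow> 'a bd_pair measure set" where
  "currents F X = {\<nu>. radon_measure (bd2_topology F X) \<nu> \<and>
     (\<forall>h\<in>carrier F. push F X (\<lambda>x. h \<otimes>\<^bsub>F\<^esub> x) \<nu> = \<nu>) \<and>
     distr \<nu> (borel_of (bd2_topology F X)) prod.swap = \<nu>}"

definition disjoint_clopens ::
  "('a, 'b) monoid_scheme \<Rightarrow> 'a set \<Rightarrow> ((nat \<Rightarrow> 'a) set set \<times> (nat \<Rightarrow> 'a) set set) set" where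
  "disjoint_clopens F X = {(S, S').
     openin (bd_topology F X) S \<and> closedin (bd_topology F X) S \<and>
     openin (bd_topology F X) S' \<and> closedin (bd_topology F X) S' \<and> S \<inter> S' = {}}"

text \<open>The coarsest topology making all evaluations \<open>\<nu> \<mapsto> \<nu> (S \<times> S')\<close> continuous. These values are
  finite since \<open>S \<times> S'\<close> is compact in the space of pairs of distinct points.\<close>

definition currents_topology ::
  "('a, 'b) monoid_scheme \<Rightarrow> 'a set \<Rightarrow> 'a bd_pair measure topology" where
  "currents_topology F X = pullback_topology (currents F X)
     (\<lambda>\<nu>. \<lambda>(S, S')\<in>disjoint_clopens F X. measure \<nu> (S \<times> S'))
     (product_topology (\<lambda>_. euclideanreal) (disjoint_clopens F X))"

definition nonzero_currents :: "('a, 'b) monoid_scheme \<Rightarrow> 'a set \<Rightarrow> 'a bd_pair measure set" where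
  "nonzero_currents F X = {\<nu> \<in> currents F X. emeasure \<nu> (space \<nu>) \<noteq> 0}"


section \<open>Projectivized currents\<close>

definition proj_rel ::
  "('a, 'b) monoid_scheme \<Rightarrow> 'a set \<Rightarrow> ('a bd_pair measure \<times> 'a bd_pair measure) set" where
  "proj_rel F X = {(\<mu>, \<nu>). \<mu> \<in> nonzero_currents F X \<and> \<nu> \<in> nonzero_currents F X \<and>
     (\<exists>c::real. c > 0 \<and> \<nu> = scale_measure (ennreal c) \<mu>)}"

definition proj_class ::
  "('a, 'b) monoid_scheme \<Rightarrow> 'a set \<Rightarrow> 'a bd_pair measure \<Rightarrow> 'a bd_pair measure set" where
  "proj_class F X \<nu> = proj_rel F X `` {\<nu>}"

definition quotient_topology :: "'a topology \<Rightarrow> ('a \<Rightarrow> 'b) \<Rightarrow> 'b topology" where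
  "quotient_topology T f =
     topology (\<lambda>U. U \<subseteq> f ` topspace T \<and> openin T {x \<in> topspace T. f x \<in> U})"

lemma openin_quotient_topology:
  "openin (quotient_topology T f) U \<longleftrightarrow>
     U \<subseteq> f ` topspace T \<and> openin T {x \<in> topspace T. f x \<in> U}"
proof -
  have "istopology (\<lambda>U. U \<subseteq> f ` topspace T \<and> openin T {x \<in> topspace T. f x \<in> U})"
    unfolding istopology_def
  proof (intro conjI allI impI)
    fix S S'
    assume "S \<subseteq> f ` topspace T \<and> openin T {x \<in> topspace T. f x \<in> S}"
      and "S' \<subseteq> f ` topspace T \<and> openin T {x \<in> topspace T. f x \<in> S'}"
    then have "openin T ({x \<in> topspace T. f x \<in> S} \<inter> {x \<in> topspace T. f x \<in> S'})"
      by blast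
    moreover have "{x \<in> topspace T. f x \<in> S} \<inter> {x \<in> topspace T. f x \<in> S'} =
        {x \<in> topspace T. f x \<in> S \<inter> S'}" by blast
    ultimately show "openin T {x \<in> topspace T. f x \<in> S \<inter> S'}" by simp
  next
    fix K
    assume K: "\<forall>U\<in>K. U \<subseteq> f ` topspace T \<and> openin T {x \<in> topspace T. f x \<in> U}"
    then have "openin T (\<Union>U\<in>K. {x \<in> topspace T. f x \<in> U})" by blast
    moreover have "(\<Union>U\<in>K. {x \<in> topspace T. f x \<in> U}) = {x \<in> topspace T. f x \<in> \<Union>K}" by blast
    ultimately show "openin T {x \<in> topspace T. f x \<in> \<Union>K}" by simp
  qed auto
  then show ?thesis
    by (simp add: quotient_topology_def topology_inverse')
qed

lemma quotient_map_quotient_topology: "quotient_map T (quotient_topology T f) f"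
proof -
  have "{x \<in> topspace T. f x \<in> f ` topspace T} = topspace T"
    by blast
  then have "openin (quotient_topology T f) (f ` topspace T)"
    by (simp add: openin_quotient_topology)
  then have "topspace (quotient_topology T f) = f ` topspace T"
    using openin_subset openin_topspace openin_quotient_topology by (metis subset_antisym)
  then show ?thesis
    by (auto simp: quotient_map_def openin_quotient_topology)
qed

definition PCurr :: "('a, 'b) monoid_scheme \<Rightarrow> 'a set \<Rightarrow> 'a bd_pair measure set topology" where
  "PCurr F X = quotient_topology
     (subtopology (currents_topology F X) (nonzero_currents F X)) (proj_class F X)"

text \<open>The action of an outer automorphism, given as a coset of inner automorphisms, through any of
  its representatives: all sets in the union are equal.\<close>

definition out_act ::
  "('a, 'b) monoid_scheme \<Rightarrow> 'a set \<Rightarrow> ('a \<Rightarrow> 'a) set \<Rightarrow> 'a bd_pair measure set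
     \<Rightarrow> 'a bd_pair measure set" where
  "out_act F X \<Phi> p = (\<Union>\<phi>\<in>\<Phi>. \<Union>\<nu>\<in>p. proj_class F X (push F X \<phi> \<nu>))"

definition out_invariant ::
  "('a, 'b) monoid_scheme \<Rightarrow> 'a set \<Rightarrow> 'a bd_pair measure set set \<Rightarrow> bool" where
  "out_invariant F X Z \<longleftrightarrow> (\<forall>\<Phi>\<in>carrier (OutGroup F). out_act F X \<Phi> ` Z \<subseteq> Z)"


section \<open>Rational currents\<close>

definition pole_pair :: "('a, 'b) monoid_scheme \<Rightarrow> 'a set \<Rightarrow> 'a \<Rightarrow> 'a bd_pair" where
  "pole_pair F X h =
     (bd_limit F X (\<lambda>n. (inv\<^bsub>F\<^esub> h) [^]\<^bsub>F\<^esub> n), bd_limit F X (\<lambda>n. h [^]\<^bsub>F\<^esub> n))"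

text \<open>The integral over the counting measure is the sum over the conjugacy class of \<open>g\<close>, and the
  indicator functions are the values of Dirac measures on \<open>A\<close>.\<close>

definition counting_current ::
  "('a, 'b) monoid_scheme \<Rightarrow> 'a set \<Rightarrow> 'a \<Rightarrow> 'a bd_pair measure" where
  "counting_current F X g =
     measure_of (topspace (bd2_topology F X)) (sets (borel_of (bd2_topology F X)))
       (\<lambda>A. \<integral>\<^sup>+h. indicator A (pole_pair F X h) + indicator A (prod.swap (pole_pair F X h))
          \<partial>count_space (conj_class F g))"

text \<open>Meant for nontrivial \<open>g\<close>; in the second case the pair of \<open>f\<close> and \<open>m\<close> is unique.\<close>

definition rational_current ::
  "('a, 'b) monoid_scheme \<Rightarrow> 'a set \<Rightarrow> 'a \<Rightarrow> 'a bd_pair measure" where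
  "rational_current F X g =
     (if \<not> proper_power F g then counting_current F X g
      else (case (SOME (f, m). f \<in> carrier F \<and> \<not> proper_power F f \<and> m > 1 \<and> g = f [^]\<^bsub>F\<^esub> (m::nat))
            of (f, m) \<Rightarrow> scale_measure (of_nat m) (counting_current F X f)))"

definition M_PCurr :: "('a, 'b) monoid_scheme \<Rightarrow> 'a set \<Rightarrow> 'a bd_pair measure set set" where
  "M_PCurr F X = PCurr F X closure_of
     {proj_class F X (rational_current F X g) |g. primitive_element F g}"

end

theory Submission
  imports Defs
begin

text \<open>
  Let \<open>Z\<close> be a non-empty closed \<open>Out(F)\<close>-invariant set of projective currents, and let
  \<open>\<nu>\<close> be a non-zero current with class in \<open>Z\<close>. In the Cayley tree of the basis \<open>X\<close> some
  turn is charged by \<open>\<nu>\<close>: there are letters \<open>u \<noteq> y\<close> such that the lines from the half-tree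
  behind \<open>u\<close> to the half-tree behind \<open>y\<close> have positive mass \<open>\<delta>\<close>
  (\<open>nonzero_current_charges_turn\<close>). Since the rank is at least three, there is a basis element
  \<open>c\<close> that occurs in neither letter. The automorphism that replaces \<open>u\<close> by \<open>c\<^sup>n u\<close> and fixes
  the other basis elements stretches each of these lines along \<open>n\<close> edges labelled \<open>c\<close>, so
  the push-forward of \<open>\<nu>\<close> has mass at least \<open>n \<delta>\<close> on the lines crossing a \<open>c\<close>-edge
  (\<open>edge_mass_twist_growth\<close>), while the mass on the lines crossing any other edge stays what it
  was (\<open>edge_mass_twist\<close>). After normalisation the other edges lose all their mass. This
  already forces convergence to the counting current of \<open>c\<close> (\<open>edge_convergence\<close>): the mass of
  the lines that contain a path with an edge not labelled \<open>c\<close> tends to zero, and the mass of the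
  lines that contain a path along the axis of \<open>c\<close> is that of a single edge, up to such negligible
  terms. So \<open>Z\<close> contains the class of \<open>\<mu>\<^sub>c\<close>, hence by invariance the classes of all primitive elements, hence
  their closure.

  That the closure is itself invariant follows from the equality of the push-forward of
  \<open>\<mu>\<^sub>g\<close> under \<open>\<phi>\<close> with the current of \<open>\<phi>(g)\<close>, and from the continuity of the action.

  Two devices keep the boundary manageable. Automorphisms distort the word metric, but they preserve
  the almost invariant subsets of the group (those with finite coboundary in the Cayley graph), and
  for sequences that leave every finite set both convergence to the boundary and equality of limits
  can be expressed by eventual membership in almost invariant sets (\<open>seqsI\<close>, \<open>bd_rel_iff_almost_invariant\<close>). Therefore automorphisms and
  left translations extend to homeomorphisms of the boundary, and an almost invariant set
  \<open>A\<close> determines a clopen set \<open>bdset A\<close> on which they act as they act on \<open>A\<close>. Secondly, the masses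
  \<open>mass \<nu> A C\<close> of the lines between two disjoint almost invariant sets carry all estimates, so
  the combinatorics takes place in the group itself.
\<close>


section \<open>Reduced words and normal forms\<close>

definition linv :: "'a \<times> bool \<Rightarrow> 'a \<times> bool" where
  "linv l = (fst l, \<not> snd l)"

lemma linv_linv [simp]: "linv (linv l) = l"
  by (simp add: linv_def)

lemma fst_linv [simp]: "fst (linv l) = fst l"
  by (simp add: linv_def)

lemma linv_neq [simp]: "linv l \<noteq> l" "l \<noteq> linv l"
  by (metis linv_def snd_conv)+

lemma linv_inj [simp]: "linv a = linv b \<longleftrightarrow> a = b"
  by (metis linv_linv)

lemma same_fst_letters: "fst a = fst b \<longleftrightarrow> a = b \<or> a = linv b"
  by (auto simp: linv_def prod_eq_iff)

lemma reduced_Nil [simp]: "reduced []"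
  by (simp add: reduced_def)

lemma reduced_single [simp]: "reduced [l]"
  by (simp add: reduced_def)

lemma reduced_Cons: "reduced (l # w) \<longleftrightarrow> reduced w \<and> (w \<noteq> [] \<longrightarrow> hd w \<noteq> linv l)"
  by (auto simp: reduced_def successively_Cons linv_def)

lemma reduced_append:
  "reduced (u @ v) \<longleftrightarrow>
     reduced u \<and> reduced v \<and> (u \<noteq> [] \<longrightarrow> v \<noteq> [] \<longrightarrow> hd v \<noteq> linv (last u))"
  by (auto simp: reduced_def successively_append_iff linv_def)

definition winv :: "'a word \<Rightarrow> 'a word" where
  "winv w = rev (map linv w)"

lemma winv_simps [simp]:
  "winv [] = []" "winv (u @ v) = winv v @ winv u" "length (winv w) = length w"
  "winv (l # w) = winv w @ [linv l]" "winv w = [] \<longleftrightarrow> w = []"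
  by (auto simp: winv_def)

lemma winv_hd_last:
  assumes "w \<noteq> []"
  shows "hd (winv w) = linv (last w)" "last (winv w) = linv (hd w)"
  using assms by (auto simp: winv_def hd_rev last_rev hd_map last_map)

lemma reduced_winv [simp]: "reduced (winv w) \<longleftrightarrow> reduced w"
proof -
  have "reduced (winv w)" if "reduced w" for w :: "'a word"
    using that
  proof (induction w)
    case (Cons l w)
    then show ?case
      by (auto simp: reduced_append reduced_Cons winv_hd_last)
  qed simp
  moreover have "winv (winv w) = w"
    by (simp add: winv_def rev_map comp_def)
  ultimately show ?thesis by metis
qed

lemma reduced_replicate [simp]: "reduced (replicate n l)"
  by (induction n) (auto simp: reduced_Cons hd_replicate)

lemma split_at_first_difference:
  assumes "length p = length q" "p \<noteq> q"
  obtains r a p' b q' where "p = r @ a # p'" "q = r @ b # q'" "a \<noteq> b"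
  using assms
proof (induction p q arbitrary: thesis rule: list_induct2)
  case (Cons x p y q)
  show ?case
  proof (cases "x = y")
    case True
    then have "p \<noteq> q" using Cons.prems by simp
    then obtain r a p' b q' where "p = r @ a # p'" "q = r @ b # q'" "a \<noteq> b"
      using Cons.IH by blast
    then show ?thesis
      using True Cons.prems(1)[of "x # r"] by simp
  next
    case False
    then show ?thesis
      using Cons.prems(1)[of "[]"] by simp
  qed
qed simp

locale free_group = group F for F :: "('a, 'b) monoid_scheme" (structure) +
  fixes X :: "'a set"
  assumes basis: "free_basis F X"
begin

abbreviation letters :: "('a \<times> bool) set" where
  "letters \<equiv> X \<times> UNIV"

abbreviation lval :: "'a \<times> bool \<Rightarrow> 'a" where
  "lval \<equiv> letter_val F"

abbreviation wval :: "'a word \<Rightarrow> 'a" where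
  "wval \<equiv> word_val F"

definition nf :: "'a \<Rightarrow> 'a word" where
  "nf g = (THE w. w \<in> lists letters \<and> reduced w \<and> wval w = g)"

lemma linv_letters [simp]: "linv l \<in> letters \<longleftrightarrow> l \<in> letters"
  by (cases l) (auto simp: linv_def)

lemma winv_letters [simp]: "winv w \<in> lists letters \<longleftrightarrow> w \<in> lists letters"
  by (induction w) auto

lemma basis_carrier: "x \<in> X \<Longrightarrow> x \<in> carrier F"
  using basis by (auto simp: free_basis_def)

lemma lval_closed [simp]: "l \<in> letters \<Longrightarrow> lval l \<in> carrier F"
  by (auto simp: letter_val_def basis_carrier)

lemma lval_linv: "l \<in> letters \<Longrightarrow> lval (linv l) = inv (lval l)"
  by (auto simp: letter_val_def basis_carrier linv_def)

lemma wval_simps [simp]: "wval [] = \<one>" "wval (l # w) = lval l \<otimes> wval w"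
  by (auto simp: word_val_def)

lemma wval_closed [simp]: "w \<in> lists letters \<Longrightarrow> wval w \<in> carrier F"
  by (induction w) auto

lemma wval_append:
  "u \<in> lists letters \<Longrightarrow> v \<in> lists letters \<Longrightarrow> wval (u @ v) = wval u \<otimes> wval v"
  by (induction u) (auto simp: m_assoc)

lemma wval_winv: "w \<in> lists letters \<Longrightarrow> wval (winv w) = inv (wval w)"
  by (induction w) (auto simp: wval_append lval_linv inv_mult_group)

lemma
  assumes "g \<in> carrier F"
  shows nf_lists [simp]: "nf g \<in> lists letters"
    and nf_reduced [simp]: "reduced (nf g)"
    and wval_nf [simp]: "wval (nf g) = g"
proof -
  have "\<exists>!w. w \<in> lists letters \<and> reduced w \<and> wval w = g"
    using basis assms unfolding free_basis_def by blast
  from theI'[OF this]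
  show "nf g \<in> lists letters" "reduced (nf g)" "wval (nf g) = g"
    by (auto simp: nf_def)
qed

lemma nf_wval [simp]:
  assumes "w \<in> lists letters" "reduced w"
  shows "nf (wval w) = w"
proof -
  have "\<exists>!v. v \<in> lists letters \<and> reduced v \<and> wval v = wval w"
    using basis wval_closed[OF assms(1)] unfolding free_basis_def by blast
  then show ?thesis
    unfolding nf_def by (rule the1_equality) (use assms in auto)
qed

lemma nf_set: "g \<in> carrier F \<Longrightarrow> set (nf g) \<subseteq> letters"
  using nf_lists[of g] by (simp add: lists_eq_set)

lemma nf_inject: "g \<in> carrier F \<Longrightarrow> h \<in> carrier F \<Longrightarrow> nf g = nf h \<longleftrightarrow> g = h"
  by (metis wval_nf)

lemma nf_one [simp]: "nf \<one> = []"
  using nf_wval[of "[]"] by simp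

lemma nf_eq_Nil: "g \<in> carrier F \<Longrightarrow> nf g = [] \<longleftrightarrow> g = \<one>"
  using nf_inject[of g \<one>] by simp

lemma nf_lval [simp]: "l \<in> letters \<Longrightarrow> nf (lval l) = [l]"
  using nf_wval[of "[l]"] by simp

lemma nf_lval_mult:
  assumes "l \<in> letters" "g \<in> carrier F"
  shows "nf (lval l \<otimes> g) = (if nf g \<noteq> [] \<and> hd (nf g) = linv l then tl (nf g) else l # nf g)"
proof (cases "nf g \<noteq> [] \<and> hd (nf g) = linv l")
  case True
  then obtain t where t: "nf g = linv l # t"
    by (metis list.collapse)
  have tl: "t \<in> lists letters" "reduced t"
    using nf_lists[OF assms(2)] nf_reduced[OF assms(2)] t by (auto simp: reduced_Cons)
  have "g = inv (lval l) \<otimes> wval t"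
    using wval_nf[OF assms(2)] t assms lval_linv by simp
  then have "lval l \<otimes> g = wval t"
    using assms tl by (simp add: m_assoc[symmetric])
  then show ?thesis
    using True t tl by simp
next
  case False
  then have "reduced (l # nf g)"
    using assms by (auto simp: reduced_Cons)
  then have "nf (wval (l # nf g)) = l # nf g"
    using assms nf_wval by (metis Cons_in_lists_iff nf_lists)
  then show ?thesis
    using False assms by auto
qed

lemma nf_mult_reduced:
  assumes "w \<in> lists letters" "g \<in> carrier F" "reduced (w @ nf g)"
  shows "nf (wval w \<otimes> g) = w @ nf g"
  using nf_wval[of "w @ nf g"] assms by (simp add: wval_append)

lemma word_length_eq:
  assumes "g \<in> carrier F"
  shows "word_length F X g = length (nf g)"
  unfolding word_length_def
proof (rule Least_equality)
  show "\<exists>w. w \<in> lists letters \<and> length w = length (nf g) \<and> wval w = g"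
    using assms nf_lists wval_nf by blast
  have "length (nf (wval w)) \<le> length w" if "w \<in> lists letters" for w
    using that
  proof (induction w)
    case (Cons l w)
    then show ?case by (auto simp: nf_lval_mult)
  qed simp
  then show "length (nf g) \<le> n" if "\<exists>w. w \<in> lists letters \<and> length w = n \<and> wval w = g" for n
    using that by blast
qed

text \<open>Homomorphisms out of a free group are defined by evaluating normal forms; compatibility with
  multiplication reduces to multiplication by one letter.\<close>

lemma free_group_extend_hom:
  fixes H :: "('c, 'd) monoid_scheme"
  assumes "group H" "a \<in> X \<rightarrow> carrier H"
  obtains f where "f \<in> hom F H" "\<And>x. x \<in> X \<Longrightarrow> f x = a x"
    "\<And>g. g \<in> carrier F \<Longrightarrow> f g = word_val H (map (map_prod a id) (nf g))"
proof -
  interpret H: group H by fact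
  let ?m = "map_prod a id :: 'a \<times> bool \<Rightarrow> 'c \<times> bool"
  define e where "e w = word_val H (map ?m w)" for w
  have e_simps [simp]: "e [] = \<one>\<^bsub>H\<^esub>" "e (l # w) = letter_val H (?m l) \<otimes>\<^bsub>H\<^esub> e w" for l w
    by (auto simp: e_def word_val_def)
  have cl [simp]: "letter_val H (?m l) \<in> carrier H" if "l \<in> letters" for l
    using that assms(2) by (auto simp: letter_val_def Pi_iff)
  have ecl [simp]: "e w \<in> carrier H" if "w \<in> lists letters" for w
    using that by (induction w) auto
  have li: "letter_val H (?m (linv l)) = inv\<^bsub>H\<^esub> (letter_val H (?m l))" if "l \<in> letters" for l
    using that assms(2) by (auto simp: letter_val_def Pi_iff linv_def)
  define f where "f g = e (nf g)" for g
  have fcl: "f g \<in> carrier H" if "g \<in> carrier F" for g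
    using that by (simp add: f_def)
  have fl: "f (lval l \<otimes> g) = letter_val H (?m l) \<otimes>\<^bsub>H\<^esub> f g" if l: "l \<in> letters" and g: "g \<in> carrier F" for l g
  proof (cases "nf g \<noteq> [] \<and> hd (nf g) = linv l")
    case True
    then obtain t where t: "nf g = linv l # t"
      by (metis list.collapse)
    moreover have "t \<in> lists letters"
      using nf_lists[OF g] t by auto
    ultimately show ?thesis
      using True l g by (simp add: f_def nf_lval_mult li H.m_assoc[symmetric])
  qed (use l g in \<open>auto simp: f_def nf_lval_mult\<close>)
  have "f (wval w \<otimes> h) = e w \<otimes>\<^bsub>H\<^esub> f h" if "w \<in> lists letters" "h \<in> carrier F" for w h
    using that
  proof (induction w)
    case Nil
    then show ?case by (simp add: f_def)
  next
    case (Cons l w)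
    then show ?case
      by (simp add: m_assoc fl H.m_assoc fcl)
  qed
  from this[of "nf _"] have mult: "f (g \<otimes> h) = f g \<otimes>\<^bsub>H\<^esub> f h" if "g \<in> carrier F" "h \<in> carrier F" for g h
    using that by (metis f_def nf_lists wval_nf)
  have "f \<in> hom F H"
    by (auto simp: hom_def mult fcl)
  moreover have "f x = a x" if "x \<in> X" for x
  proof -
    have "nf x = [(x, True)]"
      using nf_lval[of "(x, True)"] that by (simp add: letter_val_def)
    then show ?thesis
      using that assms(2) by (simp add: f_def letter_val_def Pi_iff)
  qed
  ultimately show ?thesis
    by (rule that) (auto simp: f_def e_def)
qed

lemma hom_lval_linv:
  assumes "f \<in> hom F H" "group H" "l \<in> letters"
  shows "f (lval (linv l)) = inv\<^bsub>H\<^esub> (f (lval l))"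
proof -
  interpret group_hom F H f
    using assms by (simp add: group_hom_def group_hom_axioms_def is_group)
  show ?thesis
    using assms by (simp add: lval_linv)
qed

lemma hom_eqI:
  assumes f: "f \<in> hom F H" and f': "f' \<in> hom F H" and H: "group H"
    and eq: "\<And>x. x \<in> X \<Longrightarrow> f x = f' x" and g: "g \<in> carrier F"
  shows "f g = f' g"
proof -
  interpret f: group_hom F H f
    using f H by (simp add: group_hom_def group_hom_axioms_def is_group)
  interpret f': group_hom F H f'
    using f' H by (simp add: group_hom_def group_hom_axioms_def is_group)
  have l: "f (lval l) = f' (lval l)" if "l \<in> letters" for l
    using that eq by (auto simp: letter_val_def basis_carrier)
  have "f (wval w) = f' (wval w)" if "w \<in> lists letters" for w
    using that by (induction w) (auto simp: l)
  then show ?thesis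
    using g nf_lists wval_nf by metis
qed

end

section \<open>Cylinders and almost invariant sets\<close>

context free_group
begin

definition cyl :: "'a word \<Rightarrow> 'a set" where
  "cyl p = {g \<in> carrier F. \<exists>t. nf g = p @ t}"

lemma cyl_carrier: "cyl p \<subseteq> carrier F"
  by (auto simp: cyl_def)

lemma cyl_in_carrier: "g \<in> cyl p \<Longrightarrow> g \<in> carrier F"
  by (simp add: cyl_def)

lemma cyl_Nil [simp]: "cyl [] = carrier F"
  by (auto simp: cyl_def)

lemma cyl_nonempty_word:
  assumes "g \<in> cyl p"
  shows "p \<in> lists letters" "reduced p"
proof -
  obtain t where t: "nf g = p @ t" and g: "g \<in> carrier F"
    using assms by (auto simp: cyl_def)
  show "p \<in> lists letters" "reduced p"
    using nf_lists[OF g] nf_reduced[OF g] t by (auto simp: reduced_append)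
qed

lemma wval_in_cyl: "p @ t \<in> lists letters \<Longrightarrow> reduced (p @ t) \<Longrightarrow> wval (p @ t) \<in> cyl p"
  unfolding cyl_def using nf_wval[of "p @ t"] wval_closed[of "p @ t"] by blast

lemma wval_in_own_cyl: "p \<in> lists letters \<Longrightarrow> reduced p \<Longrightarrow> wval p \<in> cyl p"
  using wval_in_cyl[of p "[]"] by simp

lemma cyl_append_subset: "cyl (p @ q) \<subseteq> cyl p"
  by (auto simp: cyl_def)

lemma cyl_subset_hd: "p \<noteq> [] \<Longrightarrow> cyl p \<subseteq> cyl [hd p]"
  using cyl_append_subset[of "[hd p]" "tl p"] by simp

lemma cyl_unique: "g \<in> cyl p \<Longrightarrow> g \<in> cyl q \<Longrightarrow> length p = length q \<Longrightarrow> p = q"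
  by (auto simp: cyl_def)

lemma cyl_disjoint: "length p = length q \<Longrightarrow> p \<noteq> q \<Longrightarrow> cyl p \<inter> cyl q = {}"
  using cyl_unique by blast

lemma in_cyl_take: "g \<in> carrier F \<Longrightarrow> g \<in> cyl (take n (nf g))"
  by (auto simp: cyl_def intro: exI[of _ "drop n (nf g)"])

lemma in_cyl_single: "g \<in> cyl [l] \<longleftrightarrow> g \<in> carrier F \<and> nf g \<noteq> [] \<and> hd (nf g) = l"
  by (cases "nf g") (auto simp: cyl_def)

lemma cyl_children:
  "cyl p - {wval p} \<subseteq> (\<Union>z\<in>{z \<in> letters. p = [] \<or> z \<noteq> linv (last p)}. cyl (p @ [z]))"
proof
  fix g assume g: "g \<in> cyl p - {wval p}"
  then obtain t where t: "nf g = p @ t" and gc: "g \<in> carrier F"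
    by (auto simp: cyl_def)
  have "t \<noteq> []"
    using t g gc wval_nf by force
  then obtain z u where t': "t = z # u"
    by (cases t) auto
  have "z \<in> letters" "p = [] \<or> z \<noteq> linv (last p)"
    using nf_lists[OF gc] nf_reduced[OF gc] t t' by (auto simp: reduced_append)
  moreover have "g \<in> cyl (p @ [z])"
    using gc t t' by (auto simp: cyl_def)
  ultimately show "g \<in> (\<Union>z\<in>{z \<in> letters. p = [] \<or> z \<noteq> linv (last p)}. cyl (p @ [z]))"
    by blast
qed

lemma cyl_translate:
  assumes "u @ v \<in> lists letters" "reduced (u @ v)" "v \<noteq> []"
  shows "(\<lambda>g. wval u \<otimes> g) ` cyl v = cyl (u @ v)"
proof (intro equalityI subsetI)
  fix h assume "h \<in> (\<lambda>g. wval u \<otimes> g) ` cyl v"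
  then obtain g t where g: "g \<in> carrier F" "nf g = v @ t" "h = wval u \<otimes> g"
    by (auto simp: cyl_def)
  have "reduced (u @ nf g)"
    using assms g(2) nf_reduced[OF g(1)] by (auto simp: reduced_append)
  then have "nf h = u @ v @ t"
    using nf_mult_reduced[of u g] assms(1) g by simp
  then show "h \<in> cyl (u @ v)"
    using g assms(1) by (auto simp: cyl_def)
next
  fix h assume h: "h \<in> cyl (u @ v)"
  then obtain t where t: "nf h = u @ v @ t"
    by (auto simp: cyl_def)
  have hc: "h \<in> carrier F"
    using h by (rule cyl_in_carrier)
  have "v @ t \<in> lists letters" "reduced (v @ t)"
    using nf_lists[OF hc] nf_reduced[OF hc] t by (auto simp: reduced_append)
  then have "wval (v @ t) \<in> cyl v"
    by (rule wval_in_cyl)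
  moreover have "h = wval u \<otimes> wval (v @ t)"
    using wval_nf[OF hc] nf_lists[OF hc] t wval_append[of u "v @ t"] by simp
  ultimately show "h \<in> (\<lambda>g. wval u \<otimes> g) ` cyl v"
    by blast
qed

lemma left_translate_bij: "h \<in> carrier F \<Longrightarrow> bij_betw (\<lambda>g. h \<otimes> g) (carrier F) (carrier F)"
  by (rule bij_betwI[where g = "\<lambda>g. inv h \<otimes> g"]) (auto simp: m_assoc[symmetric])

lemma left_translate_diff:
  assumes "h \<in> carrier F" "A \<subseteq> carrier F"
  shows "(\<lambda>g. h \<otimes> g) ` (carrier F - A) = carrier F - (\<lambda>g. h \<otimes> g) ` A"
  using left_translate_bij[OF assms(1)] assms(2)
  by (simp add: bij_betw_def inj_on_image_set_diff[of _ "carrier F"])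

lemma left_translate_translate:
  assumes "h \<in> carrier F" "k \<in> carrier F" "A \<subseteq> carrier F"
  shows "(\<lambda>g. h \<otimes> g) ` (\<lambda>g. k \<otimes> g) ` A = (\<lambda>g. (h \<otimes> k) \<otimes> g) ` A"
  using assms by (auto simp: image_image m_assoc subset_iff intro!: image_cong)

text \<open>Crossing the edge from the identity to a letter \<open>l\<close> turns the side that avoids \<open>l\<close>
  into the side of the inverse letter.\<close>

lemma lval_translate_compl:
  assumes "l \<in> letters"
  shows "(\<lambda>g. lval l \<otimes> g) ` (carrier F - cyl [linv l]) = cyl [l]"
proof (intro equalityI subsetI)
  fix h assume "h \<in> (\<lambda>g. lval l \<otimes> g) ` (carrier F - cyl [linv l])"
  then show "h \<in> cyl [l]"
    using assms by (auto simp: in_cyl_single nf_lval_mult)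
next
  fix h assume h: "h \<in> cyl [l]"
  then have hc: "h \<in> carrier F"
    by (rule cyl_in_carrier)
  obtain t where t: "nf h = l # t"
    using h by (auto simp: cyl_def)
  have "t \<in> lists letters" "reduced t" "t \<noteq> [] \<longrightarrow> hd t \<noteq> linv l"
    using nf_lists[OF hc] nf_reduced[OF hc] t by (auto simp: reduced_Cons)
  then have "wval t \<in> carrier F - cyl [linv l]" "h = lval l \<otimes> wval t"
    using wval_nf[OF hc] t by (auto simp: in_cyl_single)
  then show "h \<in> (\<lambda>g. lval l \<otimes> g) ` (carrier F - cyl [linv l])"
    by blast
qed

lemma cyl_snoc_eq_translate_compl:
  assumes "p @ [z] \<in> lists letters" "reduced (p @ [z])"
  shows "cyl (p @ [z]) = (\<lambda>g. wval (p @ [z]) \<otimes> g) ` (carrier F - cyl [linv z])"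
proof -
  have "cyl (p @ [z]) = (\<lambda>g. wval p \<otimes> g) ` (\<lambda>g. lval z \<otimes> g) ` (carrier F - cyl [linv z])"
    using cyl_translate[OF assms] assms by (simp add: lval_translate_compl)
  also have "\<dots> = (\<lambda>g. wval (p @ [z]) \<otimes> g) ` (carrier F - cyl [linv z])"
    using assms by (subst left_translate_translate) (auto simp: wval_append)
  finally show ?thesis .
qed

text \<open>Almost invariance under right translations is the notion through which the boundary is
  accessible independently of the basis: it is visibly preserved by automorphisms and by left
  translations, and the almost invariant sets are, up to finite sets, the finite unions of
  cylinders.\<close>

definition almost_invariant :: "'a set \<Rightarrow> bool" where
  "almost_invariant A \<longleftrightarrow> A \<subseteq> carrier F \<and>
     (\<forall>h\<in>carrier F. finite {g \<in> carrier F. (g \<in> A) \<noteq> (g \<otimes> h \<in> A)})"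

lemma almost_invariant_carrier: "almost_invariant A \<Longrightarrow> A \<subseteq> carrier F"
  by (simp add: almost_invariant_def)

lemma almost_invariant_full: "almost_invariant (carrier F)"
  unfolding almost_invariant_def
proof (intro conjI ballI order_refl)
  fix h assume "h \<in> carrier F"
  then have "{g \<in> carrier F. (g \<in> carrier F) \<noteq> (g \<otimes> h \<in> carrier F)} = {}"
    by auto
  then show "finite {g \<in> carrier F. (g \<in> carrier F) \<noteq> (g \<otimes> h \<in> carrier F)}"
    by (simp only: finite.emptyI)
qed

lemma almost_invariant_Diff:
  assumes "almost_invariant A" "almost_invariant C"
  shows "almost_invariant (A - C)"
  unfolding almost_invariant_def
proof (intro conjI ballI)
  fix h assume "h \<in> carrier F"
  then have "finite ({g \<in> carrier F. (g \<in> A) \<noteq> (g \<otimes> h \<in> A)} \<union> {g \<in> carrier F. (g \<in> C) \<noteq> (g \<otimes> h \<in> C)})"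
    using assms by (simp add: almost_invariant_def)
  then show "finite {g \<in> carrier F. (g \<in> A - C) \<noteq> (g \<otimes> h \<in> A - C)}"
    by (rule rev_finite_subset) auto
qed (use assms in \<open>auto simp: almost_invariant_def\<close>)

lemma right_translate_inj: "h \<in> carrier F \<Longrightarrow> inj_on (\<lambda>g. g \<otimes> h) (carrier F)"
  by (auto simp: inj_on_def)

lemma almost_invariantI:
  assumes "A \<subseteq> carrier F"
    and fin: "\<And>l. l \<in> letters \<Longrightarrow> finite {g \<in> carrier F. (g \<in> A) \<noteq> (g \<otimes> lval l \<in> A)}"
  shows "almost_invariant A"
proof -
  have fw: "finite {g \<in> carrier F. (g \<in> A) \<noteq> (g \<otimes> wval w \<in> A)}" if "w \<in> lists letters" for w
    using that
  proof (induction w)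
    case Nil
    have "{g \<in> carrier F. (g \<in> A) \<noteq> (g \<otimes> wval [] \<in> A)} = {}"
      by auto
    then show ?case by (simp only: finite.emptyI)
  next
    case (Cons l w)
    let ?D = "{g \<in> carrier F. (g \<in> A) \<noteq> (g \<otimes> wval w \<in> A)}"
    have l: "l \<in> letters" and w: "w \<in> lists letters"
      using Cons.hyps by simp_all
    have "finite ((\<lambda>g. g \<otimes> lval l) -` ?D \<inter> carrier F)"
      using Cons.IH right_translate_inj[OF lval_closed[OF l]] by (rule finite_vimage_IntI)
    then have "finite ({g \<in> carrier F. (g \<in> A) \<noteq> (g \<otimes> lval l \<in> A)} \<union>
        ((\<lambda>g. g \<otimes> lval l) -` ?D \<inter> carrier F))"
      using fin[OF l] by simp
    then show ?case
      by (rule rev_finite_subset) (use lval_closed[OF l] wval_closed[OF w] in \<open>auto simp: m_assoc\<close>)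
  qed
  then have "finite {g \<in> carrier F. (g \<in> A) \<noteq> (g \<otimes> h \<in> A)}" if "h \<in> carrier F" for h
    using fw[OF nf_lists[OF that]] wval_nf[OF that] by simp
  then show ?thesis
    using assms(1) unfolding almost_invariant_def by blast
qed

lemma nf_mult_lval:
  assumes "g \<in> carrier F" "l \<in> letters"
  shows "nf (g \<otimes> lval l) = (if nf g \<noteq> [] \<and> last (nf g) = linv l then butlast (nf g) else nf g @ [l])"
proof (cases "nf g \<noteq> [] \<and> last (nf g) = linv l")
  case True
  then obtain w where w: "nf g = w @ [linv l]"
    using append_butlast_last_id[of "nf g"] by metis
  have wl: "w \<in> lists letters" "reduced w"
    using nf_lists[OF assms(1)] nf_reduced[OF assms(1)] w by (auto simp: reduced_append)
  have "g = wval w \<otimes> inv (lval l)"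
    using wval_nf[OF assms(1)] w wl assms lval_linv by (simp add: wval_append)
  then have "g \<otimes> lval l = wval w"
    using assms wl by (simp add: m_assoc)
  then show ?thesis
    using True w wl by simp
next
  case False
  have "reduced (nf g @ [l])"
    using False assms by (auto simp: reduced_append)
  moreover have "nf g @ [l] \<in> lists letters"
    using assms nf_lists by simp
  ultimately have "nf (wval (nf g @ [l])) = nf g @ [l]"
    by (intro nf_wval)
  then show ?thesis
    using False assms by (auto simp: wval_append)
qed

lemma almost_invariant_cyl: "almost_invariant (cyl p)"
proof (rule almost_invariantI)
  fix l assume l: "l \<in> letters"
  have "{g \<in> carrier F. (g \<in> cyl p) \<noteq> (g \<otimes> lval l \<in> cyl p)} \<subseteq> {wval p, wval (butlast p)}"
  proof
    fix g assume g: "g \<in> {g \<in> carrier F. (g \<in> cyl p) \<noteq> (g \<otimes> lval l \<in> cyl p)}"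
    then have gc: "g \<in> carrier F" and ne: "(g \<in> cyl p) \<noteq> (g \<otimes> lval l \<in> cyl p)"
      by auto
    have "nf g = p \<or> nf g = butlast p"
    proof (cases "nf g \<noteq> [] \<and> last (nf g) = linv l")
      case True
      then have b: "nf (g \<otimes> lval l) = butlast (nf g)"
        using nf_mult_lval[OF gc l] by simp
      have g_cyl: "g \<in> cyl p" if p: "g \<otimes> lval l \<in> cyl p"
      proof -
        obtain t where "butlast (nf g) = p @ t"
          using p b by (auto simp: cyl_def)
        then have "nf g = p @ (t @ [last (nf g)])"
          using True append_butlast_last_id[of "nf g"] by simp
        then show ?thesis
          using gc unfolding cyl_def by blast
      qed
      then obtain t where t: "nf g = p @ t" and n: "g \<otimes> lval l \<notin> cyl p"
        using ne by (auto simp: cyl_def)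
      have "t = []"
      proof (rule ccontr)
        assume "t \<noteq> []"
        then have "nf (g \<otimes> lval l) = p @ butlast t"
          using b t by (simp add: butlast_append)
        then show False
          using n gc l by (auto simp: cyl_def)
      qed
      then show ?thesis
        using t by simp
    next
      case False
      then have b: "nf (g \<otimes> lval l) = nf g @ [l]"
        using nf_mult_lval[OF gc l] by auto
      then have "g \<otimes> lval l \<in> cyl p" if "g \<in> cyl p"
        using that gc l by (auto simp: cyl_def)
      then obtain t where t: "nf g @ [l] = p @ t" and n: "g \<notin> cyl p"
        using ne b by (auto simp: cyl_def)
      have "t = []"
      proof (rule ccontr)
        assume "t \<noteq> []"
        then have "nf g = p @ butlast t"
          using t by (metis butlast_append butlast_snoc)
        then show False
          using n gc by (auto simp: cyl_def)
      qed
      then show ?thesis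
        using t by (metis append_Nil2 butlast_snoc)
    qed
    then show "g \<in> {wval p, wval (butlast p)}"
      using wval_nf[OF gc] by auto
  qed
  then show "finite {g \<in> carrier F. (g \<in> cyl p) \<noteq> (g \<otimes> lval l \<in> cyl p)}"
    by (rule finite_subset) simp
qed (rule cyl_carrier)

end


section \<open>Convergence to the boundary\<close>

locale finite_rank_free_group = free_group +
  assumes finite_basis: "finite X"
begin

abbreviation seqs :: "(nat \<Rightarrow> 'a) set" where
  "seqs \<equiv> gromov_seqs (carrier F) (word_dist F X) \<one>"

abbreviation bd :: "(nat \<Rightarrow> 'a) set set" where
  "bd \<equiv> gromov_boundary (carrier F) (word_dist F X) \<one>"

lemma finite_letters: "finite letters"
  using finite_basis by simp

lemma finite_words: "finite {w \<in> lists letters. length w = n}"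
  using finite_lists_length_eq[OF finite_letters, of n]
  by (rule rev_finite_subset) (auto simp: in_lists_conv_set)

lemma finite_ball: "finite {g \<in> carrier F. length (nf g) \<le> n}"
proof (rule inj_on_finite)
  show "inj_on nf {g \<in> carrier F. length (nf g) \<le> n}"
    by (auto simp: inj_on_def nf_inject)
  show "nf ` {g \<in> carrier F. length (nf g) \<le> n} \<subseteq> {w. set w \<subseteq> letters \<and> length w \<le> n}"
    using nf_set by blast
  show "finite {w. set w \<subseteq> letters \<and> length w \<le> n}"
    using finite_letters by (rule finite_lists_length_le)
qed

text \<open>Two normal forms with longest common prefix \<open>p\<close> leave the identity together along
  \<open>p\<close>, so their Gromov product is the length of \<open>p\<close>.\<close>

lemma gromov_product_ge_iff:
  assumes x: "x \<in> carrier F" and y: "y \<in> carrier F"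
  shows "real n \<le> gromov_product (word_dist F X) \<one> x y \<longleftrightarrow>
    (\<exists>p. length p = n \<and> x \<in> cyl p \<and> y \<in> cyl p)"
proof -
  obtain r u v where r: "nf x = r @ u" "nf y = r @ v" "u = [] \<or> v = [] \<or> hd u \<noteq> hd v"
    using longest_common_prefix by blast
  have words: "u \<in> lists letters" "reduced u" "v \<in> lists letters" "reduced v" "r \<in> lists letters"
    using nf_lists[OF x] nf_lists[OF y] nf_reduced[OF x] nf_reduced[OF y] r
    by (auto simp: reduced_append)
  have "inv x \<otimes> y = inv (wval r \<otimes> wval u) \<otimes> (wval r \<otimes> wval v)"
    using words r wval_nf[OF x] wval_nf[OF y] by (simp add: wval_append)
  also have "\<dots> = inv (wval u) \<otimes> (inv (wval r) \<otimes> wval r) \<otimes> wval v"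
    using words by (simp only: inv_mult_group wval_closed m_assoc inv_closed m_closed)
  also have "\<dots> = wval (winv u @ v)"
    using words by (simp add: wval_append wval_winv)
  finally have "inv x \<otimes> y = wval (winv u @ v)" .
  moreover have "reduced (winv u @ v)"
    using words r(3) by (auto simp: reduced_append winv_hd_last)
  ultimately have "nf (inv x \<otimes> y) = winv u @ v"
    using words by simp
  then have "gromov_product (word_dist F X) \<one> x y = length r"
    using x y r by (simp add: gromov_product_def word_dist_def word_length_eq)
  moreover have "n \<le> length r \<longleftrightarrow> (\<exists>p. length p = n \<and> x \<in> cyl p \<and> y \<in> cyl p)"
  proof
    assume "n \<le> length r"
    then have "x \<in> cyl (take n r)" "y \<in> cyl (take n r)"
      using x y r in_cyl_take[of x n] in_cyl_take[of y n] by auto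
    then show "\<exists>p. length p = n \<and> x \<in> cyl p \<and> y \<in> cyl p"
      using \<open>n \<le> length r\<close> by (intro exI[of _ "take n r"]) simp
  next
    assume "\<exists>p. length p = n \<and> x \<in> cyl p \<and> y \<in> cyl p"
    then obtain p s t where p: "length p = n" "nf x = p @ s" "nf y = p @ t"
      by (auto simp: cyl_def)
    show "n \<le> length r"
    proof (rule ccontr)
      assume less: "\<not> n \<le> length r"
      then have "p = r @ drop (length r) p"
        using p r by (metis append_eq_append_conv_if linorder_le_cases append_eq_conv_conj)
      then obtain a q where "p = r @ a # q"
        using less p(1) by (cases "drop (length r) p") auto
      then show False
        using p r by auto
    qed
  qed
  ultimately show ?thesis by simp
qed

lemma gromov_product_tendsto_iff:
  assumes "range s \<subseteq> carrier F" "range t \<subseteq> carrier F"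
  shows "filterlim (\<lambda>(i, j). gromov_product (word_dist F X) \<one> (s i) (t j)) at_top
      (sequentially \<times>\<^sub>F sequentially) \<longleftrightarrow>
    (\<forall>n. \<exists>p. length p = n \<and> (\<forall>\<^sub>F i in sequentially. s i \<in> cyl p) \<and> (\<forall>\<^sub>F i in sequentially. t i \<in> cyl p))"
    (is "?L \<longleftrightarrow> (\<forall>n. ?R n)")
proof -
  let ?P = "\<lambda>n. \<exists>K. \<forall>i\<ge>K. \<forall>j\<ge>K. \<exists>p. length p = n \<and> s i \<in> cyl p \<and> t j \<in> cyl p"
  have st: "s i \<in> carrier F" "t i \<in> carrier F" for i
    using assms by auto
  have "?L \<longleftrightarrow> (\<forall>n. \<forall>\<^sub>F x in sequentially \<times>\<^sub>F sequentially. real n \<le>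
      (case x of (i, j) \<Rightarrow> gromov_product (word_dist F X) \<one> (s i) (t j)))"
    unfolding filterlim_at_top
  proof safe
    fix Z :: real
    assume *: "\<forall>n. \<forall>\<^sub>F x in sequentially \<times>\<^sub>F sequentially. real n \<le>
      (case x of (i, j) \<Rightarrow> gromov_product (word_dist F X) \<one> (s i) (t j))"
    show "\<forall>\<^sub>F x in sequentially \<times>\<^sub>F sequentially. Z \<le>
      (case x of (i, j) \<Rightarrow> gromov_product (word_dist F X) \<one> (s i) (t j))"
      using *[rule_format, of "nat \<lceil>Z\<rceil>"] by eventually_elim (meson order_trans real_nat_ceiling_ge)
  qed blast
  also have "\<dots> \<longleftrightarrow> (\<forall>n. ?P n)"
    by (simp add: eventually_prod_sequentially gromov_product_ge_iff st) meson
  also have "\<dots> \<longleftrightarrow> (\<forall>n. ?R n)"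
  proof (intro iff_allI iffI)
    fix n assume "?P n"
    then obtain K where K: "\<And>i j. i \<ge> K \<Longrightarrow> j \<ge> K \<Longrightarrow> \<exists>p. length p = n \<and> s i \<in> cyl p \<and> t j \<in> cyl p"
      by blast
    then obtain p where p: "length p = n" "s K \<in> cyl p" "t K \<in> cyl p"
      by blast
    have "t j \<in> cyl p" if "j \<ge> K" for j
      using K[of K j] that p cyl_unique by blast
    moreover have "s i \<in> cyl p" if "i \<ge> K" for i
      using K[of i K] that p cyl_unique by blast
    ultimately show "?R n"
      using p(1) unfolding eventually_sequentially by blast
  next
    fix n assume "?R n"
    then obtain p K K' where p: "length p = n" "\<And>i. i \<ge> K \<Longrightarrow> s i \<in> cyl p" "\<And>i. i \<ge> K' \<Longrightarrow> t i \<in> cyl p"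
      unfolding eventually_sequentially by blast
    then show "?P n"
      by (intro exI[of _ "max K K'"]) auto
  qed
  finally show ?thesis .
qed

lemma seqs_carrier: "s \<in> seqs \<Longrightarrow> s i \<in> carrier F"
  by (auto simp: gromov_seqs_def)

lemma seqs_iff:
  "s \<in> seqs \<longleftrightarrow> range s \<subseteq> carrier F \<and>
     (\<forall>n. \<exists>p. length p = n \<and> (\<forall>\<^sub>F i in sequentially. s i \<in> cyl p))"
  using gromov_product_tendsto_iff[of s s] by (auto simp: gromov_seqs_def)

lemma bd_rel_iff:
  "(s, t) \<in> bd_rel F X \<longleftrightarrow> s \<in> seqs \<and> t \<in> seqs \<and>
     (\<forall>n. \<exists>p. length p = n \<and> (\<forall>\<^sub>F i in sequentially. s i \<in> cyl p) \<and> (\<forall>\<^sub>F i in sequentially. t i \<in> cyl p))"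
proof (cases "s \<in> seqs \<and> t \<in> seqs")
  case True
  then have "range s \<subseteq> carrier F" "range t \<subseteq> carrier F"
    by (auto simp: gromov_seqs_def)
  from gromov_product_tendsto_iff[OF this] show ?thesis
    using True by (simp add: bd_rel_def gromov_rel_def)
qed (auto simp: bd_rel_def gromov_rel_def)

text \<open>Beyond a large ball membership in an almost invariant set no longer changes along edges.\<close>

lemma almost_invariant_threshold:
  assumes "almost_invariant A"
  obtains n where "\<And>p. length p = n \<Longrightarrow> cyl p \<subseteq> A \<or> cyl p \<inter> A = {}"
proof -
  define D where "D = (\<Union>l\<in>letters. {g \<in> carrier F. (g \<in> A) \<noteq> (g \<otimes> lval l \<in> A)})"
  have "finite D"
    using assms finite_letters by (auto simp: D_def almost_invariant_def)
  then obtain n where n: "\<And>g. g \<in> D \<Longrightarrow> length (nf g) < n"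
    using finite_nat_set_iff_bounded[of "(\<lambda>g. length (nf g)) ` D"] by auto
  have same: "wval (p @ t) \<in> A \<longleftrightarrow> wval p \<in> A"
    if "length p = n" "p @ t \<in> lists letters" "reduced (p @ t)" for p t
    using that
  proof (induction t rule: rev_induct)
    case (snoc l t)
    have w: "p @ t \<in> lists letters" "reduced (p @ t)" "l \<in> letters"
      using snoc.prems reduced_append[of "p @ t" "[l]"] by auto
    have "wval (p @ t) \<notin> D"
      using n[of "wval (p @ t)"] snoc.prems(1) w by auto
    then have "wval (p @ t) \<in> A \<longleftrightarrow> wval (p @ t) \<otimes> lval l \<in> A"
      using w by (auto simp: D_def)
    moreover have "wval (p @ t) \<otimes> lval l = wval (p @ t @ [l])"
      using w wval_append[of "p @ t" "[l]"] by simp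
    ultimately show ?case
      using snoc w by simp
  qed simp
  show thesis
  proof (rule that)
    fix p :: "'a word" assume p: "length p = n"
    have "g \<in> A \<longleftrightarrow> wval p \<in> A" if gp: "g \<in> cyl p" for g
    proof -
      obtain t where t: "nf g = p @ t" and g: "g \<in> carrier F"
        using gp unfolding cyl_def by blast
      show ?thesis
        using same[OF p, of t] t nf_lists[OF g] nf_reduced[OF g] wval_nf[OF g] by simp
    qed
    then show "cyl p \<subseteq> A \<or> cyl p \<inter> A = {}"
      by blast
  qed
qed

lemma seqs_decided:
  assumes "s \<in> seqs" "almost_invariant A"
  shows "(\<forall>\<^sub>F i in sequentially. s i \<in> A) \<or> (\<forall>\<^sub>F i in sequentially. s i \<notin> A)"
proof -
  obtain n where n: "\<And>p. length p = n \<Longrightarrow> cyl p \<subseteq> A \<or> cyl p \<inter> A = {}"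
    using almost_invariant_threshold[OF assms(2)] by blast
  obtain p where p: "length p = n" "\<forall>\<^sub>F i in sequentially. s i \<in> cyl p"
    using assms(1) seqs_iff by blast
  from n[OF p(1)] show ?thesis
  proof
    assume "cyl p \<subseteq> A"
    then show ?thesis
      using p(2) by (auto elim: eventually_mono)
  next
    assume "cyl p \<inter> A = {}"
    then have "\<forall>\<^sub>F i in sequentially. s i \<notin> A"
      using p(2) by (auto elim!: eventually_mono)
    then show ?thesis ..
  qed
qed

lemma seqs_not_eventually:
  assumes "s \<in> seqs" "almost_invariant A"
  shows "(\<forall>\<^sub>F i in sequentially. s i \<notin> A) \<longleftrightarrow> \<not> (\<forall>\<^sub>F i in sequentially. s i \<in> A)"
proof
  assume *: "\<forall>\<^sub>F i in sequentially. s i \<notin> A"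
  show "\<not> (\<forall>\<^sub>F i in sequentially. s i \<in> A)"
  proof
    assume "\<forall>\<^sub>F i in sequentially. s i \<in> A"
    with * have "\<forall>\<^sub>F i in sequentially. False"
      by eventually_elim simp
    then show False by simp
  qed
qed (use seqs_decided[OF assms] in blast)

lemma seqs_leave_finite:
  assumes "s \<in> seqs" "finite K"
  shows "\<forall>\<^sub>F i in sequentially. s i \<notin> K"
proof -
  obtain n where n: "\<And>g. g \<in> K \<Longrightarrow> length (nf g) < n"
    using finite_nat_set_iff_bounded[of "(\<lambda>g. length (nf g)) ` K"] assms(2) by auto
  obtain p where p: "length p = n" "\<forall>\<^sub>F i in sequentially. s i \<in> cyl p"
    using assms(1) seqs_iff by blast
  have "g \<notin> K" if "g \<in> cyl p" for g
    using n[of g] p(1) that by (auto simp: cyl_def)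
  with p(2) show ?thesis
    by (auto elim: eventually_mono)
qed

text \<open>The cylinders of a fixed length are almost invariant and cover all but finitely many
  elements. A sequence that leaves finite sets and decides each of them must end in one.\<close>

lemma seqsI:
  assumes s: "range s \<subseteq> carrier F"
    and leave: "\<And>K. finite K \<Longrightarrow> \<forall>\<^sub>F i in sequentially. s i \<notin> K"
    and dec: "\<And>A. almost_invariant A \<Longrightarrow>
      (\<forall>\<^sub>F i in sequentially. s i \<in> A) \<or> (\<forall>\<^sub>F i in sequentially. s i \<notin> A)"
  shows "s \<in> seqs"
  unfolding seqs_iff
proof (intro conjI allI s)
  fix n
  show "\<exists>p. length p = n \<and> (\<forall>\<^sub>F i in sequentially. s i \<in> cyl p)"
  proof (rule ccontr)
    assume "\<not> (\<exists>p. length p = n \<and> (\<forall>\<^sub>F i in sequentially. s i \<in> cyl p))"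
    then have "\<forall>\<^sub>F i in sequentially. s i \<notin> cyl p" if "length p = n" for p
      using dec[OF almost_invariant_cyl] that by blast
    then have "\<forall>\<^sub>F i in sequentially. \<forall>p\<in>{w \<in> lists letters. length w = n}. s i \<notin> cyl p"
      using finite_words by (intro eventually_ball_finite) auto
    moreover have "\<forall>\<^sub>F i in sequentially. s i \<notin> {g \<in> carrier F. length (nf g) \<le> n}"
      using leave finite_ball by blast
    ultimately have "\<forall>\<^sub>F i in sequentially. False"
    proof eventually_elim
      case (elim i)
      have si: "s i \<in> carrier F"
        using s by auto
      then have "s i \<in> cyl (take n (nf (s i)))" "length (take n (nf (s i))) = n"
        using elim(2) by (auto intro: in_cyl_take)
      moreover have "take n (nf (s i)) \<in> lists letters"
        using cyl_nonempty_word calculation(1) by blast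
      ultimately show ?case
        using elim(1) by blast
    qed
    then show False by simp
  qed
qed

text \<open>This description of the limit no longer refers to the basis, and it makes transitivity of the
  relation evident.\<close>

lemma bd_rel_iff_almost_invariant:
  "(s, t) \<in> bd_rel F X \<longleftrightarrow> s \<in> seqs \<and> t \<in> seqs \<and>
     (\<forall>A. almost_invariant A \<longrightarrow>
        (\<forall>\<^sub>F i in sequentially. s i \<in> A) = (\<forall>\<^sub>F i in sequentially. t i \<in> A))"
proof (cases "s \<in> seqs \<and> t \<in> seqs")
  case True
  then have s: "s \<in> seqs" and t: "t \<in> seqs"
    by auto
  have "(\<forall>n. \<exists>p. length p = n \<and> (\<forall>\<^sub>F i in sequentially. s i \<in> cyl p) \<and> (\<forall>\<^sub>F i in sequentially. t i \<in> cyl p))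
    \<longleftrightarrow> (\<forall>A. almost_invariant A \<longrightarrow>
        (\<forall>\<^sub>F i in sequentially. s i \<in> A) = (\<forall>\<^sub>F i in sequentially. t i \<in> A))" (is "?L \<longleftrightarrow> ?R")
  proof
    assume L: ?L
    show ?R
    proof (intro allI impI)
      fix A assume A: "almost_invariant A"
      obtain n where n: "\<And>p. length p = n \<Longrightarrow> cyl p \<subseteq> A \<or> cyl p \<inter> A = {}"
        using almost_invariant_threshold[OF A] by blast
      obtain p where p: "length p = n" "\<forall>\<^sub>F i in sequentially. s i \<in> cyl p"
          "\<forall>\<^sub>F i in sequentially. t i \<in> cyl p"
        using L by blast
      from n[OF p(1)] show "(\<forall>\<^sub>F i in sequentially. s i \<in> A) = (\<forall>\<^sub>F i in sequentially. t i \<in> A)"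
      proof
        assume "cyl p \<subseteq> A"
        then have "\<forall>\<^sub>F i in sequentially. s i \<in> A" "\<forall>\<^sub>F i in sequentially. t i \<in> A"
          using p(2,3) by (auto elim: eventually_mono)
        then show ?thesis by simp
      next
        assume *: "cyl p \<inter> A = {}"
        have "\<forall>\<^sub>F i in sequentially. s i \<notin> A"
          using p(2) by eventually_elim (use * in blast)
        moreover have "\<forall>\<^sub>F i in sequentially. t i \<notin> A"
          using p(3) by eventually_elim (use * in blast)
        ultimately show ?thesis
          using seqs_not_eventually[OF s A] seqs_not_eventually[OF t A] by simp
      qed
    qed
  next
    assume ?R
    then show ?L
      using s almost_invariant_cyl unfolding seqs_iff by metis
  qed
  then show ?thesis
    using True bd_rel_iff by simp
qed (use bd_rel_iff in blast)

lemma equiv_bd_rel: "equiv seqs (bd_rel F X)"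
  by (intro equivI refl_onI symI transI) (auto simp: bd_rel_iff_almost_invariant)

end

section \<open>The boundary and its clopen sets\<close>

context finite_rank_free_group
begin

definition bdset :: "'a set \<Rightarrow> (nat \<Rightarrow> 'a) set set" where
  "bdset A = {\<zeta> \<in> bd. \<exists>s\<in>\<zeta>. \<forall>\<^sub>F i in sequentially. s i \<in> A}"

lemma topspace_bd_topology [simp]: "topspace (bd_topology F X) = bd"
  by (simp add: bd_topology_def)

lemma bd_eq_quotient: "bd = seqs // bd_rel F X"
  by (simp add: gromov_boundary_def bd_rel_def)

lemma bd_limit_in_bd: "s \<in> seqs \<Longrightarrow> bd_limit F X s \<in> bd"
  by (auto simp: bd_eq_quotient bd_limit_def quotientI)

lemma bd_limit_self: "s \<in> seqs \<Longrightarrow> s \<in> bd_limit F X s"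
  unfolding bd_limit_def by (rule equiv_class_self[OF equiv_bd_rel])

lemma bd_limit_eq_iff:
  "s \<in> seqs \<Longrightarrow> t \<in> seqs \<Longrightarrow> bd_limit F X s = bd_limit F X t \<longleftrightarrow> (s, t) \<in> bd_rel F X"
  unfolding bd_limit_def by (rule eq_equiv_class_iff[OF equiv_bd_rel])

lemma bd_member:
  assumes "\<zeta> \<in> bd" "s \<in> \<zeta>"
  shows "s \<in> seqs" "\<zeta> = bd_limit F X s"
proof -
  obtain t where t: "t \<in> seqs" "\<zeta> = bd_rel F X `` {t}"
    using assms(1) unfolding bd_eq_quotient by (rule quotientE)
  then have ts: "(t, s) \<in> bd_rel F X"
    using assms(2) by simp
  then show "s \<in> seqs"
    using equiv_class_eq_iff[OF equiv_bd_rel] by blast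
  show "\<zeta> = bd_limit F X s"
    using t(2) equiv_class_eq[OF equiv_bd_rel ts] by (simp add: bd_limit_def)
qed

lemma bd_obtain:
  assumes "\<zeta> \<in> bd"
  obtains s where "s \<in> seqs" "\<zeta> = bd_limit F X s"
proof -
  obtain t where "t \<in> seqs" "\<zeta> = bd_rel F X `` {t}"
    using assms unfolding bd_eq_quotient by (rule quotientE)
  then show ?thesis
    using that by (simp add: bd_limit_def)
qed

lemma bdset_subset: "bdset A \<subseteq> bd"
  by (auto simp: bdset_def)

lemma bd_limit_in_bdset_iff:
  assumes "s \<in> seqs" "almost_invariant A"
  shows "bd_limit F X s \<in> bdset A \<longleftrightarrow> (\<forall>\<^sub>F i in sequentially. s i \<in> A)"
proof
  assume "bd_limit F X s \<in> bdset A"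
  then obtain t where t: "t \<in> bd_limit F X s" "\<forall>\<^sub>F i in sequentially. t i \<in> A"
    by (auto simp: bdset_def)
  then have "(s, t) \<in> bd_rel F X"
    by (simp add: bd_limit_def)
  then show "\<forall>\<^sub>F i in sequentially. s i \<in> A"
    using assms(2) t(2) unfolding bd_rel_iff_almost_invariant by blast
next
  assume "\<forall>\<^sub>F i in sequentially. s i \<in> A"
  then show "bd_limit F X s \<in> bdset A"
    using assms(1) bd_limit_self bd_limit_in_bd by (auto simp: bdset_def)
qed

lemma bdset_Diff:
  assumes "almost_invariant A" "almost_invariant C"
  shows "bdset (A - C) = bdset A - bdset C"
proof (intro equalityI subsetI)
  fix \<zeta> assume z: "\<zeta> \<in> bdset (A - C)"
  then obtain s where s: "s \<in> seqs" "\<zeta> = bd_limit F X s"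
    using bdset_subset bd_obtain by blast
  have "\<forall>\<^sub>F i in sequentially. s i \<in> A \<and> s i \<notin> C"
    using z s bd_limit_in_bdset_iff[OF s(1) almost_invariant_Diff[OF assms]] by simp
  then show "\<zeta> \<in> bdset A - bdset C"
    using s assms by (simp add: eventually_conj_iff bd_limit_in_bdset_iff seqs_not_eventually)
next
  fix \<zeta> assume z: "\<zeta> \<in> bdset A - bdset C"
  then obtain s where s: "s \<in> seqs" "\<zeta> = bd_limit F X s"
    using bdset_subset bd_obtain by blast
  have "\<forall>\<^sub>F i in sequentially. s i \<in> A" "\<forall>\<^sub>F i in sequentially. s i \<notin> C"
    using z s assms by (simp_all add: bd_limit_in_bdset_iff seqs_not_eventually)
  then show "\<zeta> \<in> bdset (A - C)"
    using s bd_limit_in_bdset_iff[OF s(1) almost_invariant_Diff[OF assms]]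
    by (simp add: eventually_conj_iff)
qed

lemma bdset_carrier [simp]: "bdset (carrier F) = bd"
proof
  show "bd \<subseteq> bdset (carrier F)"
  proof
    fix \<zeta> assume "\<zeta> \<in> bd"
    then obtain s where "s \<in> seqs" "\<zeta> = bd_limit F X s"
      using bd_obtain by blast
    then show "\<zeta> \<in> bdset (carrier F)"
      using bd_limit_in_bdset_iff[OF _ almost_invariant_full] seqs_carrier by simp
  qed
qed (rule bdset_subset)

lemma bdset_mono: "A \<subseteq> C \<Longrightarrow> bdset A \<subseteq> bdset C"
  unfolding bdset_def by (blast intro: eventually_mono)

lemma bdset_disjoint:
  assumes "almost_invariant A" "almost_invariant C" "A \<inter> C = {}"
  shows "bdset A \<inter> bdset C = {}"
  using bdset_Diff[OF assms(1,2)] assms(3) by (metis Diff_disjoint Diff_triv inf_commute)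

lemma bdset_finite_Union:
  assumes "finite I" "\<And>i. i \<in> I \<Longrightarrow> almost_invariant (C i)" "finite K" "A - K \<subseteq> (\<Union>i\<in>I. C i)"
  shows "bdset A \<subseteq> (\<Union>i\<in>I. bdset (C i))"
proof
  fix \<zeta> assume z: "\<zeta> \<in> bdset A"
  then obtain s where s: "s \<in> seqs" "\<zeta> = bd_limit F X s" "\<forall>\<^sub>F i in sequentially. s i \<in> A"
    using bd_member unfolding bdset_def by blast
  show "\<zeta> \<in> (\<Union>i\<in>I. bdset (C i))"
  proof (rule ccontr)
    assume "\<zeta> \<notin> (\<Union>i\<in>I. bdset (C i))"
    then have "\<forall>i\<in>I. \<forall>\<^sub>F j in sequentially. s j \<notin> C i"
      using s assms(2) by (auto simp: bd_limit_in_bdset_iff seqs_not_eventually)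
    then have "\<forall>\<^sub>F j in sequentially. \<forall>i\<in>I. s j \<notin> C i"
      using assms(1) by (simp add: eventually_ball_finite)
    moreover have "\<forall>\<^sub>F j in sequentially. s j \<notin> K"
      using seqs_leave_finite s(1) assms(3) by blast
    ultimately have "\<forall>\<^sub>F j in sequentially. False"
      using s(3) by eventually_elim (use assms(4) in blast)
    then show False by simp
  qed
qed

lemma bdset_cyl_children:
  "bdset (cyl p) \<subseteq> (\<Union>z\<in>{z \<in> letters. p = [] \<or> z \<noteq> linv (last p)}. bdset (cyl (p @ [z])))"
  by (rule bdset_finite_Union[where K = "{wval p}"])
    (use finite_letters cyl_children almost_invariant_cyl in auto)

lemma bdset_cyl_unique:
  assumes "\<zeta> \<in> bdset (cyl p)" "\<zeta> \<in> bdset (cyl q)" "length p = length q"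
  shows "p = q"
  using assms bdset_disjoint[OF almost_invariant_cyl almost_invariant_cyl] cyl_disjoint by blast

lemma bdset_cyl_word: "\<zeta> \<in> bdset (cyl p) \<Longrightarrow> p \<in> lists letters \<and> reduced p"
proof -
  assume z: "\<zeta> \<in> bdset (cyl p)"
  then obtain s where "\<forall>\<^sub>F i in sequentially. s i \<in> cyl p"
    by (auto simp: bdset_def)
  then obtain i where "s i \<in> cyl p"
    using eventually_happens'[OF sequentially_bot] by blast
  then show ?thesis
    using cyl_nonempty_word by blast
qed

lemma bd_prefix:
  assumes "\<zeta> \<in> bd"
  obtains p where "length p = n" "\<zeta> \<in> bdset (cyl p)"
proof -
  obtain s where s: "s \<in> seqs" "\<zeta> = bd_limit F X s"
    using assms bd_obtain by blast
  obtain p where "length p = n" "\<forall>\<^sub>F i in sequentially. s i \<in> cyl p"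
    using s(1) seqs_iff by blast
  then show ?thesis
    using that s bd_limit_in_bdset_iff[OF s(1) almost_invariant_cyl] by blast
qed

lemma bd_separate:
  assumes "\<zeta> \<in> bd" "\<xi> \<in> bd" "\<zeta> \<noteq> \<xi>"
  obtains p q where "length p = length q" "p \<noteq> q" "\<zeta> \<in> bdset (cyl p)" "\<xi> \<in> bdset (cyl q)"
proof -
  obtain s t where s: "s \<in> seqs" "\<zeta> = bd_limit F X s" and t: "t \<in> seqs" "\<xi> = bd_limit F X t"
    using assms bd_obtain by metis
  have "(s, t) \<notin> bd_rel F X"
    using assms(3) s t bd_limit_eq_iff by blast
  then obtain n where n: "\<And>p. length p = n \<Longrightarrow>
      \<not> ((\<forall>\<^sub>F i in sequentially. s i \<in> cyl p) \<and> (\<forall>\<^sub>F i in sequentially. t i \<in> cyl p))"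
    using s t unfolding bd_rel_iff by blast
  obtain p where p: "length p = n" "\<zeta> \<in> bdset (cyl p)"
    using assms(1) bd_prefix by blast
  obtain q where q: "length q = n" "\<xi> \<in> bdset (cyl q)"
    using assms(2) bd_prefix by blast
  have "p \<noteq> q"
    using n[OF p(1)] p q s t by (auto simp: bd_limit_in_bdset_iff almost_invariant_cyl)
  then show ?thesis
    by (rule that[rotated]) (use p q in simp_all)
qed

lemma gromov_nbhd_subset_bdset:
  assumes "\<zeta> \<in> bdset (cyl p)"
  shows "gromov_nbhd (carrier F) (word_dist F X) \<one> \<zeta> (real (length p) + 1) \<subseteq> bdset (cyl p)"
proof
  fix \<xi> assume "\<xi> \<in> gromov_nbhd (carrier F) (word_dist F X) \<one> \<zeta> (real (length p) + 1)"
  then obtain s t where xi: "\<xi> \<in> bd" and s: "s \<in> \<zeta>" and t: "t \<in> \<xi>" and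
    lim: "Liminf (sequentially \<times>\<^sub>F sequentially)
      (\<lambda>(i, j). ereal (gromov_product (word_dist F X) \<one> (s i) (t j))) \<ge> ereal (real (length p) + 1)"
    by (auto simp: gromov_nbhd_def)
  have z: "\<zeta> \<in> bd"
    using assms bdset_subset by blast
  note s' = bd_member[OF z s] and t' = bd_member[OF xi t]
  have "\<forall>\<^sub>F x in sequentially \<times>\<^sub>F sequentially. ereal (real (length p)) <
      (case x of (i, j) \<Rightarrow> ereal (gromov_product (word_dist F X) \<one> (s i) (t j)))"
    using lim unfolding le_Liminf_iff by simp
  then obtain K where K: "\<And>i j. i \<ge> K \<Longrightarrow> j \<ge> K \<Longrightarrow>
      real (length p) < gromov_product (word_dist F X) \<one> (s i) (t j)"
    by (auto simp: eventually_prod_sequentially)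
  have "\<forall>\<^sub>F i in sequentially. s i \<in> cyl p"
    using assms s' by (simp add: bd_limit_in_bdset_iff almost_invariant_cyl)
  then obtain i where i: "i \<ge> K" "s i \<in> cyl p"
    unfolding eventually_sequentially by (metis linear order_trans)
  have "t j \<in> cyl p" if "j \<ge> K" for j
  proof -
    have "real (length p) \<le> gromov_product (word_dist F X) \<one> (s i) (t j)"
      using K[OF i(1) that] by simp
    then show ?thesis
      using i(2) cyl_unique s' t' by (auto simp: gromov_product_ge_iff seqs_carrier)
  qed
  then have "\<forall>\<^sub>F j in sequentially. t j \<in> cyl p"
    unfolding eventually_sequentially by blast
  then show "\<xi> \<in> bdset (cyl p)"
    using t' by (simp add: bd_limit_in_bdset_iff almost_invariant_cyl)
qed

lemma bdset_subset_gromov_nbhd: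
  assumes "\<zeta> \<in> bdset (cyl p)"
  shows "bdset (cyl p) \<subseteq> gromov_nbhd (carrier F) (word_dist F X) \<one> \<zeta> (real (length p))"
proof
  fix \<xi> assume xi: "\<xi> \<in> bdset (cyl p)"
  obtain s where s: "s \<in> \<zeta>" "\<forall>\<^sub>F i in sequentially. s i \<in> cyl p"
    using assms by (auto simp: bdset_def)
  obtain t where t: "t \<in> \<xi>" "\<forall>\<^sub>F i in sequentially. t i \<in> cyl p"
    using xi by (auto simp: bdset_def)
  obtain K K' where K: "\<And>i. i \<ge> K \<Longrightarrow> s i \<in> cyl p" "\<And>i. i \<ge> K' \<Longrightarrow> t i \<in> cyl p"
    using s(2) t(2) unfolding eventually_sequentially by blast
  have "real (length p) \<le> gromov_product (word_dist F X) \<one> (s i) (t j)" if "i \<ge> K" "j \<ge> K'" for i j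
    using K(1)[OF that(1)] K(2)[OF that(2)] by (auto simp: gromov_product_ge_iff cyl_in_carrier)
  then have "\<forall>\<^sub>F x in sequentially \<times>\<^sub>F sequentially. ereal (real (length p)) \<le>
      (case x of (i, j) \<Rightarrow> ereal (gromov_product (word_dist F X) \<one> (s i) (t j)))"
    by (auto simp: eventually_prod_sequentially intro!: exI[of _ "max K K'"])
  then have "Liminf (sequentially \<times>\<^sub>F sequentially)
      (\<lambda>(i, j). ereal (gromov_product (word_dist F X) \<one> (s i) (t j))) \<ge> ereal (real (length p))"
    by (rule Liminf_bounded)
  then show "\<xi> \<in> gromov_nbhd (carrier F) (word_dist F X) \<one> \<zeta> (real (length p))"
    using xi s(1) t(1) bdset_subset unfolding gromov_nbhd_def by blast
qed

lemma openin_bd_topology_iff: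
  "openin (bd_topology F X) U \<longleftrightarrow>
     U \<subseteq> bd \<and> (\<forall>\<zeta>\<in>U. \<exists>p. \<zeta> \<in> bdset (cyl p) \<and> bdset (cyl p) \<subseteq> U)"
proof (cases "U \<subseteq> bd")
  case True
  have "(\<exists>r. gromov_nbhd (carrier F) (word_dist F X) \<one> \<zeta> r \<subseteq> U) \<longleftrightarrow>
      (\<exists>p. \<zeta> \<in> bdset (cyl p) \<and> bdset (cyl p) \<subseteq> U)" if zU: "\<zeta> \<in> U" for \<zeta>
  proof
    assume "\<exists>r. gromov_nbhd (carrier F) (word_dist F X) \<one> \<zeta> r \<subseteq> U"
    then obtain r where r: "gromov_nbhd (carrier F) (word_dist F X) \<one> \<zeta> r \<subseteq> U"
      by blast
    obtain p where p: "length p = nat \<lceil>r\<rceil>" "\<zeta> \<in> bdset (cyl p)"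
      using bd_prefix True zU by blast
    have "bdset (cyl p) \<subseteq> gromov_nbhd (carrier F) (word_dist F X) \<one> \<zeta> r"
      using bdset_subset_gromov_nbhd[OF p(2)] gromov_nbhd_mono[of r "real (length p)"] p(1)
      by (metis order_trans real_nat_ceiling_ge)
    then show "\<exists>p. \<zeta> \<in> bdset (cyl p) \<and> bdset (cyl p) \<subseteq> U"
      using r p(2) by blast
  next
    assume "\<exists>p. \<zeta> \<in> bdset (cyl p) \<and> bdset (cyl p) \<subseteq> U"
    then show "\<exists>r. gromov_nbhd (carrier F) (word_dist F X) \<one> \<zeta> r \<subseteq> U"
      using gromov_nbhd_subset_bdset by blast
  qed
  then show ?thesis
    using True by (simp add: bd_topology_def openin_gromov_topology)
qed (simp add: bd_topology_def openin_gromov_topology)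

lemma openin_bdset:
  assumes "almost_invariant A"
  shows "openin (bd_topology F X) (bdset A)"
  unfolding openin_bd_topology_iff
proof (intro conjI ballI bdset_subset)
  fix \<zeta> assume z: "\<zeta> \<in> bdset A"
  obtain n where n: "\<And>p. length p = n \<Longrightarrow> cyl p \<subseteq> A \<or> cyl p \<inter> A = {}"
    using almost_invariant_threshold[OF assms] by blast
  obtain p where p: "length p = n" "\<zeta> \<in> bdset (cyl p)"
    using bd_prefix z bdset_subset by blast
  have "cyl p \<subseteq> A"
    using n[OF p(1)] bdset_disjoint[OF almost_invariant_cyl[of p] assms] z p(2) by blast
  then show "\<exists>p. \<zeta> \<in> bdset (cyl p) \<and> bdset (cyl p) \<subseteq> bdset A"
    using p(2) bdset_mono by blast
qed

lemma almost_invariant_compl: "almost_invariant A \<Longrightarrow> almost_invariant (carrier F - A)"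
  by (intro almost_invariant_Diff almost_invariant_full)

lemma bdset_compl: "almost_invariant A \<Longrightarrow> bdset (carrier F - A) = bd - bdset A"
  by (simp add: bdset_Diff almost_invariant_full)

lemma closedin_bdset:
  assumes "almost_invariant A"
  shows "closedin (bd_topology F X) (bdset A)"
  using openin_bdset[OF almost_invariant_compl[OF assms]] bdset_subset[of A]
  by (simp add: closedin_def bdset_compl[OF assms])

text \<open>Compactness by the argument of Koenig's lemma: if an open cover has no finite subcover, then
  neither has it over some child of every cylinder with this property, and the ray through the
  resulting nested cylinders converges to a point that no member of the cover contains.\<close>

lemma compactin_bd: "compactin (bd_topology F X) bd"
  unfolding compactin_def
proof (intro conjI allI impI)
  fix \<U> assume U: "(\<forall>U\<in>\<U>. openin (bd_topology F X) U) \<and> bd \<subseteq> \<Union> \<U>"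
  define bad where "bad p \<longleftrightarrow> \<not> (\<exists>\<F>. finite \<F> \<and> \<F> \<subseteq> \<U> \<and> bdset (cyl p) \<subseteq> \<Union> \<F>)" for p
  show "\<exists>\<F>. finite \<F> \<and> \<F> \<subseteq> \<U> \<and> bd \<subseteq> \<Union> \<F>"
  proof (rule ccontr)
    assume "\<not> ?thesis"
    then have bad0: "bad []"
      by (simp add: bad_def)
    have step: "\<exists>z. bad (p @ [z])" if "bad p" for p
    proof (rule ccontr)
      assume "\<not> ?thesis"
      then have "\<not> bad (p @ [z])" for z
        by blast
      then have "\<exists>\<F>. finite \<F> \<and> \<F> \<subseteq> \<U> \<and> bdset (cyl (p @ [z])) \<subseteq> \<Union> \<F>" for z
        unfolding bad_def by (rule notnotD)
      then obtain \<F> where F: "\<And>z. finite (\<F> z) \<and> \<F> z \<subseteq> \<U> \<and> bdset (cyl (p @ [z])) \<subseteq> \<Union> (\<F> z)"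
        by metis
      have child: "bdset (cyl (p @ [z])) \<subseteq> \<Union> (\<Union>z\<in>letters. \<F> z)" if "z \<in> letters" for z
        using F[of z] that by (meson UN_upper Union_mono order_trans)
      have "bdset (cyl p) \<subseteq> \<Union> (\<Union>z\<in>letters. \<F> z)"
        by (rule order_trans[OF bdset_cyl_children], rule UN_least, rule child) simp
      moreover have "finite (\<Union>z\<in>letters. \<F> z)" "(\<Union>z\<in>letters. \<F> z) \<subseteq> \<U>"
        using F finite_letters by auto
      ultimately show False
        using that unfolding bad_def by blast
    qed
    have "\<exists>P. P 0 = [] \<and> (\<forall>n. bad (P n) \<and> length (P n) = n) \<and> (\<forall>n. \<exists>z. P (Suc n) = P n @ [z])"
      using dependent_nat_choice[of "\<lambda>n p. bad p \<and> length p = n \<and> (n = 0 \<longrightarrow> p = [])"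
          "\<lambda>n p q. \<exists>z. q = p @ [z]"] bad0 step
      by (metis length_0_conv length_append_singleton nat.distinct(1))
    then obtain P where P: "\<And>n. bad (P n)" "\<And>n. length (P n) = n" "\<And>n. \<exists>z. P (Suc n) = P n @ [z]"
      by blast
    have nonempty: "bdset (cyl (P n)) \<noteq> {}" for n
      using P(1)[of n] unfolding bad_def by (metis empty_subsetI finite.emptyI)
    then have words: "P n \<in> lists letters" "reduced (P n)" for n
      using bdset_cyl_word by blast+
    define s where "s n = wval (P n)" for n
    have nest: "cyl (P n) \<subseteq> cyl (P m)" if "m \<le> n" for m n
      using that
    proof (induction n rule: dec_induct)
      case (step n)
      then show ?case
        using P(3)[of n] cyl_append_subset by (metis order_trans)
    qed simp
    have s_cyl: "s n \<in> cyl (P m)" if "m \<le> n" for m n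
      using nest[OF that] wval_in_own_cyl[OF words[of n]] by (auto simp: s_def)
    have ev: "\<forall>\<^sub>F i in sequentially. s i \<in> cyl (P m)" for m
      unfolding eventually_sequentially using s_cyl by blast
    have s: "s \<in> seqs"
      unfolding seqs_iff using ev P(2) words by (auto simp: s_def)
    have "bd_limit F X s \<in> \<Union> \<U>"
      using bd_limit_in_bd[OF s] U by (rule subsetD[rotated, OF _ conjunct2])
    then obtain V where V: "V \<in> \<U>" "bd_limit F X s \<in> V"
      by (rule UnionE)
    have "openin (bd_topology F X) V"
      using U V(1) by simp
    then obtain p where p: "bd_limit F X s \<in> bdset (cyl p)" "bdset (cyl p) \<subseteq> V"
      using V(2) unfolding openin_bd_topology_iff by meson
    have "bd_limit F X s \<in> bdset (cyl (P (length p)))"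
      using ev s by (simp add: bd_limit_in_bdset_iff almost_invariant_cyl)
    then have "p = P (length p)"
      using bdset_cyl_unique p(1) P(2) by metis
    then have "bad p"
      using P(1) by metis
    then show False
      using p(2) V(1) unfolding bad_def by (simp add: exI[of _ "{V}"])
  qed
qed simp

text \<open>Every boundary point has a cylinder inside \<open>S\<close> or inside its complement; finitely many of
  these cover, and the longest word among them gives the depth.\<close>

lemma clopen_level:
  assumes "openin (bd_topology F X) S" "closedin (bd_topology F X) S"
  obtains n where "\<forall>p. n \<le> length p \<longrightarrow> bdset (cyl p) \<subseteq> S \<or> bdset (cyl p) \<inter> S = {}"
proof -
  have "\<exists>p. \<zeta> \<in> bdset (cyl p) \<and> (bdset (cyl p) \<subseteq> S \<or> bdset (cyl p) \<inter> S = {})" if "\<zeta> \<in> bd" for \<zeta>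
  proof (cases "\<zeta> \<in> S")
    case True
    then show ?thesis
      using assms(1) openin_bd_topology_iff by blast
  next
    case False
    then have "\<zeta> \<in> bd - S" "openin (bd_topology F X) (bd - S)"
      using that assms(2) by (auto simp: closedin_def)
    then obtain p where "\<zeta> \<in> bdset (cyl p)" "bdset (cyl p) \<subseteq> bd - S"
      unfolding openin_bd_topology_iff by blast
    then show ?thesis
      by blast
  qed
  then obtain P where P: "\<And>\<zeta>. \<zeta> \<in> bd \<Longrightarrow> \<zeta> \<in> bdset (cyl (P \<zeta>))"
    "\<And>\<zeta>. \<zeta> \<in> bd \<Longrightarrow> bdset (cyl (P \<zeta>)) \<subseteq> S \<or> bdset (cyl (P \<zeta>)) \<inter> S = {}"
    by metis
  have "bd \<subseteq> \<Union> ((\<lambda>\<zeta>. bdset (cyl (P \<zeta>))) ` bd)"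
    using P(1) by blast
  moreover have "\<And>U. U \<in> (\<lambda>\<zeta>. bdset (cyl (P \<zeta>))) ` bd \<Longrightarrow> openin (bd_topology F X) U"
    using openin_bdset almost_invariant_cyl by blast
  ultimately obtain \<F> where F: "finite \<F>" "\<F> \<subseteq> (\<lambda>\<zeta>. bdset (cyl (P \<zeta>))) ` bd" "bd \<subseteq> \<Union> \<F>"
    using compactin_bd unfolding compactin_def by meson
  obtain Z where Z: "Z \<subseteq> bd" "finite Z" "\<F> = (\<lambda>\<zeta>. bdset (cyl (P \<zeta>))) ` Z"
    using finite_subset_image[OF F(1,2)] by blast
  obtain n where n: "\<And>\<zeta>. \<zeta> \<in> Z \<Longrightarrow> length (P \<zeta>) < n"
    using finite_nat_set_iff_bounded[of "(\<lambda>\<zeta>. length (P \<zeta>)) ` Z"] Z(2) by auto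
  show ?thesis
  proof (rule that[of n], intro allI impI)
    fix p :: "'a word" assume m: "n \<le> length p"
    show "bdset (cyl p) \<subseteq> S \<or> bdset (cyl p) \<inter> S = {}"
    proof (cases "bdset (cyl p) = {}")
      case False
      then obtain \<zeta> where z: "\<zeta> \<in> bdset (cyl p)"
        by blast
      then obtain \<xi> where xi: "\<xi> \<in> Z" "\<zeta> \<in> bdset (cyl (P \<xi>))"
        using F(3) Z(3) bdset_subset by blast
      define q where "q = take (length (P \<xi>)) p"
      have sub: "cyl p \<subseteq> cyl q"
        using cyl_append_subset[of q "drop (length (P \<xi>)) p"] by (simp add: q_def)
      have "length q = length (P \<xi>)"
        using n[OF xi(1)] m by (simp add: q_def)
      then have "q = P \<xi>"
        using bdset_cyl_unique xi(2) z bdset_mono[OF sub] by blast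
      then show ?thesis
        using P(2)[of \<xi>] Z(1) xi(1) bdset_mono[OF sub] by blast
    qed simp
  qed
qed

end

section \<open>Automorphisms and translations on the boundary\<close>

context finite_rank_free_group
begin

text \<open>Mutually inverse bijections of the group that respect almost invariance: exactly what is
  needed for an action on the boundary.\<close>

definition end_iso :: "('a \<Rightarrow> 'a) \<Rightarrow> ('a \<Rightarrow> 'a) \<Rightarrow> bool" where
  "end_iso f f' \<longleftrightarrow> f \<in> carrier F \<rightarrow> carrier F \<and> f' \<in> carrier F \<rightarrow> carrier F \<and>
     (\<forall>g\<in>carrier F. f' (f g) = g \<and> f (f' g) = g) \<and>
     (\<forall>A. almost_invariant A \<longrightarrow>
        almost_invariant {g \<in> carrier F. f g \<in> A} \<and> almost_invariant {g \<in> carrier F. f' g \<in> A})"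

lemma end_iso_sym: "end_iso f f' \<Longrightarrow> end_iso f' f"
  unfolding end_iso_def by simp

lemma end_isoD:
  assumes "end_iso f f'"
  shows "g \<in> carrier F \<Longrightarrow> f g \<in> carrier F" "g \<in> carrier F \<Longrightarrow> f' g \<in> carrier F"
    "g \<in> carrier F \<Longrightarrow> f' (f g) = g" "g \<in> carrier F \<Longrightarrow> f (f' g) = g"
    "almost_invariant A \<Longrightarrow> almost_invariant {g \<in> carrier F. f g \<in> A}"
  using assms unfolding end_iso_def Pi_iff by simp_all

lemma end_iso_image_eq:
  assumes "end_iso f f'" "A \<subseteq> carrier F"
  shows "f ` A = {g \<in> carrier F. f' g \<in> A}"
proof (intro equalityI subsetI)
  fix y assume "y \<in> f ` A"
  then show "y \<in> {g \<in> carrier F. f' g \<in> A}"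
    using assms(2) end_isoD(1,3)[OF assms(1)] by auto
next
  fix y assume "y \<in> {g \<in> carrier F. f' g \<in> A}"
  then show "y \<in> f ` A"
    using end_isoD(4)[OF assms(1)] by (metis (mono_tags, lifting) imageI mem_Collect_eq)
qed

lemma almost_invariant_image:
  assumes "end_iso f f'" "almost_invariant A"
  shows "almost_invariant (f ` A)"
  using end_iso_image_eq[OF assms(1) almost_invariant_carrier[OF assms(2)]]
    end_isoD(5)[OF end_iso_sym[OF assms(1)] assms(2)] by simp

definition mutually_inverse_homs :: "('a \<Rightarrow> 'a) \<Rightarrow> ('a \<Rightarrow> 'a) \<Rightarrow> bool" where
  "mutually_inverse_homs f f' \<longleftrightarrow> f \<in> hom F F \<and> f' \<in> hom F F \<and>
     (\<forall>g\<in>carrier F. f' (f g) = g \<and> f (f' g) = g)"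

lemma almost_invariant_hom_preimage:
  assumes f: "f \<in> hom F F" "inj_on f (carrier F)" and A: "almost_invariant A"
  shows "almost_invariant {g \<in> carrier F. f g \<in> A}"
  unfolding almost_invariant_def
proof (intro conjI ballI)
  fix h assume h: "h \<in> carrier F"
  have fc: "f g \<in> carrier F" if "g \<in> carrier F" for g
    using f(1) that by (auto simp: hom_def)
  have "finite (f -` {y \<in> carrier F. (y \<in> A) \<noteq> (y \<otimes> f h \<in> A)} \<inter> carrier F)"
    using A fc[OF h] f(2) by (intro finite_vimage_IntI) (auto simp: almost_invariant_def)
  then show "finite {g \<in> carrier F. (g \<in> {g \<in> carrier F. f g \<in> A}) \<noteq> (g \<otimes> h \<in> {g \<in> carrier F. f g \<in> A})}"
    by (rule rev_finite_subset) (use h fc f(1) in \<open>auto simp: hom_def\<close>)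
qed auto

lemma end_iso_automorphism:
  assumes "mutually_inverse_homs f f'"
  shows "end_iso f f'"
proof -
  have "inj_on f (carrier F)" "inj_on f' (carrier F)"
    using assms unfolding mutually_inverse_homs_def by (metis inj_onI)+
  then show ?thesis
    using assms almost_invariant_hom_preimage
    unfolding end_iso_def mutually_inverse_homs_def by (simp add: hom_def)
qed

lemma end_iso_translation:
  assumes h: "h \<in> carrier F"
  shows "end_iso (\<lambda>g. h \<otimes> g) (\<lambda>g. inv h \<otimes> g)"
proof -
  have pre: "almost_invariant {g \<in> carrier F. k \<otimes> g \<in> A}" if k: "k \<in> carrier F" and A: "almost_invariant A" for k A
    unfolding almost_invariant_def
  proof (intro conjI ballI)
    fix x assume x: "x \<in> carrier F"
    have "finite ((\<lambda>g. k \<otimes> g) -` {y \<in> carrier F. (y \<in> A) \<noteq> (y \<otimes> x \<in> A)} \<inter> carrier F)"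
      using A k x by (intro finite_vimage_IntI) (auto simp: almost_invariant_def inj_on_def)
    then show "finite {g \<in> carrier F. (g \<in> {g \<in> carrier F. k \<otimes> g \<in> A}) \<noteq> (g \<otimes> x \<in> {g \<in> carrier F. k \<otimes> g \<in> A})}"
      by (rule rev_finite_subset) (use k x in \<open>auto simp: m_assoc\<close>)
  qed auto
  show ?thesis
    using h pre[of h] pre[of "inv h"] unfolding end_iso_def by (simp add: m_assoc[symmetric])
qed

lemma end_iso_seqs:
  assumes f: "end_iso f f'" and s: "s \<in> seqs"
  shows "f \<circ> s \<in> seqs"
proof (rule seqsI)
  have sc: "s i \<in> carrier F" for i
    using s seqs_carrier by blast
  show "range (f \<circ> s) \<subseteq> carrier F"
    using sc end_isoD(1)[OF f] by auto
  show "\<forall>\<^sub>F i in sequentially. (f \<circ> s) i \<notin> K" if K: "finite K" for K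
  proof -
    have "\<forall>\<^sub>F i in sequentially. s i \<notin> f' ` K"
      using seqs_leave_finite[OF s] K by blast
    then show ?thesis
    proof eventually_elim
      case (elim i)
      have "s i = f' ((f \<circ> s) i)"
        using end_isoD(3)[OF f sc] by simp
      with elim show ?case by blast
    qed
  qed
  show "(\<forall>\<^sub>F i in sequentially. (f \<circ> s) i \<in> A) \<or> (\<forall>\<^sub>F i in sequentially. (f \<circ> s) i \<notin> A)"
    if "almost_invariant A" for A
    using seqs_decided[OF s end_isoD(5)[OF f that]] sc by simp
qed

lemma end_iso_bd_rel:
  assumes f: "end_iso f f'" and st: "(s, t) \<in> bd_rel F X"
  shows "(f \<circ> s, f \<circ> t) \<in> bd_rel F X"
proof -
  have s: "s \<in> seqs" and t: "t \<in> seqs"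
    using st by (simp_all add: bd_rel_iff)
  have "(\<forall>\<^sub>F i in sequentially. (f \<circ> s) i \<in> A) = (\<forall>\<^sub>F i in sequentially. (f \<circ> t) i \<in> A)"
    if A: "almost_invariant A" for A
  proof -
    have "(\<forall>\<^sub>F i in sequentially. s i \<in> {g \<in> carrier F. f g \<in> A}) =
        (\<forall>\<^sub>F i in sequentially. t i \<in> {g \<in> carrier F. f g \<in> A})"
      using st end_isoD(5)[OF f A] unfolding bd_rel_iff_almost_invariant by blast
    then show ?thesis
      using s t seqs_carrier by simp
  qed
  then show ?thesis
    using end_iso_seqs[OF f] s t unfolding bd_rel_iff_almost_invariant by blast
qed

lemma bd_map_limit:
  assumes f: "end_iso f f'" and s: "s \<in> seqs"
  shows "bd_map F X f (bd_limit F X s) = bd_limit F X (f \<circ> s)"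
proof -
  have "bd_limit F X (f \<circ> t) = bd_limit F X (f \<circ> s)" if "t \<in> bd_limit F X s" for t
  proof -
    have "(s, t) \<in> bd_rel F X"
      using that by (simp add: bd_limit_def)
    then have "(f \<circ> s, f \<circ> t) \<in> bd_rel F X" "t \<in> seqs"
      using end_iso_bd_rel[OF f] by (auto simp: bd_rel_iff)
    then show ?thesis
      using bd_limit_eq_iff[OF end_iso_seqs[OF f s] end_iso_seqs[OF f]] by metis
  qed
  moreover have "s \<in> bd_limit F X s"
    using bd_limit_self[OF s] .
  ultimately show ?thesis
    unfolding bd_map_def by blast
qed

lemma bd_map_in_bd: "end_iso f f' \<Longrightarrow> \<zeta> \<in> bd \<Longrightarrow> bd_map F X f \<zeta> \<in> bd"
  by (metis bd_limit_in_bd bd_map_limit bd_obtain end_iso_seqs)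

lemma bd_map_cong:
  assumes "\<And>g. g \<in> carrier F \<Longrightarrow> f g = k g" "\<zeta> \<in> bd"
  shows "bd_map F X f \<zeta> = bd_map F X k \<zeta>"
proof -
  have "f \<circ> s = k \<circ> s" if "s \<in> \<zeta>" for s
    using assms(1) seqs_carrier bd_member(1)[OF assms(2) that] by (auto simp: fun_eq_iff)
  then show ?thesis
    by (simp add: bd_map_def)
qed

lemma bd_map_compose:
  assumes "end_iso f f'" "end_iso k k'" "\<zeta> \<in> bd"
  shows "bd_map F X k (bd_map F X f \<zeta>) = bd_map F X (\<lambda>g. k (f g)) \<zeta>"
proof -
  obtain s where s: "s \<in> seqs" "\<zeta> = bd_limit F X s"
    using assms(3) bd_obtain by blast
  have l: "bd_limit F X (\<lambda>i. k (f (t i))) = bd_limit F X (\<lambda>i. k (f (s i)))" if "t \<in> \<zeta>" for t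
  proof -
    have "(s, t) \<in> bd_rel F X"
      using that s(2) by (simp add: bd_limit_def)
    then have "(k \<circ> (f \<circ> s), k \<circ> (f \<circ> t)) \<in> bd_rel F X"
      using assms(1,2) end_iso_bd_rel by blast
    then have "(\<lambda>i. k (f (s i)), \<lambda>i. k (f (t i))) \<in> bd_rel F X"
      by (simp add: comp_def)
    then show ?thesis
      using bd_limit_eq_iff by (auto simp: bd_rel_iff)
  qed
  have "s \<in> \<zeta>"
    using s bd_limit_self by simp
  then have "bd_map F X (\<lambda>g. k (f g)) \<zeta> = bd_limit F X (\<lambda>i. k (f (s i)))"
    unfolding bd_map_def comp_def using l by blast
  moreover have "bd_map F X k (bd_map F X f \<zeta>) = bd_limit F X (\<lambda>i. k (f (s i)))"
    using s assms(1,2) bd_map_limit end_iso_seqs by (simp add: comp_def) 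
  ultimately show ?thesis
    by simp
qed

lemma bd_map_inverse:
  assumes f: "end_iso f f'" and z: "\<zeta> \<in> bd"
  shows "bd_map F X f' (bd_map F X f \<zeta>) = \<zeta>"
proof -
  obtain s where s: "s \<in> seqs" "\<zeta> = bd_limit F X s"
    using z bd_obtain by blast
  have "f' \<circ> (f \<circ> s) = s"
    using end_isoD(3)[OF f] s(1) seqs_carrier by (auto simp: fun_eq_iff)
  moreover have "bd_map F X f' (bd_map F X f \<zeta>) = bd_limit F X (f' \<circ> (f \<circ> s))"
    using bd_map_limit[OF end_iso_sym[OF f] end_iso_seqs[OF f s(1)]] bd_map_limit[OF f s(1)] s(2)
    by simp
  ultimately show ?thesis
    using s(2) by simp
qed

lemma bd_map_eq_iff:
  assumes "end_iso f f'" "\<zeta> \<in> bd" "\<xi> \<in> bd"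
  shows "bd_map F X f \<zeta> = bd_map F X f \<xi> \<longleftrightarrow> \<zeta> = \<xi>"
  using assms bd_map_inverse by metis

lemma bd_map_in_bdset_iff:
  assumes f: "end_iso f f'" and z: "\<zeta> \<in> bd" and A: "almost_invariant A"
  shows "bd_map F X f \<zeta> \<in> bdset A \<longleftrightarrow> \<zeta> \<in> bdset {g \<in> carrier F. f g \<in> A}"
proof -
  obtain s where s: "s \<in> seqs" "\<zeta> = bd_limit F X s"
    using z bd_obtain by blast
  then show ?thesis
    using bd_map_limit[OF f s(1)] end_iso_seqs[OF f s(1)] end_isoD(5)[OF f A] A seqs_carrier
    by (simp add: bd_limit_in_bdset_iff)
qed

lemma continuous_map_bd_map:
  assumes f: "end_iso f f'"
  shows "continuous_map (bd_topology F X) (bd_topology F X) (bd_map F X f)"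
  unfolding continuous_map_def
proof (intro conjI allI impI)
  show "bd_map F X f \<in> topspace (bd_topology F X) \<rightarrow> topspace (bd_topology F X)"
    using bd_map_in_bd[OF f] by auto
  fix U assume U: "openin (bd_topology F X) U"
  show "openin (bd_topology F X) {\<zeta> \<in> topspace (bd_topology F X). bd_map F X f \<zeta> \<in> U}"
  proof (subst openin_subopen, intro ballI)
    fix \<zeta> assume "\<zeta> \<in> {\<zeta> \<in> topspace (bd_topology F X). bd_map F X f \<zeta> \<in> U}"
    then have z: "\<zeta> \<in> bd" and "bd_map F X f \<zeta> \<in> U"
      by auto
    then obtain p where p: "bd_map F X f \<zeta> \<in> bdset (cyl p)" "bdset (cyl p) \<subseteq> U"
      using U openin_bd_topology_iff by blast
    let ?T = "bdset {g \<in> carrier F. f g \<in> cyl p}"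
    have "openin (bd_topology F X) ?T"
      using openin_bdset end_isoD(5)[OF f almost_invariant_cyl] .
    moreover have "\<zeta> \<in> ?T"
      using bd_map_in_bdset_iff[OF f z almost_invariant_cyl] p(1) by blast
    moreover have "?T \<subseteq> {\<zeta> \<in> topspace (bd_topology F X). bd_map F X f \<zeta> \<in> U}"
    proof
      fix \<xi> assume xi: "\<xi> \<in> ?T"
      then have "\<xi> \<in> bd"
        using bdset_subset by blast
      then show "\<xi> \<in> {\<zeta> \<in> topspace (bd_topology F X). bd_map F X f \<zeta> \<in> U}"
        using bd_map_in_bdset_iff[OF f _ almost_invariant_cyl] xi p(2) by auto
    qed
    ultimately show "\<exists>T. openin (bd_topology F X) T \<and> \<zeta> \<in> T \<and>
        T \<subseteq> {\<zeta> \<in> topspace (bd_topology F X). bd_map F X f \<zeta> \<in> U}"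
      by blast
  qed
qed

text \<open>Right translations move points a bounded distance, so they are invisible at the boundary.\<close>

lemma right_translate_bd_rel:
  assumes s: "s \<in> seqs" and k: "k \<in> carrier F"
  shows "(\<lambda>i. s i \<otimes> k, s) \<in> bd_rel F X"
proof -
  have sc: "s i \<in> carrier F" for i
    using s seqs_carrier by blast
  have ev: "\<forall>\<^sub>F i in sequentially. (s i \<otimes> k \<in> A) = (s i \<in> A)" if A: "almost_invariant A" for A
  proof -
    have "finite {g \<in> carrier F. (g \<in> A) \<noteq> (g \<otimes> k \<in> A)}"
      using A k by (simp add: almost_invariant_def)
    from seqs_leave_finite[OF s this] show ?thesis
      by eventually_elim (use sc in auto)
  qed
  have ev_all: "(\<forall>\<^sub>F i in sequentially. s i \<otimes> k \<in> A) = (\<forall>\<^sub>F i in sequentially. s i \<in> A)"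
    if A: "almost_invariant A" for A
    using eventually_subst[OF ev[OF A]] .
  have "(\<lambda>i. s i \<otimes> k) \<in> seqs"
    unfolding seqs_iff using s k sc ev_all[OF almost_invariant_cyl] by (auto simp: seqs_iff)
  then show ?thesis
    using s ev_all unfolding bd_rel_iff_almost_invariant by blast
qed

lemma mutually_inverse_conjugation:
  assumes "h \<in> carrier F"
  shows "mutually_inverse_homs (\<lambda>x. h \<otimes> x \<otimes> inv h) (\<lambda>x. inv h \<otimes> x \<otimes> h)"
proof -
  have c: "a \<otimes> (inv a \<otimes> b) = b" "inv a \<otimes> (a \<otimes> b) = b" if "a \<in> carrier F" "b \<in> carrier F" for a b
    using that by (simp_all add: m_assoc[symmetric])
  show ?thesis
    using assms by (auto simp: mutually_inverse_homs_def hom_def m_assoc c)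
qed

lemma bd_map_conjugation:
  assumes h: "h \<in> carrier F" and z: "\<zeta> \<in> bd"
  shows "bd_map F X (\<lambda>x. h \<otimes> x \<otimes> inv h) \<zeta> = bd_map F X (\<lambda>x. h \<otimes> x) \<zeta>"
proof -
  obtain s where s: "s \<in> seqs" "\<zeta> = bd_limit F X s"
    using z bd_obtain by blast
  note t = end_iso_translation[OF h]
  note c = end_iso_automorphism[OF mutually_inverse_conjugation[OF h]]
  have "((\<lambda>i. ((\<lambda>x. h \<otimes> x) \<circ> s) i \<otimes> inv h), (\<lambda>x. h \<otimes> x) \<circ> s) \<in> bd_rel F X"
    using right_translate_bd_rel[OF end_iso_seqs[OF t s(1)]] h by simp
  moreover have "(\<lambda>i. ((\<lambda>x. h \<otimes> x) \<circ> s) i \<otimes> inv h) = (\<lambda>x. h \<otimes> x \<otimes> inv h) \<circ> s"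
    by (simp add: comp_def)
  ultimately have "bd_limit F X ((\<lambda>x. h \<otimes> x \<otimes> inv h) \<circ> s) = bd_limit F X ((\<lambda>x. h \<otimes> x) \<circ> s)"
    using bd_limit_eq_iff by (auto simp: bd_rel_iff)
  then show ?thesis
    using bd_map_limit[OF t s(1)] bd_map_limit[OF c s(1)] s(2) by simp
qed

end

section \<open>Radon measures and currents\<close>

lemma space_borel_of [simp]: "space (borel_of T) = topspace T"
  by (simp add: borel_of_def space_measure_of_conv)

lemma openin_borel_of:
  assumes "openin T U"
  shows "U \<in> sets (borel_of T)"
proof -
  have "{U. openin T U} \<subseteq> Pow (topspace T)"
    by (auto dest: openin_subset)
  then show ?thesis
    unfolding borel_of_def using assms by (intro in_measure_of) simp_all
qed

lemma closedin_borel_of: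
  assumes "closedin T C"
  shows "C \<in> sets (borel_of T)"
proof -
  have "space (borel_of T) - (topspace T - C) \<in> sets (borel_of T)"
    using assms by (intro sets.compl_sets openin_borel_of) (simp add: closedin_def)
  moreover have "space (borel_of T) - (topspace T - C) = C"
    using assms by (auto simp: closedin_def)
  ultimately show ?thesis by simp
qed

lemma measurable_borel_of:
  assumes "continuous_map T T' f" "sets M = sets (borel_of T)"
  shows "f \<in> measurable M (borel_of T')"
proof -
  have "f \<in> measurable (borel_of T) (sigma (topspace T') {U. openin T' U})"
  proof (rule measurable_measure_of)
    show "{U. openin T' U} \<subseteq> Pow (topspace T')"
      by (auto dest: openin_subset)
    show "f \<in> space (borel_of T) \<rightarrow> topspace T'"
      using assms(1) by (simp add: continuous_map_def)
    fix U assume "U \<in> {U. openin T' U}"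
    then have "openin T {x \<in> topspace T. f x \<in> U}"
      using assms(1) by (simp add: continuous_map_def)
    moreover have "f -` U \<inter> space (borel_of T) = {x \<in> topspace T. f x \<in> U}"
      by auto
    ultimately show "f -` U \<inter> space (borel_of T) \<in> sets (borel_of T)"
      by (simp add: openin_borel_of)
  qed
  then show ?thesis
    using measurable_cong_sets[OF assms(2) refl] unfolding borel_of_def by blast
qed

lemma radon_measure_homeomorphic_image:
  assumes \<mu>: "radon_measure T \<mu>"
    and f: "continuous_map T T f" and f': "continuous_map T T f'"
    and inv: "\<And>x. x \<in> topspace T \<Longrightarrow> f' (f x) = x" "\<And>x. x \<in> topspace T \<Longrightarrow> f (f' x) = x"
  shows "radon_measure T (distr \<mu> (borel_of T) f)"
proof -
  let ?D = "distr \<mu> (borel_of T) f"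
  have sets: "sets \<mu> = sets (borel_of T)" and fin: "\<And>K. compactin T K \<Longrightarrow> emeasure \<mu> K < \<infinity>"
    and reg: "\<And>A. A \<in> sets \<mu> \<Longrightarrow> emeasure \<mu> A = (SUP K\<in>{K. compactin T K \<and> K \<subseteq> A}. emeasure \<mu> K)"
    using \<mu> by (auto simp: radon_measure_def)
  have space: "space \<mu> = topspace T"
    using sets_eq_imp_space_eq[OF sets] by simp
  have meas: "f \<in> measurable \<mu> (borel_of T)" "f' \<in> measurable \<mu> (borel_of T)"
    using f f' sets by (auto intro: measurable_borel_of)
  have fT: "f x \<in> topspace T" "f' x \<in> topspace T" if "x \<in> topspace T" for x
    using f f' that by (auto simp: continuous_map_def)
  have emb: "emeasure ?D A = emeasure \<mu> (f -` A \<inter> topspace T)" if "A \<in> sets (borel_of T)" for A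
    using emeasure_distr[OF meas(1) that] by (simp add: space)
  have pre: "f -` A \<inter> topspace T = f' ` A" if "A \<subseteq> topspace T" for A
    using that inv fT by (force simp: image_iff)
  have pre': "f' -` A \<inter> topspace T = f ` A" if "A \<subseteq> topspace T" for A
    using that inv fT by (force simp: image_iff)
  show ?thesis
    unfolding radon_measure_def
  proof (intro conjI allI impI ballI)
    fix K assume K: "compactin T K"
    show "emeasure ?D K < \<infinity>"
    proof (cases "K \<in> sets (borel_of T)")
      case True
      have "compactin T (f' ` K)"
        using K f' by (rule image_compactin)
      then show ?thesis
        using fin emb[OF True] pre[OF compactin_subset_topspace[OF K]] by simp
    qed (simp add: emeasure_notin_sets)
  next
    fix A assume "A \<in> sets ?D"
    then have A: "A \<in> sets (borel_of T)"
      by simp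
    then have A_sub: "A \<subseteq> topspace T"
      using sets.sets_into_space by fastforce
    have fA: "f -` A \<inter> topspace T \<in> sets \<mu>"
      using measurable_sets[OF meas(1) A] by (simp add: space)
    show "emeasure ?D A = (SUP K\<in>{K. compactin T K \<and> K \<subseteq> A}. emeasure ?D K)"
    proof (rule antisym)
      show "emeasure ?D A \<le> (SUP K\<in>{K. compactin T K \<and> K \<subseteq> A}. emeasure ?D K)"
        unfolding emb[OF A] reg[OF fA]
      proof (rule SUP_least)
        fix K assume "K \<in> {K. compactin T K \<and> K \<subseteq> f -` A \<inter> topspace T}"
        then have K: "compactin T K" "K \<subseteq> f -` A \<inter> topspace T"
          by auto
        have K_sub: "K \<subseteq> topspace T"
          using K(1) by (rule compactin_subset_topspace)
        show "emeasure \<mu> K \<le> (SUP K\<in>{K. compactin T K \<and> K \<subseteq> A}. emeasure ?D K)"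
        proof (cases "K \<in> sets \<mu>")
          case True
          have "f' -` K \<inter> space \<mu> \<in> sets \<mu>"
            using measurable_sets[OF meas(2)] True sets by simp
          then have fK: "f ` K \<in> sets (borel_of T)"
            using pre'[OF K_sub] space sets by simp
          have "f' ` f ` K = K"
            using K_sub inv by (force simp: image_image)
          then have "emeasure ?D (f ` K) = emeasure \<mu> K"
            using emb[OF fK] pre[OF sets.sets_into_space[OF fK, simplified]] by simp
          moreover have "f ` K \<in> {K. compactin T K \<and> K \<subseteq> A}"
            using image_compactin[OF K(1) f] K(2) by auto
          ultimately show ?thesis
            using SUP_upper[of "f ` K" "{K. compactin T K \<and> K \<subseteq> A}" "emeasure ?D"] by simp
        qed (simp add: emeasure_notin_sets)
      qed
      show "(SUP K\<in>{K. compactin T K \<and> K \<subseteq> A}. emeasure ?D K) \<le> emeasure ?D A"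
        using A by (auto intro!: SUP_least emeasure_mono)
    qed
  qed simp
qed

lemma radon_measure_scale:
  assumes "radon_measure T \<mu>"
  shows "radon_measure T (scale_measure (ennreal c) \<mu>)"
  using assms by (auto simp: radon_measure_def SUP_mult_left_ennreal ennreal_mult_less_top)

context finite_rank_free_group
begin

abbreviation bd2 :: "'a bd_pair topology" where
  "bd2 \<equiv> bd2_topology F X"

abbreviation bd2_map :: "('a \<Rightarrow> 'a) \<Rightarrow> 'a bd_pair \<Rightarrow> 'a bd_pair" where
  "bd2_map f \<equiv> map_prod (bd_map F X f) (bd_map F X f)"

lemma topspace_bd2: "topspace bd2 = {(\<zeta>, \<xi>). \<zeta> \<in> bd \<and> \<xi> \<in> bd \<and> \<zeta> \<noteq> \<xi>}"
  by (auto simp: bd2_topology_def)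

definition lines :: "'a set \<Rightarrow> 'a set \<Rightarrow> 'a bd_pair set" where
  "lines A C = bdset A \<times> bdset C"

lemma disjoint_clopen_Times:
  assumes S: "openin (bd_topology F X) S" "closedin (bd_topology F X) S"
    and S': "openin (bd_topology F X) S'" "closedin (bd_topology F X) S'"
    and disj: "S \<inter> S' = {}"
  shows "openin bd2 (S \<times> S')" "compactin bd2 (S \<times> S')"
proof -
  have sub: "S \<times> S' \<subseteq> {(\<zeta>, \<xi>). \<zeta> \<noteq> \<xi>}"
    using disj by auto
  have "openin (prod_topology (bd_topology F X) (bd_topology F X)) (S \<times> S')"
    using S S' by (simp add: openin_prod_Times_iff)
  then show "openin bd2 (S \<times> S')"
    unfolding bd2_topology_def openin_subtopology using sub by blast
  have "S \<subseteq> bd" "S' \<subseteq> bd"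
    using S S' closedin_subset by fastforce+
  then have "compactin (bd_topology F X) S" "compactin (bd_topology F X) S'"
    using S S' closed_compactin[OF compactin_bd] by blast+
  then show "compactin bd2 (S \<times> S')"
    unfolding bd2_topology_def compactin_subtopology using sub by (simp add: compactin_Times)
qed

lemma
  assumes "almost_invariant A" "almost_invariant C" "A \<inter> C = {}"
  shows openin_lines: "openin bd2 (lines A C)" and compactin_lines: "compactin bd2 (lines A C)"
  using disjoint_clopen_Times[of "bdset A" "bdset C"] bdset_disjoint[OF assms] assms
  by (simp_all add: lines_def openin_bdset closedin_bdset)

lemma continuous_map_bd2_map:
  assumes f: "end_iso f f'"
  shows "continuous_map bd2 bd2 (bd2_map f)"
  unfolding bd2_topology_def continuous_map_in_subtopology
proof
  have "continuous_map (prod_topology (bd_topology F X) (bd_topology F X))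
      (prod_topology (bd_topology F X) (bd_topology F X)) (bd2_map f)"
    using continuous_map_bd_map[OF f] by (simp add: map_prod_def continuous_map_prod_top)
  then show "continuous_map (subtopology (prod_topology (bd_topology F X) (bd_topology F X)) {(\<zeta>, \<xi>). \<zeta> \<noteq> \<xi>})
      (prod_topology (bd_topology F X) (bd_topology F X)) (bd2_map f)"
    by (rule continuous_map_from_subtopology)
  show "bd2_map f \<in> topspace (subtopology (prod_topology (bd_topology F X) (bd_topology F X)) {(\<zeta>, \<xi>). \<zeta> \<noteq> \<xi>})
      \<rightarrow> {(\<zeta>, \<xi>). \<zeta> \<noteq> \<xi>}"
    using bd_map_eq_iff[OF f] by auto
qed

lemma bd2_map_inverse: "end_iso f f' \<Longrightarrow> x \<in> topspace bd2 \<Longrightarrow> bd2_map f' (bd2_map f x) = x"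
  by (auto simp: topspace_bd2 bd_map_inverse)

lemma continuous_map_bd2_swap: "continuous_map bd2 bd2 prod.swap"
  unfolding bd2_topology_def continuous_map_in_subtopology
proof
  have "continuous_map (prod_topology (bd_topology F X) (bd_topology F X))
      (prod_topology (bd_topology F X) (bd_topology F X)) prod.swap"
    by (simp add: prod.swap_def continuous_map_pairwise comp_def continuous_map_fst continuous_map_snd
        continuous_map_paired)
  then show "continuous_map (subtopology (prod_topology (bd_topology F X) (bd_topology F X)) {(\<zeta>, \<xi>). \<zeta> \<noteq> \<xi>})
      (prod_topology (bd_topology F X) (bd_topology F X)) prod.swap"
    by (rule continuous_map_from_subtopology)
qed auto

lemma current_sets:
  assumes "\<nu> \<in> currents F X"
  shows "sets \<nu> = sets (borel_of bd2)" "space \<nu> = topspace bd2"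
proof -
  show s: "sets \<nu> = sets (borel_of bd2)"
    using assms by (simp add: currents_def radon_measure_def)
  show "space \<nu> = topspace bd2"
    using sets_eq_imp_space_eq[OF s] by simp
qed

lemma lines_sets:
  assumes "sets \<nu> = sets (borel_of bd2)" "almost_invariant A" "almost_invariant C" "A \<inter> C = {}"
  shows "lines A C \<in> sets \<nu>"
  using openin_borel_of[OF openin_lines[OF assms(2-4)]] assms(1) by simp

lemma current_lines_finite:
  assumes "\<nu> \<in> currents F X" "almost_invariant A" "almost_invariant C" "A \<inter> C = {}"
  shows "emeasure \<nu> (lines A C) < \<infinity>"
  using assms(1) compactin_lines[OF assms(2-4)] by (simp add: currents_def radon_measure_def)

text \<open>The mass that a current gives to the lines running from \<open>A\<close> to \<open>C\<close>. For disjoint almost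
  invariant sets it is finite, and it is monotone, additive, symmetric and invariant under
  translations; all estimates on currents go through these properties.\<close>

definition mass :: "'a bd_pair measure \<Rightarrow> 'a set \<Rightarrow> 'a set \<Rightarrow> real" where
  "mass \<nu> A C = measure \<nu> (lines A C)"

lemma emeasure_lines_eq_mass:
  assumes "\<nu> \<in> currents F X" "almost_invariant A" "almost_invariant C" "A \<inter> C = {}"
  shows "emeasure \<nu> (lines A C) = ennreal (mass \<nu> A C)"
  using current_lines_finite[OF assms] by (simp add: mass_def emeasure_eq_ennreal_measure less_top[symmetric])

lemma mass_nonneg [simp]: "mass \<nu> A C \<ge> 0"
  by (simp add: mass_def)

lemma lines_mono: "A \<subseteq> A' \<Longrightarrow> C \<subseteq> C' \<Longrightarrow> lines A C \<subseteq> lines A' C'"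
  unfolding lines_def by (intro Sigma_mono bdset_mono)

lemma mass_mono:
  assumes "\<nu> \<in> currents F X" "almost_invariant A'" "almost_invariant C'" "A' \<inter> C' = {}"
    and "A \<subseteq> A'" "C \<subseteq> C'"
  shows "mass \<nu> A C \<le> mass \<nu> A' C'"
proof (cases "lines A C \<in> sets \<nu>")
  case True
  show ?thesis
    unfolding mass_def
    using True lines_mono[OF assms(5,6)] current_lines_finite[OF assms(1-4)]
      lines_sets[OF current_sets(1)[OF assms(1)] assms(2-4)]
    by (intro measure_mono_fmeasurable) (auto simp: fmeasurable_def)
qed (simp add: mass_def measure_notin_sets)

lemma bd2_map_vimage_lines:
  assumes f: "end_iso f f'" and A: "almost_invariant A" and C: "almost_invariant C" and d: "A \<inter> C = {}"
  shows "bd2_map f -` lines A C \<inter> topspace bd2 = lines {g \<in> carrier F. f g \<in> A} {g \<in> carrier F. f g \<in> C}"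
    (is "?L = lines ?A ?C")
proof -
  have "?A \<inter> ?C = {}"
    using d by auto
  then have disj: "bdset ?A \<inter> bdset ?C = {}"
    using bdset_disjoint end_isoD(5)[OF f] A C by blast
  have "(\<zeta>, \<xi>) \<in> ?L \<longleftrightarrow> (\<zeta>, \<xi>) \<in> lines ?A ?C" for \<zeta> \<xi>
  proof (cases "\<zeta> \<in> bd \<and> \<xi> \<in> bd")
    case True
    then have "(\<zeta>, \<xi>) \<in> ?L \<longleftrightarrow> \<zeta> \<noteq> \<xi> \<and> \<zeta> \<in> bdset ?A \<and> \<xi> \<in> bdset ?C"
      using bd_map_in_bdset_iff[OF f _ A] bd_map_in_bdset_iff[OF f _ C]
      by (auto simp: topspace_bd2 lines_def)
    then show ?thesis
      using disj by (auto simp: lines_def)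
  next
    case False
    then show ?thesis
      using bdset_subset[of ?A] bdset_subset[of ?C] by (auto simp: topspace_bd2 lines_def)
  qed
  then show ?thesis
    by (simp add: set_eq_iff split_paired_all)
qed

lemma push_lines:
  assumes "sets \<nu> = sets (borel_of bd2)" "end_iso f f'"
    "almost_invariant A" "almost_invariant C" "A \<inter> C = {}"
  shows "emeasure (push F X f \<nu>) (lines A C) = emeasure \<nu> (lines {g \<in> carrier F. f g \<in> A} {g \<in> carrier F. f g \<in> C})"
proof -
  have "bd2_map f \<in> measurable \<nu> (borel_of bd2)"
    using measurable_borel_of[OF continuous_map_bd2_map[OF assms(2)] assms(1)] .
  then have "emeasure (push F X f \<nu>) (lines A C) = emeasure \<nu> (bd2_map f -` lines A C \<inter> space \<nu>)"
    unfolding push_def by (rule emeasure_distr) (rule lines_sets[OF refl assms(3-5)])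
  moreover have "space \<nu> = topspace bd2"
    using sets_eq_imp_space_eq[OF assms(1)] by simp
  ultimately show ?thesis
    using bd2_map_vimage_lines[OF assms(2-5)] by simp
qed

lemma mass_push:
  assumes "\<nu> \<in> currents F X" "end_iso f f'"
    "almost_invariant A" "almost_invariant C" "A \<inter> C = {}"
  shows "mass (push F X f \<nu>) A C = mass \<nu> {g \<in> carrier F. f g \<in> A} {g \<in> carrier F. f g \<in> C}"
  using push_lines[OF current_sets(1)[OF assms(1)] assms(2-5)] by (simp add: mass_def measure_def)

lemma mass_translate:
  assumes \<nu>: "\<nu> \<in> currents F X" and h: "h \<in> carrier F"
    and A: "almost_invariant A" and C: "almost_invariant C" and d: "A \<inter> C = {}"
  shows "mass \<nu> ((\<lambda>g. h \<otimes> g) ` A) ((\<lambda>g. h \<otimes> g) ` C) = mass \<nu> A C"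
proof -
  note t = end_iso_translation[OF h] and t' = end_iso_translation[OF inv_closed[OF h]]
  have i: "inv h \<in> carrier F"
    using h by simp
  have "push F X (\<lambda>g. inv h \<otimes> g) \<nu> = \<nu>"
    using \<nu> i by (simp add: currents_def)
  then have "mass \<nu> A C = mass \<nu> {g \<in> carrier F. inv h \<otimes> g \<in> A} {g \<in> carrier F. inv h \<otimes> g \<in> C}"
    using mass_push[OF \<nu> t' A C d] by simp
  then show ?thesis
    using end_iso_image_eq[OF t] almost_invariant_carrier A C by simp
qed

lemma mass_commute:
  assumes \<nu>: "\<nu> \<in> currents F X"
    and A: "almost_invariant A" and C: "almost_invariant C" and d: "A \<inter> C = {}"
  shows "mass \<nu> A C = mass \<nu> C A"
proof -
  have "distr \<nu> (borel_of bd2) prod.swap = \<nu>"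
    using \<nu> by (simp add: currents_def)
  then have "emeasure \<nu> (lines A C) = emeasure (distr \<nu> (borel_of bd2) prod.swap) (lines A C)"
    by simp
  also have "\<dots> = emeasure \<nu> (prod.swap -` lines A C \<inter> space \<nu>)"
    using measurable_borel_of[OF continuous_map_bd2_swap current_sets(1)[OF \<nu>]]
    by (rule emeasure_distr) (rule lines_sets[OF refl A C d])
  also have "prod.swap -` lines A C \<inter> space \<nu> = lines C A"
    using bdset_disjoint[OF A C d] bdset_subset
    by (fastforce simp: current_sets(2)[OF \<nu>] topspace_bd2 lines_def)
  finally show ?thesis
    by (simp add: mass_def measure_def)
qed

lemma mass_finite_Union_le:
  assumes \<nu>: "\<nu> \<in> currents F X" and A: "almost_invariant A"
    and I: "finite I" "\<And>i. i \<in> I \<Longrightarrow> almost_invariant (C i) \<and> A \<inter> C i = {}"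
    and K: "finite K" "C' - K \<subseteq> (\<Union>i\<in>I. C i)"
  shows "mass \<nu> A C' \<le> (\<Sum>i\<in>I. mass \<nu> A (C i))"
proof -
  have s: "lines A (C i) \<in> fmeasurable \<nu>" if "i \<in> I" for i
    using current_lines_finite[OF \<nu> A, of "C i"] lines_sets[OF current_sets(1)[OF \<nu>] A, of "C i"] I(2) that
    by (auto simp: fmeasurable_def)
  have "lines A C' \<subseteq> (\<Union>i\<in>I. lines A (C i))"
    using bdset_finite_Union[OF I(1) _ K] I(2) by (fastforce simp: lines_def)
  then have "mass \<nu> A C' \<le> measure \<nu> (\<Union>i\<in>I. lines A (C i))"
    unfolding mass_def using s I(1)
    by (cases "lines A C' \<in> sets \<nu>")
      (auto simp: measure_notin_sets intro!: measure_mono_fmeasurable fmeasurable.finite_UN)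
  also have "\<dots> \<le> (\<Sum>i\<in>I. measure \<nu> (lines A (C i)))"
    by (rule measure_UNION_le[OF I(1)]) (use s in auto)
  finally show ?thesis
    by (simp add: mass_def)
qed

lemma sum_mass_disjoint_le:
  assumes \<nu>: "\<nu> \<in> currents F X" and A: "almost_invariant A" and C: "almost_invariant C" and d: "A \<inter> C = {}"
    and I: "finite I" "\<And>i. i \<in> I \<Longrightarrow> almost_invariant (A' i) \<and> almost_invariant (C' i) \<and> A' i \<subseteq> A \<and> C' i \<subseteq> C"
    and disj: "\<And>i j. i \<in> I \<Longrightarrow> j \<in> I \<Longrightarrow> i \<noteq> j \<Longrightarrow> C' i \<inter> C' j = {}"
  shows "(\<Sum>i\<in>I. mass \<nu> (A' i) (C' i)) \<le> mass \<nu> A C"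
proof -
  have s: "lines (A' i) (C' i) \<in> fmeasurable \<nu>" if "i \<in> I" for i
    using current_lines_finite[OF \<nu>, of "A' i" "C' i"] lines_sets[OF current_sets(1)[OF \<nu>], of "A' i" "C' i"] I(2)[OF that] d
    by (auto simp: fmeasurable_def)
  have AC: "lines A C \<in> fmeasurable \<nu>"
    using current_lines_finite[OF \<nu> A C d] lines_sets[OF current_sets(1)[OF \<nu>] A C d]
    by (auto simp: fmeasurable_def)
  have "(\<Sum>i\<in>I. mass \<nu> (A' i) (C' i)) = measure \<nu> (\<Union>i\<in>I. lines (A' i) (C' i))"
    unfolding mass_def
  proof (rule measure_finite_Union[symmetric, OF I(1)])
    show "disjoint_family_on (\<lambda>i. lines (A' i) (C' i)) I"
      unfolding disjoint_family_on_def
    proof (intro ballI impI)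
      fix i j assume ij: "i \<in> I" "j \<in> I" "i \<noteq> j"
      have "bdset (C' i) \<inter> bdset (C' j) = {}"
        using bdset_disjoint[OF _ _ disj[OF ij]] I(2) ij by blast
      then show "lines (A' i) (C' i) \<inter> lines (A' j) (C' j) = {}"
        by (auto simp: lines_def)
    qed
  qed (use s in \<open>auto simp: fmeasurable_def less_top\<close>)
  also have "\<dots> \<le> mass \<nu> A C"
    unfolding mass_def
  proof (rule measure_mono_fmeasurable[OF _ _ AC])
    show "(\<Union>i\<in>I. lines (A' i) (C' i)) \<subseteq> lines A C"
      using I(2) by (intro UN_least lines_mono) simp_all
    show "(\<Union>i\<in>I. lines (A' i) (C' i)) \<in> sets \<nu>"
      using s by (intro sets.finite_UN I(1)) (rule fmeasurableD)
  qed
  finally show ?thesis .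
qed

end

section \<open>Bases, primitive elements and automorphisms\<close>

context finite_rank_free_group
begin

lemma mutually_inverse_homsD:
  assumes "mutually_inverse_homs f f'"
  shows "f \<in> hom F F" "f' \<in> hom F F"
    "g \<in> carrier F \<Longrightarrow> f g \<in> carrier F" "g \<in> carrier F \<Longrightarrow> f' g \<in> carrier F"
    "g \<in> carrier F \<Longrightarrow> f' (f g) = g" "g \<in> carrier F \<Longrightarrow> f (f' g) = g"
    "g \<in> carrier F \<Longrightarrow> h \<in> carrier F \<Longrightarrow> f (g \<otimes> h) = f g \<otimes> f h"
  using assms by (auto simp: mutually_inverse_homs_def hom_def)

lemma mutually_inverse_homs_inj:
  assumes "mutually_inverse_homs f f'"
  shows "inj_on f (carrier F)"
  using mutually_inverse_homsD(5)[OF assms] by (metis inj_onI)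

end

lemma reduced_map:
  fixes f :: "'a \<Rightarrow> 'b"
  assumes "inj_on f A" "w \<in> lists (A \<times> UNIV)"
  shows "reduced (map (map_prod f id) w) \<longleftrightarrow> reduced w"
proof -
  define m where "m = (map_prod f id :: 'a \<times> bool \<Rightarrow> 'b \<times> bool)"
  have "reduced (map m w) \<longleftrightarrow> reduced w"
    using assms(2)
  proof (induction w rule: list.induct)
    case (Cons l w)
    have "hd (map m w) = linv (m l) \<longleftrightarrow> hd w = linv l" if "w \<noteq> []"
      using Cons.prems that assms(1)
      by (cases w) (auto simp: m_def linv_def prod_eq_iff inj_on_def)
    then show ?case
      using Cons by (auto simp: reduced_Cons)
  qed simp
  then show ?thesis
    by (simp add: m_def)
qed

context free_group
begin

lemma hom_word_val:
  assumes f: "f \<in> hom F F" and w: "w \<in> lists (carrier F \<times> UNIV)"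
  shows "word_val F w \<in> carrier F \<and> f (word_val F w) = word_val F (map (map_prod f id) w)"
proof -
  interpret f: group_hom F F f
    using f by (simp add: group_hom_def group_hom_axioms_def is_group)
  show ?thesis
    using w by (induction w rule: list.induct) (auto simp: word_val_def letter_val_def)
qed

text \<open>Homomorphisms to the group with two elements are arbitrary on a basis, so the number of
  them is the number of subsets of any basis.\<close>

lemma basis_card_le:
  assumes Y: "free_basis F Y" and X: "finite X"
  shows "finite Y \<and> card Y \<le> card X"
proof -
  interpret Y: free_group F Y
    using Y by unfold_locales
  let ?Z = "\<lparr>carrier = UNIV :: bool set, monoid.mult = (\<noteq>), one = False\<rparr>"
  have Z: "group ?Z"
    by (rule groupI) auto
  have "\<exists>f. f \<in> hom F ?Z \<and> (\<forall>y\<in>Y. f y = (y \<in> A))" for A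
    by (rule Y.free_group_extend_hom[OF Z, of "\<lambda>y. y \<in> A"]) auto
  then obtain ex where ex: "\<And>A. ex A \<in> hom F ?Z" "\<And>A y. y \<in> Y \<Longrightarrow> ex A y = (y \<in> A)"
    by metis
  have inj: "inj_on (\<lambda>A. {x \<in> X. ex A x}) (Pow Y)"
  proof (rule inj_onI)
    fix A C assume A: "A \<in> Pow Y" and C: "C \<in> Pow Y" and eq: "{x \<in> X. ex A x} = {x \<in> X. ex C x}"
    have "ex A g = ex C g" if "g \<in> carrier F" for g
      by (rule hom_eqI[OF ex(1) ex(1) Z _ that]) (use eq in blast)
    then have "y \<in> A \<longleftrightarrow> y \<in> C" if "y \<in> Y" for y
      using ex(2)[OF that] Y.basis_carrier[OF that] by metis
    then show "A = C"
      using A C by blast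
  qed
  have sub: "(\<lambda>A. {x \<in> X. ex A x}) ` Pow Y \<subseteq> Pow X"
    by blast
  have "finite (Pow Y)"
    using inj sub X by (meson finite_Pow_iff inj_on_finite)
  then have fin: "finite Y"
    by simp
  have "card (Pow Y) \<le> card (Pow X)"
    using card_inj_on_le[OF inj sub] X by simp
  then show ?thesis
    using fin X by (simp add: card_Pow)
qed

text \<open>The exponent sum in a basis element \<open>g\<close> is a homomorphism to the integers with
  value \<open>1\<close> on \<open>g\<close>, and \<open>1\<close> is not a proper multiple.\<close>

lemma basis_element_not_proper_power:
  assumes "g \<in> X"
  shows "\<not> proper_power F g"
proof
  assume "proper_power F g"
  then obtain f m where f: "f \<in> carrier F" "m > (1::nat)" "g = f [^] m"
    by (auto simp: proper_power_def)
  let ?Z = "\<lparr>carrier = UNIV :: int set, monoid.mult = (+), one = 0\<rparr>"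
  have Z: "group ?Z"
    by (rule groupI) (auto intro: exI[of _ "- _"])
  obtain ex where ex: "ex \<in> hom F ?Z" "\<And>x. x \<in> X \<Longrightarrow> ex x = (if x = g then 1 else 0)"
    by (rule free_group_extend_hom[OF Z, of "\<lambda>x. if x = g then 1 else 0"]) auto
  interpret group_hom F ?Z ex
    using ex(1) Z by (simp add: group_hom_def group_hom_axioms_def is_group)
  have "ex (f [^] n) = int n * ex f" for n :: nat
    using f(1) by (induction n) (auto simp: algebra_simps)
  then have "int m * ex f = 1"
    using ex(2)[OF assms] f(3) by metis
  then show False
    using f(2) by (simp add: zmult_eq_1_iff)
qed

end

context finite_rank_free_group
begin

lemma primitive_not_proper_power:
  assumes "primitive_element F g"
  shows "\<not> proper_power F g"
proof -
  obtain Y where Y: "free_basis F Y" "g \<in> Y"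
    using assms by (auto simp: primitive_element_def)
  interpret Y: free_group F Y
    using Y(1) by unfold_locales
  show ?thesis
    using Y.basis_element_not_proper_power[OF Y(2)] .
qed

text \<open>Any two bases have the same number of elements, so some bijection between them maps \<open>c\<close> to
  \<open>g\<close>; its extensions in both directions are mutually inverse.\<close>

lemma primitive_transitive:
  assumes g: "primitive_element F g" and c: "c \<in> X"
  obtains f f' where "mutually_inverse_homs f f'" "f c = g"
proof -
  obtain Y where Y: "free_basis F Y" "g \<in> Y"
    using g by (auto simp: primitive_element_def)
  interpret Y: free_group F Y
    using Y(1) by unfold_locales
  have fin: "finite Y" and "card Y = card X"
    using basis_card_le[OF Y(1) finite_basis] Y.basis_card_le[OF basis] by auto
  then have "card (X - {c}) = card (Y - {g})"
    using c Y(2) finite_basis by simp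
  then obtain b where b: "bij_betw b (X - {c}) (Y - {g})"
    using finite_same_card_bij[of "X - {c}" "Y - {g}"] fin finite_basis by auto
  define \<beta> where "\<beta> = b(c := g)"
  have "bij_betw \<beta> ({c} \<union> (X - {c})) ({g} \<union> (Y - {g}))"
  proof (rule bij_betw_combine)
    show "bij_betw \<beta> {c} {g}"
      by (simp add: \<beta>_def bij_betw_def)
    show "bij_betw \<beta> (X - {c}) (Y - {g})"
      using b by (rule bij_betw_cong[THEN iffD1, rotated]) (simp add: \<beta>_def)
  qed simp
  then have \<beta>: "bij_betw \<beta> X Y"
    using c Y(2) by (simp add: insert_absorb)
  let ?\<beta>' = "inv_into X \<beta>"
  obtain f where f: "f \<in> hom F F" "\<And>x. x \<in> X \<Longrightarrow> f x = \<beta> x"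
    using free_group_extend_hom[OF is_group, of \<beta>] bij_betw_imp_funcset[OF \<beta>] Y.basis_carrier
    by (metis (no_types, lifting) Pi_iff)
  obtain f' where f': "f' \<in> hom F F" "\<And>y. y \<in> Y \<Longrightarrow> f' y = ?\<beta>' y"
    using Y.free_group_extend_hom[OF is_group, of ?\<beta>'] bij_betw_imp_funcset[OF bij_betw_inv_into[OF \<beta>]] basis_carrier
    by (metis (no_types, lifting) Pi_iff)
  have idh: "(\<lambda>x. x) \<in> hom F F"
    by (simp add: hom_def)
  have comp: "(\<lambda>x. f' (f x)) \<in> hom F F" "(\<lambda>x. f (f' x)) \<in> hom F F"
    using f(1) f'(1) by (auto simp: hom_def Pi_iff)
  have "f' (f h) = h" if "h \<in> carrier F" for h
    by (rule hom_eqI[OF comp(1) idh is_group _ that])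
      (use \<beta> f(2) f'(2) in \<open>simp add: bij_betw_apply bij_betw_inv_into_left\<close>)
  moreover have "f (f' h) = h" if "h \<in> carrier F" for h
    by (rule Y.hom_eqI[OF comp(2) idh is_group _ that])
      (use bij_betw_inv_into[OF \<beta>] \<beta> f(2) f'(2) in \<open>simp add: bij_betw_apply bij_betw_inv_into_right\<close>)
  ultimately have "mutually_inverse_homs f f'"
    using f(1) f'(1) by (simp add: mutually_inverse_homs_def)
  moreover have "f c = g"
    using f(2)[OF c] by (simp add: \<beta>_def)
  ultimately show ?thesis
    using that by blast
qed

lemma free_basis_image:
  assumes f: "mutually_inverse_homs f f'" and Y: "free_basis F Y"
  shows "free_basis F (f ` Y)"
  unfolding free_basis_def
proof (intro conjI ballI)
  interpret Y: free_group F Y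
    using Y by unfold_locales
  note D = mutually_inverse_homsD[OF f]
  show "f ` Y \<subseteq> carrier F"
    using Y.basis_carrier D(3) by blast
  fix g assume g: "g \<in> carrier F"
  let ?m = "map (map_prod f id) :: 'a word \<Rightarrow> 'a word" and ?m' = "map (map_prod f' id) :: 'a word \<Rightarrow> 'a word"
  have inj: "inj_on f Y" "inj_on f' (f ` Y)"
    using D(5) Y.basis_carrier by (auto simp: inj_on_def) metis
  have in_carrier: "w \<in> lists (carrier F \<times> UNIV)" if "w \<in> lists (Y \<times> UNIV)" for w :: "'a word"
    using that Y.basis_carrier by (auto simp: in_lists_conv_set)
  have mm: "?m' (?m w) = w" if "w \<in> lists (Y \<times> UNIV)" for w
    using that Y.basis_carrier D(5) by (induction w rule: list.induct) auto
  have mm': "?m (?m' v) = v" "?m' v \<in> lists (Y \<times> UNIV)" if "v \<in> lists (f ` Y \<times> UNIV)" for v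
    using that Y.basis_carrier D(5) by (induction v rule: list.induct) auto
  have m_in: "?m w \<in> lists (f ` Y \<times> UNIV)" if "w \<in> lists (Y \<times> UNIV)" for w
    using that by (induction w rule: list.induct) auto
  let ?w = "Y.nf (f' g)"
  have w: "?w \<in> lists (Y \<times> UNIV)" "reduced ?w" "word_val F ?w = f' g"
    using D(4)[OF g] by auto
  show "\<exists>!v. v \<in> lists (f ` Y \<times> UNIV) \<and> reduced v \<and> word_val F v = g"
  proof (rule ex1I)
    have "word_val F (?m ?w) = f (word_val F ?w)"
      using hom_word_val[OF D(1) in_carrier[OF w(1)]] by simp
    then show "?m ?w \<in> lists (f ` Y \<times> UNIV) \<and> reduced (?m ?w) \<and> word_val F (?m ?w) = g"
      using w m_in reduced_map[OF inj(1) w(1)] D(6)[OF g] by simp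
  next
    fix v assume v: "v \<in> lists (f ` Y \<times> UNIV) \<and> reduced v \<and> word_val F v = g"
    have vc: "v \<in> lists (carrier F \<times> UNIV)"
      using v Y.basis_carrier D(3) by (auto simp: in_lists_conv_set)
    have "word_val F (?m' v) = f' g"
      using hom_word_val[OF D(2) vc] v by simp
    moreover have "reduced (?m' v)" "?m' v \<in> lists (Y \<times> UNIV)"
      using reduced_map[OF inj(2)] v mm' by auto
    ultimately have "?w = ?m' v"
      using Y.nf_wval by metis
    then show "v = ?m ?w"
      using mm'(1) v by simp
  qed
qed

lemma primitive_image:
  "mutually_inverse_homs f f' \<Longrightarrow> primitive_element F g \<Longrightarrow> primitive_element F (f g)"
  unfolding primitive_element_def using free_basis_image by blast

end

section \<open>Twisting along a basis element\<close>

context finite_rank_free_group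
begin

definition power_word :: "'a \<Rightarrow> int \<Rightarrow> 'a word" where
  "power_word c m = replicate (nat \<bar>m\<bar>) (c, m \<ge> 0)"

lemma power_word_letters: "c \<in> X \<Longrightarrow> power_word c m \<in> lists letters"
  by (auto simp: power_word_def in_lists_conv_set)

lemma power_word_fst: "l \<in> set (power_word c m) \<Longrightarrow> fst l = c"
  by (auto simp: power_word_def)

lemma reduced_power_word_snoc: "fst z \<noteq> c \<Longrightarrow> reduced (power_word c m @ [z])"
  by (auto simp: reduced_append power_word_def linv_def)

lemma power_word_inject: "power_word c m = power_word c m' \<longleftrightarrow> m = m'"
proof
  assume eq: "power_word c m = power_word c m'"
  then have len: "nat \<bar>m\<bar> = nat \<bar>m'\<bar>"
    by (metis length_replicate power_word_def)
  show "m = m'"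
  proof (cases "m = 0")
    case False
    then have "(m \<ge> 0) = (m' \<ge> 0)"
      using eq len by (auto simp: power_word_def replicate_eq_replicate)
    then show ?thesis
      using len by linarith
  qed (use len in simp)
qed simp

lemma wval_replicate: "l \<in> letters \<Longrightarrow> wval (replicate n l) = lval l [^] n"
proof (induction n)
  case (Suc n)
  then show ?case
    using nat_pow_Suc2[of "lval l" n] by simp
qed simp

lemma wval_power_word:
  assumes c: "c \<in> X"
  shows "wval (power_word c m) = c [^] m"
proof (cases "m \<ge> 0")
  case True
  then have "power_word c m = replicate (nat m) (c, True)"
    by (simp add: power_word_def)
  moreover have "c [^] m = c [^] nat m"
    using True by (simp only: int_pow_def2) simp
  moreover have "lval (c, True) = c"
    by (simp add: letter_val_def)
  ultimately show ?thesis
    using wval_replicate[of "(c, True)" "nat m"] c by simp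
next
  case False
  then have "power_word c m = replicate (nat (- m)) (c, False)"
    by (simp add: power_word_def)
  moreover have "c [^] m = inv c [^] nat (- m)"
    using False basis_carrier[OF c] by (simp only: int_pow_def2 nat_pow_inv) simp
  moreover have "lval (c, False) = inv c"
    by (simp add: letter_val_def)
  ultimately show ?thesis
    using wval_replicate[of "(c, False)" "nat (- m)"] c by simp
qed

lemma nf_power:
  assumes c: "c \<in> X"
  shows "nf (c [^] (m::int)) = power_word c m"
proof -
  have "reduced (power_word c m)"
    by (simp add: power_word_def)
  then show ?thesis
    using nf_wval[OF power_word_letters[OF c]] wval_power_word[OF c] by metis
qed

lemma reduced_letters_of_one_generator:
  assumes "reduced u" "\<And>l. l \<in> set u \<Longrightarrow> fst l = c"
  obtains m where "u = power_word c m"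
proof -
  have "u = replicate (length u) (hd u)"
    using assms
  proof (induction u)
    case (Cons l u)
    then have u: "u = replicate (length u) (hd u)"
      by (auto simp: reduced_Cons)
    show ?case
    proof (cases "u = []")
      case False
      then have "fst (hd u) = fst l" "hd u \<noteq> linv l"
        using Cons.prems by (auto simp: reduced_Cons)
      then have "hd u = l"
        using same_fst_letters by metis
      then show ?thesis
        using u by simp
    qed simp
  qed simp
  moreover have "u = power_word c (if snd (hd u) then int (length u) else - int (length u))"
    if "u \<noteq> []"
  proof -
    have "fst (hd u) = c"
      using assms(2) that by simp
    then have "hd u = (c, snd (hd u))"
      by (metis prod.collapse)
    then show ?thesis
      using calculation that by (auto simp: power_word_def)
  qed
  ultimately show ?thesis
    using that[of 0] that by (cases "u = []") (auto simp: power_word_def)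
qed

lemma power_translate_cyl:
  assumes "c \<in> X" "z \<in> letters" "fst z \<noteq> c"
  shows "(\<lambda>g. c [^] (m::int) \<otimes> g) ` cyl [z] = cyl (power_word c m @ [z])"
proof -
  have "power_word c m @ [z] \<in> lists letters"
    using power_word_letters[OF assms(1)] assms(2) by simp
  from cyl_translate[OF this reduced_power_word_snoc[OF assms(3)]] show ?thesis
    by (simp add: wval_power_word[OF assms(1)])
qed

lemma cyl_power_word_unique:
  assumes "g \<in> cyl (power_word c m @ [z])" "g \<in> cyl (power_word c m' @ [z'])" "fst z \<noteq> c" "fst z' \<noteq> c"
  shows "m = m' \<and> z = z'"
proof -
  obtain s s' where "nf g = (power_word c m @ [z]) @ s" "nf g = (power_word c m' @ [z']) @ s'"
    using assms(1,2) unfolding cyl_def by blast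
  then have t: "nf g = power_word c m @ z # s" "nf g = power_word c m' @ z' # s'"
    by simp_all
  have "takeWhile (\<lambda>l. fst l = c) (power_word c k @ y # s) = power_word c k" if "fst y \<noteq> c" for k y s
  proof -
    have "takeWhile (\<lambda>l. fst l = c) (power_word c k @ y # s) =
        power_word c k @ takeWhile (\<lambda>l. fst l = c) (y # s)"
      by (rule takeWhile_append2) (rule power_word_fst)
    then show ?thesis
      using that by simp
  qed
  then have "power_word c m = power_word c m'"
    using t assms(3,4) by metis
  then show ?thesis
    using t power_word_inject[of c m m'] by simp
qed

text \<open>Position of an element relative to the axis of \<open>c\<close>: it is on the axis, or it leaves the
  axis at a power of \<open>c\<close> through a letter \<open>z\<close>.\<close>

lemma axis_position:
  assumes c: "c \<in> X" and g: "g \<in> carrier F"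
  obtains (on) m where "g = c [^] (m::int)" | (off) m z where "z \<in> letters" "fst z \<noteq> c" "g \<in> cyl (power_word c m @ [z])"
proof -
  define u where "u = takeWhile (\<lambda>l. fst l = c) (nf g)"
  define v where "v = dropWhile (\<lambda>l. fst l = c) (nf g)"
  have uv: "nf g = u @ v"
    by (simp add: u_def v_def)
  have "reduced u"
    using nf_reduced[OF g] uv by (simp add: reduced_append)
  then obtain m where m: "u = power_word c m"
    using reduced_letters_of_one_generator[of u c] set_takeWhileD unfolding u_def by metis
  show thesis
  proof (cases v)
    case Nil
    then have "g = c [^] m"
      using wval_nf[OF g] uv m wval_power_word[OF c] by simp
    then show ?thesis
      by (rule on)
  next
    case (Cons z t)
    then have "fst z \<noteq> c"
      using v_def by (metis (mono_tags, lifting) dropWhile_eq_Cons_conv)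
    moreover have "z \<in> letters"
      using nf_lists[OF g] uv Cons by simp
    moreover have "g \<in> cyl (power_word c m @ [z])"
      using g uv m Cons by (auto simp: cyl_def)
    ultimately show ?thesis
      by (intro off)
  qed
qed

text \<open>An automorphism that fixes \<open>c\<close> and inserts powers of \<open>c\<close> next to the other letters:
  \<open>t z\<close> of them before \<open>z\<close>, and consistently \<open>t (linv z)\<close> inverse ones after it.\<close>

definition is_twist :: "'a \<Rightarrow> ('a \<times> bool \<Rightarrow> int) \<Rightarrow> ('a \<Rightarrow> 'a) \<Rightarrow> bool" where
  "is_twist c t f \<longleftrightarrow> f \<in> hom F F \<and> f c = c \<and>
     (\<forall>z\<in>letters. fst z \<noteq> c \<longrightarrow> f (lval z) = c [^] t z \<otimes> lval z \<otimes> c [^] (- t (linv z)))"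

lemma twist_exists:
  assumes c: "c \<in> X"
  obtains f where "is_twist c t f"
proof -
  define a where "a x = (if x = c then c else c [^] t (x, True) \<otimes> x \<otimes> c [^] (- t (x, False)))" for x
  have cc: "c \<in> carrier F"
    using c basis_carrier by blast
  have "a \<in> X \<rightarrow> carrier F"
    using cc basis_carrier by (auto simp: a_def)
  then obtain f where f: "f \<in> hom F F" "\<And>x. x \<in> X \<Longrightarrow> f x = a x"
    using free_group_extend_hom[OF is_group] by metis
  have "f (lval z) = c [^] t z \<otimes> lval z \<otimes> c [^] (- t (linv z))" if z: "z \<in> letters" "fst z \<noteq> c" for z
  proof (cases "snd z")
    case True
    then have "z = (fst z, True)" "linv z = (fst z, False)"
      by (auto simp: linv_def prod_eq_iff)
    moreover have "lval z = fst z" "fst z \<in> X"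
      using True z by (auto simp: letter_val_def)
    ultimately show ?thesis
      using f(2)[of "fst z"] z by (simp add: a_def)
  next
    case False
    then have zz: "z = (fst z, False)" "linv z = (fst z, True)"
      by (auto simp: linv_def prod_eq_iff)
    have x: "fst z \<in> X" "fst z \<in> carrier F"
      using z basis_carrier by auto
    have "f (lval z) = inv (f (lval (linv z)))"
      using hom_lval_linv[OF f(1) is_group, of "linv z"] z by simp
    also have "lval (linv z) = fst z"
      using zz by (simp add: letter_val_def)
    also have "inv (f (fst z)) = inv (c [^] t (linv z) \<otimes> fst z \<otimes> c [^] (- t z))"
      using f(2)[OF x(1)] z zz by (simp add: a_def)
    also have "\<dots> = c [^] t z \<otimes> inv (fst z) \<otimes> c [^] (- t (linv z))"
      using cc x by (simp add: inv_mult_group int_pow_neg m_assoc)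
    also have "inv (fst z) = lval z"
      using False by (simp add: letter_val_def)
    finally show ?thesis .
  qed
  then have "is_twist c t f"
    using f c by (simp add: is_twist_def a_def)
  then show ?thesis
    by (rule that)
qed

lemma is_twist_power:
  assumes "is_twist c t f" "c \<in> X"
  shows "f (c [^] (m::int)) = c [^] m"
  using assms hom_int_pow[of f F F c m] is_group basis_carrier by (simp add: is_twist_def)

lemma twist_inverse:
  assumes f: "is_twist c t f" and f': "is_twist c (\<lambda>z. - t z) f'" and c: "c \<in> X" and g: "g \<in> carrier F"
  shows "f' (f g) = g"
proof (rule hom_eqI[of "\<lambda>x. f' (f x)" F "\<lambda>x. x", OF _ _ is_group _ g])
  have cc: "c \<in> carrier F"
    using c basis_carrier by blast
  have h: "f \<in> hom F F" "f' \<in> hom F F"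
    using f f' by (simp_all add: is_twist_def)
  then show "(\<lambda>x. f' (f x)) \<in> hom F F"
    by (auto simp: hom_def Pi_iff)
  show "(\<lambda>x. x) \<in> hom F F"
    by (simp add: hom_def)
  fix x assume x: "x \<in> X"
  show "f' (f x) = x"
  proof (cases "x = c")
    case True
    then show ?thesis
      using f f' by (simp add: is_twist_def)
  next
    case False
    have xc: "x \<in> carrier F"
      using x basis_carrier by blast
    have l: "lval (x, True) = x" "linv (x, True) = (x, False)"
      by (simp_all add: letter_val_def linv_def)
    have fx: "f x = c [^] t (x, True) \<otimes> x \<otimes> c [^] (- t (x, False))"
      using f x False l unfolding is_twist_def by (metis UNIV_I fst_conv mem_Sigma_iff)
    have f'x: "f' x = c [^] (- t (x, True)) \<otimes> x \<otimes> c [^] t (x, False)"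
      using f' x False l unfolding is_twist_def by (metis UNIV_I fst_conv mem_Sigma_iff minus_minus)
    have m: "f' (a \<otimes> b) = f' a \<otimes> f' b" if "a \<in> carrier F" "b \<in> carrier F" for a b
      using h(2) that by (auto simp: hom_def)
    have "f' (f x) = c [^] t (x, True) \<otimes> (c [^] (- t (x, True)) \<otimes> x \<otimes> c [^] t (x, False)) \<otimes> c [^] (- t (x, False))"
      using cc xc fx f'x by (simp add: m is_twist_power[OF f' c])
    also have "\<dots> = (c [^] t (x, True) \<otimes> c [^] (- t (x, True))) \<otimes> x \<otimes> (c [^] t (x, False) \<otimes> c [^] (- t (x, False)))"
      using cc xc by (simp add: m_assoc)
    also have "\<dots> = x"
      using cc xc by (simp add: int_pow_neg)
    finally show ?thesis .
  qed
qed

lemma twists_mutually_inverse: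
  assumes "is_twist c t f" "is_twist c (\<lambda>z. - t z) f'" "c \<in> X"
  shows "mutually_inverse_homs f f'"
  using assms twist_inverse[of c t f f'] twist_inverse[of c "\<lambda>z. - t z" f' f]
  by (simp add: mutually_inverse_homs_def is_twist_def)

text \<open>A twist maps the half-tree behind a letter \<open>z \<noteq> c\<close> into its translate by a power of
  \<open>c\<close>. Cancellation of \<open>z\<close> against the image of the remaining word would need the next letter
  off the axis of \<open>c\<close> to be the inverse of \<open>z\<close>; then the two inserted powers of \<open>c\<close> cancel
  each other exactly, and the original word would not have been reduced.\<close>

lemma twist_cyl:
  assumes f: "is_twist c t f" and c: "c \<in> X"
    and "z \<in> letters" "fst z \<noteq> c" "g \<in> cyl [z]"
  shows "f g \<in> cyl (power_word c (t z) @ [z])"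
  using assms(3-5)
proof (induction "length (nf g)" arbitrary: g z rule: less_induct)
  case less
  have cc: "c \<in> carrier F"
    using c basis_carrier by blast
  have h: "f (a \<otimes> b) = f a \<otimes> f b" "f a \<in> carrier F" if "a \<in> carrier F" "b \<in> carrier F" for a b
    using f that by (auto simp: is_twist_def hom_def)
  have g: "g \<in> carrier F"
    using less.prems(3) by (rule cyl_in_carrier)
  obtain v where v: "nf g = z # v"
    using less.prems(3) by (auto simp: cyl_def)
  have vw: "v \<in> lists letters" "reduced v" "v \<noteq> [] \<longrightarrow> hd v \<noteq> linv z"
    using nf_lists[OF g] nf_reduced[OF g] v by (auto simp: reduced_Cons)
  define g' where "g' = wval v"
  have g': "g' \<in> carrier F" "nf g' = v"
    using vw by (simp_all add: g'_def)
  have gz: "g = lval z \<otimes> g'"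
    using wval_nf[OF g] v by (simp add: g'_def)
  have zl: "lval z \<in> carrier F"
    using less.prems(1) by simp
  define y where "y = c [^] (- t (linv z)) \<otimes> f g'"
  have y: "y \<in> carrier F"
    using cc h(2)[OF g'(1) g'(1)] by (simp add: y_def)
  have fz: "f (lval z) = c [^] t z \<otimes> lval z \<otimes> c [^] (- t (linv z))"
    using f less.prems(1,2) unfolding is_twist_def by blast
  have fg: "f g = c [^] t z \<otimes> (lval z \<otimes> y)"
    using cc zl g'(1) h(2)[OF g'(1) g'(1)] by (simp add: gz h(1) fz y_def m_assoc)
  have "y \<notin> cyl [linv z]"
  proof
    assume "y \<in> cyl [linv z]"
    then have y_in: "y \<in> cyl (power_word c 0 @ [linv z])"
      by (simp add: power_word_def)
    show False
      using c g'(1)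
    proof (cases rule: axis_position)
      case (on m)
      then have "y = c [^] (m - t (linv z))"
        using cc is_twist_power[OF f c] int_pow_mult[of c "- t (linv z)" m] by (simp add: y_def)
      then have "nf y = power_word c (m - t (linv z))"
        using nf_power[OF c] by simp
      moreover obtain s where "nf y = linv z # s"
        using y_in by (auto simp: cyl_def power_word_def)
      ultimately show False
        using power_word_fst[of "linv z" c] less.prems(2) by (metis fst_linv list.set_intros(1))
    next
      case (off m z1)
      then obtain g1 where g1: "g1 \<in> cyl [z1]" "g' = c [^] m \<otimes> g1"
        using power_translate_cyl[OF c off(1,2), of m] by blast
      have g1c: "g1 \<in> carrier F"
        using g1(1) by (rule cyl_in_carrier)
      have "nf g' = power_word c m @ nf g1"
      proof -
        have "reduced (power_word c m @ nf g1)"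
          using reduced_power_word_snoc[OF off(2), of m] nf_reduced[OF g1c] g1(1)
          by (auto simp: reduced_append in_cyl_single)
        then show ?thesis
          using nf_mult_reduced[OF power_word_letters[OF c] g1c] wval_power_word[OF c] g1(2) by simp
      qed
      then have "length (nf g1) < length (nf g)"
        using g' v by simp
      from less.hyps[OF this off(1,2) g1(1)]
      obtain y1 where y1: "y1 \<in> cyl [z1]" "f g1 = c [^] t z1 \<otimes> y1"
        using power_translate_cyl[OF c off(1,2)] by blast
      have y1c: "y1 \<in> carrier F"
        using y1(1) by (rule cyl_in_carrier)
      have "f g' = c [^] m \<otimes> (c [^] t z1 \<otimes> y1)"
        using g1 g1c cc y1 by (simp add: h(1) is_twist_power[OF f c])
      then have "y = c [^] (- t (linv z) + (m + t z1)) \<otimes> y1"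
        using cc y1c by (simp only: y_def int_pow_mult m_assoc int_pow_closed m_closed)
      then have "y \<in> cyl (power_word c (- t (linv z) + (m + t z1)) @ [z1])"
        using y1(1) power_translate_cyl[OF c off(1,2)] by blast
      then have *: "- t (linv z) + (m + t z1) = 0 \<and> z1 = linv z"
        by (rule cyl_power_word_unique[OF _ y_in off(2)]) (use less.prems(2) in simp)
      then have "m = 0"
        by auto
      then have "g' \<in> cyl [linv z]"
        using off(3) * by (simp add: power_word_def)
      then show False
        using vw(3) g'(2) by (auto simp: in_cyl_single)
    qed
  qed
  then have "lval z \<otimes> y \<in> cyl [z]"
    using lval_translate_compl[OF less.prems(1)] y by blast
  then show ?case
    using fg power_translate_cyl[OF c less.prems(1,2)] by blast
qed

lemma twist_vimage_cyl:
  assumes f: "is_twist c t f" and f': "is_twist c (\<lambda>z. - t z) f'" and c: "c \<in> X"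
    and z: "z \<in> letters" "fst z \<noteq> c"
  shows "{g \<in> carrier F. f g \<in> cyl (power_word c (t z) @ [z])} = cyl [z]"
proof (intro equalityI subsetI)
  fix g assume "g \<in> cyl [z]"
  then show "g \<in> {g \<in> carrier F. f g \<in> cyl (power_word c (t z) @ [z])}"
    using twist_cyl[OF f c z] cyl_in_carrier by blast
next
  fix g assume "g \<in> {g \<in> carrier F. f g \<in> cyl (power_word c (t z) @ [z])}"
  then have g: "g \<in> carrier F" and "f g \<in> cyl (power_word c (t z) @ [z])"
    by auto
  then obtain x where x: "x \<in> cyl [z]" "f g = c [^] t z \<otimes> x"
    using power_translate_cyl[OF c z] by blast
  obtain x' where x': "x' \<in> cyl [z]" "f' x = c [^] (- t z) \<otimes> x'"
    using twist_cyl[OF f' c z x(1)] power_translate_cyl[OF c z] by blast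
  have cc: "c \<in> carrier F" and xc: "x \<in> carrier F" "x' \<in> carrier F"
    using c basis_carrier x x' cyl_in_carrier by blast+
  have "g = f' (c [^] t z \<otimes> x)"
    using twist_inverse[OF f f' c g] x(2) by simp
  also have "\<dots> = c [^] t z \<otimes> (c [^] (- t z) \<otimes> x')"
    using f' cc xc x'(2) is_twist_power[OF f' c] by (simp add: is_twist_def hom_def)
  also have "\<dots> = x'"
    using cc xc by (simp add: m_assoc[symmetric] int_pow_neg)
  finally show "g \<in> cyl [z]"
    using x'(1) by simp
qed

end

section \<open>Edge masses\<close>

context finite_rank_free_group
begin

text \<open>The mass of the lines crossing the edge from the identity to the letter \<open>y\<close>.\<close>

definition edge_mass :: "'a bd_pair measure \<Rightarrow> 'a \<times> bool \<Rightarrow> real" where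
  "edge_mass \<nu> y = mass \<nu> (cyl [y]) (carrier F - cyl [y])"

lemma almost_invariant_co_cyl: "almost_invariant (carrier F - cyl p)"
  by (rule almost_invariant_compl[OF almost_invariant_cyl])

lemma edge_mass_swap: "\<nu> \<in> currents F X \<Longrightarrow> mass \<nu> (carrier F - cyl [y]) (cyl [y]) = edge_mass \<nu> y"
  unfolding edge_mass_def
  by (rule mass_commute[OF _ almost_invariant_co_cyl almost_invariant_cyl]) auto

text \<open>The same edge traversed backwards: translation by \<open>y\<close> and the flip.\<close>

lemma edge_mass_linv:
  assumes \<nu>: "\<nu> \<in> currents F X" and y: "y \<in> letters"
  shows "edge_mass \<nu> (linv y) = edge_mass \<nu> y"
proof -
  let ?t = "(`) (\<lambda>g. lval y \<otimes> g)"
  have l: "lval y \<in> carrier F"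
    using y by simp
  have 1: "?t (carrier F - cyl [linv y]) = cyl [y]"
    by (rule lval_translate_compl[OF y])
  have "?t (carrier F) = carrier F"
    using left_translate_bij[OF l] by (simp add: bij_betw_def)
  then have 2: "?t (cyl [linv y]) = carrier F - cyl [y]"
    using left_translate_diff[OF l, of "carrier F - cyl [linv y]"] 1 cyl_carrier[of "[linv y]"]
    by (simp add: double_diff)
  have "edge_mass \<nu> (linv y) = mass \<nu> (?t (cyl [linv y])) (?t (carrier F - cyl [linv y]))"
    unfolding edge_mass_def
    by (rule mass_translate[OF \<nu> l almost_invariant_cyl almost_invariant_co_cyl, symmetric]) auto
  then show ?thesis
    using edge_mass_swap[OF \<nu>] by (simp add: 1 2)
qed

text \<open>A half-tree behind a letter into which no power of \<open>c\<close> is inserted is its own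
  preimage.\<close>

lemma edge_mass_twist:
  assumes \<nu>: "\<nu> \<in> currents F X" and f: "is_twist c t f" and f': "is_twist c (\<lambda>z. - t z) f'" and c: "c \<in> X"
    and z: "z \<in> letters" "fst z \<noteq> c" "t z = 0"
  shows "edge_mass (push F X f \<nu>) z = edge_mass \<nu> z"
proof -
  note ff' = twists_mutually_inverse[OF f f' c]
  have pre: "{g \<in> carrier F. f g \<in> cyl [z]} = cyl [z]"
    using twist_vimage_cyl[OF f f' c z(1,2)] z(3) by (simp add: power_word_def)
  then have "{g \<in> carrier F. f g \<in> carrier F - cyl [z]} = carrier F - cyl [z]"
    using mutually_inverse_homsD(3)[OF ff'] by blast
  then show ?thesis
    using mass_push[OF \<nu> end_iso_automorphism[OF ff'] almost_invariant_cyl almost_invariant_co_cyl, of "[z]" "[z]"] pre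
    by (simp add: edge_mass_def)
qed

text \<open>A line from \<open>u\<close> to \<open>y\<close> is stretched by the twist into a line that runs along \<open>n\<close>
  edges of the axis of \<open>c\<close>. The \<open>n\<close> translates that bring these edges to the edge from the
  identity to \<open>c\<close> are disjoint, because they end on different translates of the half-tree
  behind \<open>y\<close>.\<close>

lemma edge_mass_twist_growth:
  assumes \<nu>: "\<nu> \<in> currents F X" and push: "push F X f \<nu> \<in> currents F X"
    and f: "is_twist c t f" and f': "is_twist c (\<lambda>z. - t z) f'" and c: "c \<in> X"
    and u: "u \<in> letters" "fst u \<noteq> c" "t u = int n" and y: "y \<in> letters" "fst y \<noteq> c" "t y = 0"
    and uy: "u \<noteq> y"
  shows "real n * mass \<nu> (cyl [u]) (cyl [y]) \<le> edge_mass (push F X f \<nu>) (c, True)"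
proof -
  define A where "A j = cyl (power_word c (int n - int j) @ [u])" for j
  define C where "C j = cyl (power_word c (- int j) @ [y])" for j
  have disj: "A j \<inter> C i = {}" for i j
    using cyl_power_word_unique[OF _ _ u(2) y(2)] uy by (auto simp: A_def C_def)
  have cc: "c [^] (m::int) \<in> carrier F" for m
    using basis_carrier[OF c] by simp
  have shift: "(\<lambda>g. c [^] (m::int) \<otimes> g) ` cyl (power_word c k @ [z]) = cyl (power_word c (m + k) @ [z])"
    if "z \<in> letters" "fst z \<noteq> c" for m k z
    unfolding power_translate_cyl[OF c that, symmetric]
    using basis_carrier[OF c] by (simp add: left_translate_translate[OF cc cc cyl_carrier] int_pow_mult)
  have ai: "almost_invariant (A j)" "almost_invariant (C j)" for j
    by (simp_all add: A_def C_def almost_invariant_cyl)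
  have "mass (push F X f \<nu>) (A j) (C j) = mass \<nu> (cyl [u]) (cyl [y])" for j
  proof -
    have "A j = (\<lambda>g. c [^] (- int j) \<otimes> g) ` A 0" "C j = (\<lambda>g. c [^] (- int j) \<otimes> g) ` C 0"
      using shift[OF u(1,2)] shift[OF y(1,2)] by (simp_all add: A_def C_def)
    then have "mass (push F X f \<nu>) (A j) (C j) = mass (push F X f \<nu>) (A 0) (C 0)"
      using mass_translate[OF push cc[of "- int j"] ai(1)[of 0] ai(2)[of 0] disj] by (simp only:)
    also have "\<dots> = mass \<nu> {g \<in> carrier F. f g \<in> A 0} {g \<in> carrier F. f g \<in> C 0}"
      by (rule mass_push[OF \<nu> end_iso_automorphism[OF twists_mutually_inverse[OF f f' c]] ai disj])
    also have "{g \<in> carrier F. f g \<in> A 0} = cyl [u]"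
      using twist_vimage_cyl[OF f f' c u(1,2)] u(3) by (simp add: A_def)
    also have "{g \<in> carrier F. f g \<in> C 0} = cyl [y]"
      using twist_vimage_cyl[OF f f' c y(1,2)] y(3) by (simp add: C_def)
    finally show ?thesis .
  qed
  then have "real n * mass \<nu> (cyl [u]) (cyl [y]) = (\<Sum>j<n. mass (push F X f \<nu>) (A j) (C j))"
    by simp
  also have "\<dots> \<le> edge_mass (push F X f \<nu>) (c, True)"
    unfolding edge_mass_def
  proof (rule sum_mass_disjoint_le[OF push almost_invariant_cyl almost_invariant_co_cyl])
    fix j assume "j \<in> {..<n}"
    then have "power_word c (int n - int j) @ [u] \<noteq> []" "hd (power_word c (int n - int j) @ [u]) = (c, True)"
      by (auto simp: power_word_def hd_append)
    then have "A j \<subseteq> cyl [(c, True)]"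
      unfolding A_def using cyl_subset_hd by metis
    moreover have "hd (power_word c (- int j) @ [y]) \<noteq> (c, True)"
      using y(2) by (cases "j = 0") (auto simp: power_word_def hd_append)
    then have "C j \<inter> cyl [(c, True)] = {}"
      using cyl_subset_hd[of "power_word c (- int j) @ [y]"] cyl_disjoint[of "[hd (power_word c (- int j) @ [y])]" "[(c, True)]"]
      unfolding C_def by auto
    then have "C j \<subseteq> carrier F - cyl [(c, True)]"
      using cyl_carrier unfolding C_def by blast
    ultimately show "almost_invariant (A j) \<and> almost_invariant (C j) \<and> A j \<subseteq> cyl [(c, True)] \<and> C j \<subseteq> carrier F - cyl [(c, True)]"
      by (simp add: A_def C_def almost_invariant_cyl)
  next
    fix i j :: nat assume "i \<noteq> j"
    then show "C i \<inter> C j = {}"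
      using cyl_power_word_unique[OF _ _ y(2) y(2)] unfolding C_def by fastforce
  qed auto
  finally show ?thesis .
qed

end


section \<open>Convergence is decided on edges\<close>

locale edge_convergence = finite_rank_free_group +
  fixes \<nu> :: "nat \<Rightarrow> 'a bd_pair measure" and \<mu> :: "'a bd_pair measure" and c :: 'a
  assumes \<nu>: "\<nu> n \<in> currents F X" and \<mu>: "\<mu> \<in> currents F X" and c: "c \<in> X"
    and lim: "y \<in> letters \<Longrightarrow> (\<lambda>n. edge_mass (\<nu> n) y) \<longlonglongrightarrow> edge_mass \<mu> y"
    and null: "y \<in> letters \<Longrightarrow> fst y \<noteq> c \<Longrightarrow> edge_mass \<mu> y = 0"
begin

definition converges :: "'a set \<Rightarrow> 'a set \<Rightarrow> bool" where
  "converges A C \<longleftrightarrow> (\<lambda>n. mass (\<nu> n) A C) \<longlonglongrightarrow> mass \<mu> A C"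

definition negligible :: "'a set \<Rightarrow> 'a set \<Rightarrow> bool" where
  "negligible A C \<longleftrightarrow> converges A C \<and> mass \<mu> A C = 0"

lemma negligible_tendsto: "negligible A C \<Longrightarrow> (\<lambda>n. mass (\<nu> n) A C) \<longlonglongrightarrow> 0"
  by (auto simp: negligible_def converges_def)

lemma negligible_mono:
  assumes "negligible A' C'" "almost_invariant A'" "almost_invariant C'" "A' \<inter> C' = {}"
    "A \<subseteq> A'" "C \<subseteq> C'"
  shows "negligible A C"
proof -
  have le: "mass m A C \<le> mass m A' C'" if "m \<in> currents F X" for m
    using mass_mono[OF that assms(2-6)] .
  have "mass \<mu> A C = 0"
    using le[OF \<mu>] assms(1) by (intro antisym) (simp_all add: negligible_def)
  moreover have "(\<lambda>n. mass (\<nu> n) A C) \<longlonglongrightarrow> 0"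
  proof (rule tendsto_sandwich[of "\<lambda>_. 0" _ _ "\<lambda>n. mass (\<nu> n) A' C'"])
    show "(\<lambda>n. mass (\<nu> n) A' C') \<longlonglongrightarrow> 0"
      using assms(1) by (rule negligible_tendsto)
  qed (use le[OF \<nu>] in auto)
  ultimately show ?thesis
    by (simp add: negligible_def converges_def)
qed

lemma translate_edge:
  assumes "p @ [z] \<in> lists letters" "reduced (p @ [z])" "m \<in> currents F X"
  shows "mass m (carrier F - cyl (p @ [z])) (cyl (p @ [z])) = edge_mass m z"
proof -
  have p: "wval p \<in> carrier F"
    using assms(1) by simp
  have t: "(\<lambda>g. wval p \<otimes> g) ` cyl [z] = cyl (p @ [z])"
    using cyl_translate[OF assms(1,2)] by simp
  then have "(\<lambda>g. wval p \<otimes> g) ` (carrier F - cyl [z]) = carrier F - cyl (p @ [z])"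
    using left_translate_diff[OF p cyl_carrier] by simp
  moreover have "(carrier F - cyl [z]) \<inter> cyl [z] = {}"
    by blast
  ultimately show ?thesis
    using mass_translate[OF assms(3) p almost_invariant_co_cyl almost_invariant_cyl, of "[z]" "[z]"]
      edge_mass_swap[OF assms(3)] t by simp
qed

text \<open>Lines that run along a reduced path are handled by extending the path one edge at a time.
  If the last edge is not labelled by \<open>c\<close>, the path has negligible mass; and a path along the
  axis of \<open>c\<close> loses only negligible mass when it is extended.\<close>

lemma path_converges:
  assumes "k \<noteq> []" "k \<in> lists letters" "reduced k"
  shows "converges (carrier F - cyl [hd k]) (cyl k) \<and>
    (fst (last k) \<noteq> c \<longrightarrow> negligible (carrier F - cyl [hd k]) (cyl k))"
  using assms
proof (induction k rule: rev_induct)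
  case (snoc z p)
  let ?A = "carrier F - cyl [hd (p @ [z])]"
  have w: "p @ [z] \<in> lists letters" "reduced (p @ [z])"
    using snoc.prems by auto
  have off_axis: "negligible (carrier F - cyl [hd (p @ [z'])]) (cyl (p @ [z']))"
    if "z' \<in> letters" "reduced (p @ [z'])" "fst z' \<noteq> c" for z'
  proof (rule negligible_mono)
    have "p @ [z'] \<in> lists letters"
      using w(1) that(1) by simp
    from translate_edge[OF this that(2)]
    show "negligible (carrier F - cyl (p @ [z'])) (cyl (p @ [z']))"
      using \<nu> \<mu> lim[OF that(1)] null[OF that(1,3)] by (simp add: negligible_def converges_def)
    show "carrier F - cyl [hd (p @ [z'])] \<subseteq> carrier F - cyl (p @ [z'])"
      using cyl_subset_hd[of "p @ [z']"] by blast
  qed (auto simp: almost_invariant_cyl almost_invariant_co_cyl)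
  show ?case
  proof (cases "p = []")
    case True
    then have "converges ?A (cyl (p @ [z]))"
      using lim[of z] snoc.prems edge_mass_swap \<nu> \<mu> by (simp add: converges_def)
    then show ?thesis
      using off_axis[of z] w by simp
  next
    case False
    have pw: "p \<in> lists letters" "reduced p" "z \<in> letters"
      using w by (auto simp: reduced_append)
    have hd: "hd (p @ [z']) = hd p" for z'
      using False by simp
    have A_disj: "?A \<inter> cyl p = {}" "?A \<inter> cyl (p @ [z']) = {}" for z'
      using cyl_subset_hd[OF False] cyl_append_subset[of p "[z']"] hd by auto
    note IH = snoc.IH[OF False pw(1,2)]
    consider "fst z \<noteq> c" | "fst z = c" "fst (last p) \<noteq> c" | "fst z = c" "fst (last p) = c"
      by blast
    then show ?thesis
    proof cases
      case 1
      then show ?thesis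
        using off_axis[of z] w by (simp add: negligible_def)
    next
      case 2
      have "negligible ?A (cyl (p @ [z]))"
        by (rule negligible_mono[of _ "cyl p"])
          (use IH 2 A_disj cyl_append_subset in \<open>auto simp: hd almost_invariant_cyl almost_invariant_co_cyl\<close>)
      then show ?thesis
        by (simp add: negligible_def)
    next
      case 3
      have "z \<noteq> linv (last p)"
        using w(2) False by (auto simp: reduced_append)
      then have z: "z = last p"
        using 3 same_fst_letters[of z "last p"] by auto
      let ?L = "{z' \<in> letters. fst z' \<noteq> c}"
      have fin: "finite ?L"
        using finite_letters by simp
      have L_neg: "negligible ?A (cyl (p @ [z']))" if "z' \<in> ?L" for z'
      proof -
        have "reduced (p @ [z'])"
          using pw that 3 by (auto simp: reduced_append)
        then show ?thesis
          using off_axis[of z'] that by (simp add: hd)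
      qed
      have upper: "mass m ?A (cyl p) \<le> mass m ?A (cyl (p @ [z])) + (\<Sum>z'\<in>?L. mass m ?A (cyl (p @ [z'])))"
        if "m \<in> currents F X" for m
      proof -
        have "{z' \<in> letters. p = [] \<or> z' \<noteq> linv (last p)} \<subseteq> insert z ?L"
          using 3 same_fst_letters[of _ "last p"] z False by auto
        then have "cyl p - {wval p} \<subseteq> (\<Union>z'\<in>insert z ?L. cyl (p @ [z']))"
          by (rule order_trans[OF cyl_children UN_mono[OF _ order_refl]])
        then have "mass m ?A (cyl p) \<le> (\<Sum>z'\<in>insert z ?L. mass m ?A (cyl (p @ [z'])))"
          using fin A_disj
          by (intro mass_finite_Union_le[OF that almost_invariant_co_cyl, where K = "{wval p}"])
            (simp_all add: almost_invariant_cyl)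
        then show ?thesis
          using fin 3 by simp
      qed
      have lower: "mass m ?A (cyl (p @ [z])) \<le> mass m ?A (cyl p)" if "m \<in> currents F X" for m
        by (rule mass_mono[OF that almost_invariant_co_cyl almost_invariant_cyl A_disj(1) order_refl cyl_append_subset])
      have "(\<Sum>z'\<in>?L. mass \<mu> ?A (cyl (p @ [z']))) = 0"
        using L_neg by (intro sum.neutral) (simp add: negligible_def)
      then have \<mu>_eq: "mass \<mu> ?A (cyl (p @ [z])) = mass \<mu> ?A (cyl p)"
        using upper[OF \<mu>] lower[OF \<mu>] by linarith
      have p_lim: "(\<lambda>n. mass (\<nu> n) ?A (cyl p)) \<longlonglongrightarrow> mass \<mu> ?A (cyl p)"
        using IH by (simp add: converges_def hd)
      have "(\<lambda>n. \<Sum>z'\<in>?L. mass (\<nu> n) ?A (cyl (p @ [z']))) \<longlonglongrightarrow> (\<Sum>z'\<in>?L. 0)"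
        using L_neg by (intro tendsto_sum negligible_tendsto)
      then have low_lim: "(\<lambda>n. mass (\<nu> n) ?A (cyl p) - (\<Sum>z'\<in>?L. mass (\<nu> n) ?A (cyl (p @ [z'])))) \<longlonglongrightarrow>
          mass \<mu> ?A (cyl p)"
        using tendsto_diff[OF p_lim] by fastforce
      have "(\<lambda>n. mass (\<nu> n) ?A (cyl (p @ [z]))) \<longlonglongrightarrow> mass \<mu> ?A (cyl p)"
      proof (rule tendsto_sandwich[OF always_eventually always_eventually low_lim p_lim]; intro allI)
        fix n
        show "mass (\<nu> n) ?A (cyl p) - (\<Sum>z'\<in>?L. mass (\<nu> n) ?A (cyl (p @ [z']))) \<le> mass (\<nu> n) ?A (cyl (p @ [z]))"
          using upper[OF \<nu>[of n]] by linarith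
        show "mass (\<nu> n) ?A (cyl (p @ [z])) \<le> mass (\<nu> n) ?A (cyl p)"
          by (rule lower[OF \<nu>])
      qed
      then show ?thesis
        using \<mu>_eq 3 by (simp add: converges_def)
    qed
  qed
qed simp

text \<open>Seen from the end of \<open>p\<close>, the lines between two cylinders are the lines that run along the
  path from \<open>p\<close> to \<open>q\<close>, which goes back to the branching point of the two words and then
  forward along \<open>q\<close>.\<close>

lemma cylinder_pair_converges:
  assumes p: "p \<in> lists letters" "reduced p" and q: "q \<in> lists letters" "reduced q"
    and pq: "length p = length q" "p \<noteq> q"
  shows "converges (cyl p) (cyl q)"
proof -
  obtain r a p' b q' where r: "p = r @ a # p'" "q = r @ b # q'" "a \<noteq> b"
    using split_at_first_difference[OF pq] .
  define k where "k = winv (a # p') @ (b # q')"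
  have k: "k \<noteq> []" "k \<in> lists letters" "reduced k"
    using p q r by (auto simp: k_def reduced_append reduced_Cons winv_hd_last)
  have hdk: "hd k = linv (last p)"
    using r winv_hd_last(1)[of "a # p'"] by (auto simp: k_def hd_append)
  have g: "wval p \<in> carrier F"
    using p by simp
  have "p \<noteq> []"
    using r(1) by blast
  then have "p = butlast p @ [last p]"
    by simp
  then have 1: "cyl p = (\<lambda>g. wval p \<otimes> g) ` (carrier F - cyl [hd k])"
    using cyl_snoc_eq_translate_compl p hdk by metis
  have w: "winv (a # p') \<in> lists letters" "b # q' \<in> lists letters" "r \<in> lists letters" "a # p' \<in> lists letters"
    using p q r winv_letters[of "a # p'"] by auto
  have "cyl k = (\<lambda>g. wval (winv (a # p')) \<otimes> g) ` cyl (b # q')"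
    unfolding k_def using k by (intro cyl_translate[symmetric]) (auto simp: k_def)
  then have "(\<lambda>g. wval p \<otimes> g) ` cyl k = (\<lambda>g. (wval p \<otimes> wval (winv (a # p'))) \<otimes> g) ` cyl (b # q')"
    using left_translate_translate[OF g wval_closed[OF w(1)] cyl_carrier] by simp
  also have "wval p \<otimes> wval (winv (a # p')) = wval r"
    using w r(1) by (simp only: wval_winv wval_append m_assoc wval_closed inv_closed r_inv r_one)
  also have "(\<lambda>g. wval r \<otimes> g) ` cyl (b # q') = cyl q"
    unfolding r(2) using q r by (intro cyl_translate) auto
  finally have 2: "cyl q = (\<lambda>g. wval p \<otimes> g) ` cyl k" ..
  have "mass m (cyl p) (cyl q) = mass m (carrier F - cyl [hd k]) (cyl k)" if "m \<in> currents F X" for m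
    unfolding 1 2
    using cyl_subset_hd[OF k(1)]
    by (intro mass_translate[OF that g almost_invariant_co_cyl almost_invariant_cyl]) auto
  then show ?thesis
    using path_converges[OF k] \<nu> \<mu> by (simp add: converges_def)
qed

lemma clopen_converges:
  assumes S: "openin (bd_topology F X) S" "closedin (bd_topology F X) S"
    and S': "openin (bd_topology F X) S'" "closedin (bd_topology F X) S'"
    and disj: "S \<inter> S' = {}"
  shows "(\<lambda>n. measure (\<nu> n) (S \<times> S')) \<longlonglongrightarrow> measure \<mu> (S \<times> S')"
proof -
  obtain i where i: "\<forall>p. i \<le> length p \<longrightarrow> bdset (cyl p) \<subseteq> S \<or> bdset (cyl p) \<inter> S = {}"
    by (rule clopen_level[OF S])
  obtain j where j: "\<forall>p. j \<le> length p \<longrightarrow> bdset (cyl p) \<subseteq> S' \<or> bdset (cyl p) \<inter> S' = {}"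
    by (rule clopen_level[OF S'])
  define n where "n = max i j"
  define P where "P T = {p \<in> lists letters. length p = n \<and> reduced p \<and> bdset (cyl p) \<noteq> {} \<and> bdset (cyl p) \<subseteq> T}" for T
  have fin: "finite (P T)" for T
    using finite_words[of n] by (rule rev_finite_subset) (auto simp: P_def)
  have Un: "T = (\<Union>p\<in>P T. bdset (cyl p))"
    if level: "\<And>p. length p = n \<Longrightarrow> bdset (cyl p) \<subseteq> T \<or> bdset (cyl p) \<inter> T = {}" and sub: "T \<subseteq> bd" for T
  proof (intro equalityI subsetI)
    fix \<zeta> assume z: "\<zeta> \<in> T"
    then obtain p where p: "length p = n" "\<zeta> \<in> bdset (cyl p)"
      using bd_prefix sub by blast
    then have "p \<in> P T"
      using level[OF p(1)] z bdset_cyl_word[OF p(2)] by (auto simp: P_def)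
    then show "\<zeta> \<in> (\<Union>p\<in>P T. bdset (cyl p))"
      using p(2) by blast
  qed (auto simp: P_def)
  have bd: "S \<subseteq> bd" "S' \<subseteq> bd"
    using S S' closedin_subset by fastforce+
  have SP: "S = (\<Union>p\<in>P S. bdset (cyl p))"
    by (rule Un[OF _ bd(1)], rule i[rule_format]) (simp add: n_def)
  have SP': "S' = (\<Union>p\<in>P S'. bdset (cyl p))"
    by (rule Un[OF _ bd(2)], rule j[rule_format]) (simp add: n_def)
  have P: "p \<in> lists letters" "length p = n" "reduced p" if "p \<in> P T" for p T
    using that unfolding P_def by simp_all
  have neq: "p \<noteq> q" if "p \<in> P S" "q \<in> P S'" for p q
    using that disj by (auto simp: P_def)
  have sum: "measure m (S \<times> S') = (\<Sum>x\<in>P S \<times> P S'. mass m (cyl (fst x)) (cyl (snd x)))"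
    if m: "m \<in> currents F X" for m
  proof -
    have d: "cyl (fst x) \<inter> cyl (snd x) = {}" if "x \<in> P S \<times> P S'" for x
      by (rule cyl_disjoint) (use that neq[of "fst x" "snd x"] P(2) in \<open>auto simp: mem_Times_iff\<close>)
    have "S \<times> S' = (\<Union>p\<in>P S. bdset (cyl p)) \<times> (\<Union>p\<in>P S'. bdset (cyl p))"
      by (rule arg_cong2[OF SP SP'])
    also have "\<dots> = (\<Union>x\<in>P S \<times> P S'. lines (cyl (fst x)) (cyl (snd x)))"
      by (auto simp: lines_def)
    finally have "S \<times> S' = (\<Union>x\<in>P S \<times> P S'. lines (cyl (fst x)) (cyl (snd x)))" .
    moreover have "measure m (\<Union>x\<in>P S \<times> P S'. lines (cyl (fst x)) (cyl (snd x))) =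
        (\<Sum>x\<in>P S \<times> P S'. measure m (lines (cyl (fst x)) (cyl (snd x))))"
    proof (rule measure_finite_Union)
      show "finite (P S \<times> P S')"
        using fin by simp
      show "(\<lambda>x. lines (cyl (fst x)) (cyl (snd x))) ` (P S \<times> P S') \<subseteq> sets m"
        using lines_sets[OF current_sets(1)[OF m] almost_invariant_cyl almost_invariant_cyl d] by blast
      show "disjoint_family_on (\<lambda>x. lines (cyl (fst x)) (cyl (snd x))) (P S \<times> P S')"
        unfolding disjoint_family_on_def
      proof (intro ballI impI)
        fix x y assume x: "x \<in> P S \<times> P S'" and y: "y \<in> P S \<times> P S'" and "x \<noteq> y"
        then have "fst x \<noteq> fst y \<or> snd x \<noteq> snd y"
          by (simp add: prod_eq_iff)
        moreover have "length (fst x) = length (fst y)" "length (snd x) = length (snd y)"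
          using x y P(2)[of "fst x" S] P(2)[of "snd x" S'] P(2)[of "fst y" S] P(2)[of "snd y" S']
          by (simp_all add: mem_Times_iff)
        ultimately have "cyl (fst x) \<inter> cyl (fst y) = {} \<or> cyl (snd x) \<inter> cyl (snd y) = {}"
          using cyl_disjoint[of "fst x" "fst y"] cyl_disjoint[of "snd x" "snd y"] by blast
        then have "bdset (cyl (fst x)) \<inter> bdset (cyl (fst y)) = {} \<or> bdset (cyl (snd x)) \<inter> bdset (cyl (snd y)) = {}"
          using bdset_disjoint[OF almost_invariant_cyl almost_invariant_cyl] by (elim disjE) simp_all
        then show "lines (cyl (fst x)) (cyl (snd x)) \<inter> lines (cyl (fst y)) (cyl (snd y)) = {}"
          by (auto simp: lines_def Times_Int_Times)
      qed
      fix x assume "x \<in> P S \<times> P S'"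
      from current_lines_finite[OF m almost_invariant_cyl almost_invariant_cyl d[OF this]]
      show "emeasure m (lines (cyl (fst x)) (cyl (snd x))) \<noteq> \<infinity>"
        by simp
    qed
    ultimately show ?thesis
      by (simp add: mass_def)
  qed
  have "(\<lambda>n. \<Sum>x\<in>P S \<times> P S'. mass (\<nu> n) (cyl (fst x)) (cyl (snd x))) \<longlonglongrightarrow>
      (\<Sum>x\<in>P S \<times> P S'. mass \<mu> (cyl (fst x)) (cyl (snd x)))"
  proof (rule tendsto_sum)
    fix x assume x: "x \<in> P S \<times> P S'"
    then have "fst x \<in> P S" "snd x \<in> P S'"
      by (simp_all add: mem_Times_iff)
    then have "converges (cyl (fst x)) (cyl (snd x))"
      using neq P by (intro cylinder_pair_converges) simp_all
    then show "(\<lambda>n. mass (\<nu> n) (cyl (fst x)) (cyl (snd x))) \<longlonglongrightarrow> mass \<mu> (cyl (fst x)) (cyl (snd x))"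
      by (simp add: converges_def)
  qed
  then show ?thesis
    using sum \<nu> \<mu> by simp
qed

end

section \<open>Counting currents\<close>

text \<open>Monotone convergence along an enumeration, for the inner regularity of sums of point
  masses.\<close>

lemma nn_integral_count_space_exhaustion:
  fixes f :: "'a \<Rightarrow> ennreal"
  assumes "countable C"
  obtains S :: "nat \<Rightarrow> 'a set" where "\<forall>n. finite (S n) \<and> S n \<subseteq> C"
    "(\<integral>\<^sup>+x. f x \<partial>count_space C) = (SUP n. \<integral>\<^sup>+x. f x * indicator (S n) x \<partial>count_space C)"
proof (cases "C = {}")
  case True
  then show ?thesis
    by (intro that[of "\<lambda>_. {}"]) (simp_all add: nn_integral_count_space_finite)
next
  case False
  define S where "S n = from_nat_into C ` {..<n}" for n
  have sub: "S n \<subseteq> C" for n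
    using from_nat_into[OF False] by (auto simp: S_def)
  have inc: "incseq (\<lambda>n x. f x * indicator (S n) x)"
    by (intro incseq_SucI le_funI mult_left_mono) (auto simp: S_def lessThan_Suc split: split_indicator)
  have "(SUP n. f x * indicator (S n) x) = f x" if xC: "x \<in> C" for x
  proof (rule antisym)
    show "(SUP n. f x * indicator (S n) x) \<le> f x"
      by (auto intro!: SUP_least split: split_indicator)
    obtain i where "from_nat_into C i = x"
      using from_nat_into_surj[OF assms xC] by blast
    then have "x \<in> S (Suc i)"
      by (auto simp: S_def)
    then show "f x \<le> (SUP n. f x * indicator (S n) x)"
      by (intro SUP_upper2[of "Suc i"]) auto
  qed
  then have "(\<integral>\<^sup>+x. f x \<partial>count_space C) = (\<integral>\<^sup>+x. (SUP n. f x * indicator (S n) x) \<partial>count_space C)"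
    by (intro nn_integral_cong) simp
  also have "\<dots> = (SUP n. \<integral>\<^sup>+x. f x * indicator (S n) x \<partial>count_space C)"
    by (rule nn_integral_monotone_convergence_SUP[OF inc]) simp
  finally show ?thesis
    using sub by (intro that[of S]) (simp_all add: S_def)
qed

context finite_rank_free_group
begin

lemma countable_carrier: "countable (carrier F)"
proof (rule countableI')
  show "inj_on (to_nat_on (lists letters) \<circ> nf) (carrier F)"
  proof (rule comp_inj_on)
    show "inj_on nf (carrier F)"
      by (auto simp: inj_on_def nf_inject)
    have "countable (lists letters)"
      using finite_letters by (simp add: countable_finite countable_lists)
    then show "inj_on (to_nat_on (lists letters)) (nf ` carrier F)"
      by (rule inj_on_subset[OF inj_on_to_nat_on]) (use nf_lists in blast)
  qed
qed

lemma closedin_bd_singleton: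
  assumes "\<zeta> \<in> bd"
  shows "closedin (bd_topology F X) {\<zeta>}"
  unfolding closedin_def
proof
  show "openin (bd_topology F X) (topspace (bd_topology F X) - {\<zeta>})"
    unfolding openin_bd_topology_iff
  proof (intro conjI ballI)
    fix \<xi> assume "\<xi> \<in> topspace (bd_topology F X) - {\<zeta>}"
    then have "\<xi> \<in> bd" "\<zeta> \<noteq> \<xi>"
      by auto
    then obtain p q where pq: "length p = length q" "p \<noteq> q" "\<zeta> \<in> bdset (cyl p)" "\<xi> \<in> bdset (cyl q)"
      using bd_separate[OF assms] by blast
    then have "\<zeta> \<notin> bdset (cyl q)"
      using bdset_cyl_unique by blast
    then show "\<exists>p. \<xi> \<in> bdset (cyl p) \<and> bdset (cyl p) \<subseteq> topspace (bd_topology F X) - {\<zeta>}"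
      using pq(4) bdset_subset by (intro exI[of _ q]) auto
  qed simp
qed (use assms in simp)

lemma finite_borel:
  assumes "finite K" "K \<subseteq> topspace bd2"
  shows "K \<in> sets (borel_of bd2)"
proof (rule sets.countable)
  fix x assume x: "x \<in> K"
  obtain \<zeta> \<xi> where x': "x = (\<zeta>, \<xi>)"
    by (cases x)
  have "\<zeta> \<in> bd" "\<xi> \<in> bd"
    using x x' assms(2) by (auto simp: topspace_bd2)
  then have "closedin (prod_topology (bd_topology F X) (bd_topology F X)) ({\<zeta>} \<times> {\<xi>})"
    unfolding closedin_prod_Times_iff using closedin_bd_singleton by blast
  then have "closedin bd2 {x}"
    unfolding bd2_topology_def closedin_subtopology using x x' assms(2)
    by (intro exI[of _ "{\<zeta>} \<times> {\<xi>}"]) (auto simp: topspace_bd2)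
  then show "{x} \<in> sets (borel_of bd2)"
    by (rule closedin_borel_of)
qed (use assms(1) in \<open>simp add: countable_finite\<close>)

text \<open>The condition under which the pole pair is formed by two distinct boundary points. It is
  transported by automorphisms, which spares any discussion of translation lengths.\<close>

definition axial :: "'a \<Rightarrow> bool" where
  "axial g \<longleftrightarrow> g \<in> carrier F \<and> (\<lambda>n. g [^] (n::nat)) \<in> seqs \<and> (\<lambda>n. inv g [^] (n::nat)) \<in> seqs \<and>
     pole_pair F X g \<in> topspace bd2"

lemma
  assumes f: "mutually_inverse_homs f f'" and g: "axial g"
  shows axial_image: "axial (f g)" and pole_pair_image: "pole_pair F X (f g) = bd2_map f (pole_pair F X g)"
proof -
  note e = end_iso_automorphism[OF f]
  interpret f: group_hom F F f
    using mutually_inverse_homsD(1)[OF f] by (simp add: group_hom_def group_hom_axioms_def is_group)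
  have gc: "g \<in> carrier F"
    using g by (simp add: axial_def)
  have pow: "f \<circ> (\<lambda>n. g [^] (n::nat)) = (\<lambda>n. f g [^] n)" "f \<circ> (\<lambda>n. inv g [^] (n::nat)) = (\<lambda>n. inv (f g) [^] n)"
    using gc by (auto simp: fun_eq_iff f.hom_nat_pow)
  have g': "(\<lambda>n. g [^] (n::nat)) \<in> seqs" "(\<lambda>n. inv g [^] (n::nat)) \<in> seqs"
    using g by (simp_all add: axial_def)
  have s: "(\<lambda>n. f g [^] (n::nat)) \<in> seqs" "(\<lambda>n. inv (f g) [^] (n::nat)) \<in> seqs"
    using end_iso_seqs[OF e g'(1)] end_iso_seqs[OF e g'(2)] unfolding pow by blast+
  show pp: "pole_pair F X (f g) = bd2_map f (pole_pair F X g)"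
    using bd_map_limit[OF e g'(1)] bd_map_limit[OF e g'(2)] unfolding pow pole_pair_def by simp
  have "bd2_map f (pole_pair F X g) \<in> topspace bd2"
    using continuous_map_bd2_map[OF e] g by (auto simp: continuous_map_def axial_def)
  then show "axial (f g)"
    using s gc pp by (simp add: axial_def)
qed

lemma letter_powers_in_cyl: "l \<in> letters \<Longrightarrow> m \<le> n \<Longrightarrow> lval l [^] (n::nat) \<in> cyl (replicate m l)"
  using wval_in_cyl[of "replicate m l" "replicate (n - m) l"] wval_replicate[of l n]
  by (auto simp: replicate_add[symmetric] in_lists_conv_set)

lemma letter_powers_seq:
  assumes "l \<in> letters"
  shows "(\<lambda>n. lval l [^] (n::nat)) \<in> seqs"
  unfolding seqs_iff
proof (intro conjI allI)
  fix m
  have "\<forall>\<^sub>F n in sequentially. lval l [^] n \<in> cyl (replicate m l)"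
    using eventually_ge_at_top[of m] by eventually_elim (rule letter_powers_in_cyl[OF assms])
  then show "\<exists>p. length p = m \<and> (\<forall>\<^sub>F n in sequentially. lval l [^] n \<in> cyl p)"
    by (intro exI[of _ "replicate m l"]) simp
qed (use assms in auto)

lemma letter_powers_limit:
  assumes "l \<in> letters"
  shows "bd_limit F X (\<lambda>n. lval l [^] (n::nat)) \<in> bdset (cyl [y]) \<longleftrightarrow> y = l"
proof -
  have "\<forall>\<^sub>F n in sequentially. lval l [^] n \<in> cyl [l]"
    using eventually_ge_at_top[of 1] by eventually_elim (use letter_powers_in_cyl[OF assms, of 1] in simp)
  then have "bd_limit F X (\<lambda>n. lval l [^] (n::nat)) \<in> bdset (cyl [l])"
    using bd_limit_in_bdset_iff[OF letter_powers_seq[OF assms] almost_invariant_cyl] by simp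
  then show ?thesis
    using bdset_cyl_unique[of _ "[y]" "[l]"] by auto
qed

lemma basis_letter:
  "c \<in> X \<Longrightarrow> (c, b) \<in> letters" "lval (c, True) = c" "lval (c, False) = inv c"
  by (simp_all add: letter_val_def)

lemma basis_poles:
  assumes c: "c \<in> X"
  shows "fst (pole_pair F X c) \<in> bdset (cyl [y]) \<longleftrightarrow> y = (c, False)"
    "snd (pole_pair F X c) \<in> bdset (cyl [y]) \<longleftrightarrow> y = (c, True)"
  using letter_powers_limit[OF basis_letter(1)[OF c], of False y]
    letter_powers_limit[OF basis_letter(1)[OF c], of True y]
  by (simp_all add: pole_pair_def basis_letter(2,3))

lemma axial_basis:
  assumes c: "c \<in> X"
  shows "axial c"
proof -
  have s: "(\<lambda>n. c [^] (n::nat)) \<in> seqs" "(\<lambda>n. inv c [^] (n::nat)) \<in> seqs"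
    using letter_powers_seq[OF basis_letter(1)[OF c], of True] letter_powers_seq[OF basis_letter(1)[OF c], of False]
    by (simp_all add: basis_letter(2,3))
  have "fst (pole_pair F X c) \<noteq> snd (pole_pair F X c)"
    using basis_poles[OF c, of "(c, True)"] by auto
  then have "pole_pair F X c \<in> topspace bd2"
    using bd_limit_in_bd s by (simp add: topspace_bd2 pole_pair_def)
  then show ?thesis
    using s basis_carrier[OF c] by (simp add: axial_def)
qed

lemma conj_class_carrier: "g \<in> carrier F \<Longrightarrow> conj_class F g \<subseteq> carrier F"
  by (auto simp: conj_class_def)

lemma axial_conj_class:
  assumes "axial g" "h \<in> conj_class F g"
  shows "axial h"
  using assms axial_image[OF mutually_inverse_conjugation assms(1)] by (auto simp: conj_class_def)

lemma conj_class_conjugate: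
  assumes "g \<in> carrier F" "h \<in> carrier F"
  shows "conj_class F (h \<otimes> g \<otimes> inv h) = conj_class F g"
proof (intro equalityI subsetI)
  fix x assume "x \<in> conj_class F (h \<otimes> g \<otimes> inv h)"
  then obtain k where k: "k \<in> carrier F" "x = k \<otimes> (h \<otimes> g \<otimes> inv h) \<otimes> inv k"
    by (auto simp: conj_class_def)
  then have "x = (k \<otimes> h) \<otimes> g \<otimes> inv (k \<otimes> h)"
    using assms by (simp add: inv_mult_group m_assoc)
  then show "x \<in> conj_class F g"
    using k(1) assms by (auto simp: conj_class_def)
next
  fix x assume "x \<in> conj_class F g"
  then obtain k where k: "k \<in> carrier F" "x = k \<otimes> g \<otimes> inv k"
    by (auto simp: conj_class_def)
  then have "x = (k \<otimes> inv h) \<otimes> (h \<otimes> g \<otimes> inv h) \<otimes> inv (k \<otimes> inv h)"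
    using assms by (simp add: inv_mult_group m_assoc inv_solve_left' r_inv_ex l_inv_ex) (simp add: m_assoc[symmetric])
  then show "x \<in> conj_class F (h \<otimes> g \<otimes> inv h)"
    using k(1) assms unfolding conj_class_def by blast
qed

lemma conj_class_image:
  assumes f: "mutually_inverse_homs f f'" and g: "g \<in> carrier F"
  shows "bij_betw f (conj_class F g) (conj_class F (f g))"
  unfolding bij_betw_def
proof
  show "inj_on f (conj_class F g)"
    using mutually_inverse_homs_inj[OF f] conj_class_carrier[OF g] by (rule inj_on_subset)
  interpret f: group_hom F F f
    using mutually_inverse_homsD(1)[OF f] by (simp add: group_hom_def group_hom_axioms_def is_group)
  have conj: "f (k \<otimes> g \<otimes> inv k) = f k \<otimes> f g \<otimes> inv (f k)" if "k \<in> carrier F" for k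
    using that g by simp
  show "f ` conj_class F g = conj_class F (f g)"
  proof (intro equalityI subsetI)
    fix x assume "x \<in> f ` conj_class F g"
    then obtain k where "k \<in> carrier F" "x = f (k \<otimes> g \<otimes> inv k)"
      by (auto simp: conj_class_def)
    then show "x \<in> conj_class F (f g)"
      unfolding conj_class_def using conj f.hom_closed by blast
  next
    fix x assume "x \<in> conj_class F (f g)"
    then obtain k where k: "k \<in> carrier F" "x = k \<otimes> f g \<otimes> inv k"
      by (auto simp: conj_class_def)
    then have "x = f (f' k \<otimes> g \<otimes> inv (f' k))"
      using conj mutually_inverse_homsD(4,6)[OF f] by simp
    then show "x \<in> f ` conj_class F g"
      unfolding conj_class_def using mutually_inverse_homsD(4)[OF f k(1)] by blast
  qed
qed

abbreviation hits :: "'a \<Rightarrow> 'a bd_pair set \<Rightarrow> ennreal" where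
  "hits h A \<equiv> indicator A (pole_pair F X h) + indicator A (prod.swap (pole_pair F X h))"

lemma sets_counting_current [simp]: "sets (counting_current F X g) = sets (borel_of bd2)"
proof -
  have "sets (borel_of bd2) \<subseteq> Pow (topspace bd2)"
    using sets.space_closed[of "borel_of bd2"] by simp
  then show ?thesis
    using sets.sigma_sets_eq[of "borel_of bd2"]
    by (simp add: counting_current_def sets_measure_of)
qed

lemma space_counting_current [simp]: "space (counting_current F X g) = topspace bd2"
  using sets_eq_imp_space_eq[OF sets_counting_current[of g]] by simp

lemma emeasure_counting_current:
  assumes "A \<in> sets (borel_of bd2)"
  shows "emeasure (counting_current F X g) A = (\<integral>\<^sup>+h. hits h A \<partial>count_space (conj_class F g))"
  unfolding counting_current_def
proof (rule emeasure_measure_of_sigma[OF _ _ _ assms])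
  show "sigma_algebra (topspace bd2) (sets (borel_of bd2))"
    using sets.sigma_algebra_axioms[of "borel_of bd2"] by simp
  show "positive (sets (borel_of bd2)) (\<lambda>A. \<integral>\<^sup>+h. hits h A \<partial>count_space (conj_class F g))"
    by (simp add: positive_def)
  show "countably_additive (sets (borel_of bd2)) (\<lambda>A. \<integral>\<^sup>+h. hits h A \<partial>count_space (conj_class F g))"
    unfolding countably_additive_def
  proof (intro allI impI)
    fix A :: "nat \<Rightarrow> 'a bd_pair set" assume d: "disjoint_family A"
    have "(\<Sum>i. \<integral>\<^sup>+h. hits h (A i) \<partial>count_space (conj_class F g)) =
        (\<integral>\<^sup>+h. (\<Sum>i. hits h (A i)) \<partial>count_space (conj_class F g))"
      by (rule nn_integral_suminf[symmetric]) simp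
    also have "\<dots> = (\<integral>\<^sup>+h. hits h (\<Union>i. A i) \<partial>count_space (conj_class F g))"
      by (intro nn_integral_cong)
        (simp add: suminf_add[symmetric] suminf_indicator[OF d])
    finally show "(\<Sum>i. \<integral>\<^sup>+h. hits h (A i) \<partial>count_space (conj_class F g)) =
        (\<integral>\<^sup>+h. hits h (\<Union>i. A i) \<partial>count_space (conj_class F g))" .
  qed
qed

lemma counting_current_cong:
  "conj_class F g = conj_class F h \<Longrightarrow> counting_current F X g = counting_current F X h"
  by (simp add: counting_current_def)

lemma push_cong:
  assumes "\<And>\<zeta>. \<zeta> \<in> bd \<Longrightarrow> bd_map F X f \<zeta> = bd_map F X k \<zeta>" "sets \<nu> = sets (borel_of bd2)"
  shows "push F X f \<nu> = push F X k \<nu>"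
proof -
  have "space \<nu> = topspace bd2"
    using sets_eq_imp_space_eq[OF assms(2)] by simp
  then show ?thesis
    unfolding push_def using assms(1) by (intro distr_cong) (auto simp: topspace_bd2)
qed

text \<open>An automorphism maps the conjugacy class of \<open>g\<close> bijectively to that of its image, and
  pole pairs to pole pairs.\<close>

lemma push_counting_current:
  assumes f: "mutually_inverse_homs f f'" and g: "axial g"
  shows "push F X f (counting_current F X g) = counting_current F X (f g)"
proof (rule measure_eqI)
  show "sets (push F X f (counting_current F X g)) = sets (counting_current F X (f g))"
    by (simp add: push_def)
  fix A assume "A \<in> sets (push F X f (counting_current F X g))"
  then have A: "A \<in> sets (borel_of bd2)"
    by (simp add: push_def)
  note e = end_iso_automorphism[OF f]
  have gc: "g \<in> carrier F"
    using g by (simp add: axial_def)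
  have m: "bd2_map f \<in> measurable (counting_current F X g) (borel_of bd2)"
    by (rule measurable_borel_of[OF continuous_map_bd2_map[OF e] sets_counting_current])
  have V: "bd2_map f -` A \<inter> topspace bd2 \<in> sets (borel_of bd2)"
    using measurable_sets[OF m A] by simp
  have "emeasure (push F X f (counting_current F X g)) A =
      emeasure (counting_current F X g) (bd2_map f -` A \<inter> topspace bd2)"
    unfolding push_def using emeasure_distr[OF m A] by simp
  also have "\<dots> = (\<integral>\<^sup>+h. hits h (bd2_map f -` A \<inter> topspace bd2) \<partial>count_space (conj_class F g))"
    by (rule emeasure_counting_current[OF V])
  also have "\<dots> = (\<integral>\<^sup>+h. hits (f h) A \<partial>count_space (conj_class F g))"
  proof (intro nn_integral_cong)
    fix h assume "h \<in> space (count_space (conj_class F g))"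
    then have h: "axial h"
      using axial_conj_class[OF g] by simp
    then have "pole_pair F X h \<in> topspace bd2" "prod.swap (pole_pair F X h) \<in> topspace bd2"
      by (auto simp: axial_def topspace_bd2)
    moreover have "prod.swap (bd2_map f x) = bd2_map f (prod.swap x)" for x
      by (cases x) simp
    ultimately show "hits h (bd2_map f -` A \<inter> topspace bd2) = hits (f h) A"
      by (simp add: pole_pair_image[OF f h] indicator_def)
  qed
  also have "\<dots> = (\<integral>\<^sup>+h. hits h A \<partial>count_space (conj_class F (f g)))"
    by (rule nn_integral_bij_count_space[OF conj_class_image[OF f gc]])
  also have "\<dots> = emeasure (counting_current F X (f g)) A"
    by (rule emeasure_counting_current[OF A, symmetric])
  finally show "emeasure (push F X f (counting_current F X g)) A = emeasure (counting_current F X (f g)) A" .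
qed

text \<open>Translation by \<open>h\<close> and conjugation by \<open>h\<close> agree on the boundary, and conjugation
  permutes the conjugacy class.\<close>

lemma counting_current_translate:
  assumes g: "axial g" and h: "h \<in> carrier F"
  shows "push F X (\<lambda>x. h \<otimes> x) (counting_current F X g) = counting_current F X g"
proof -
  have "push F X (\<lambda>x. h \<otimes> x) (counting_current F X g) = push F X (\<lambda>x. h \<otimes> x \<otimes> inv h) (counting_current F X g)"
    by (rule push_cong) (simp_all add: bd_map_conjugation[OF h])
  also have "\<dots> = counting_current F X (h \<otimes> g \<otimes> inv h)"
    by (rule push_counting_current[OF mutually_inverse_conjugation[OF h] g])
  also have "\<dots> = counting_current F X g"
    using g h by (intro counting_current_cong conj_class_conjugate) (simp_all add: axial_def)
  finally show ?thesis .
qed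

lemma counting_current_flip:
  "distr (counting_current F X g) (borel_of bd2) prod.swap = counting_current F X g"
proof (rule measure_eqI)
  fix A assume "A \<in> sets (distr (counting_current F X g) (borel_of bd2) prod.swap)"
  then have A: "A \<in> sets (borel_of bd2)"
    by simp
  have m: "prod.swap \<in> measurable (counting_current F X g) (borel_of bd2)"
    by (rule measurable_borel_of[OF continuous_map_bd2_swap sets_counting_current])
  have V: "prod.swap -` A \<inter> topspace bd2 \<in> sets (borel_of bd2)"
    using measurable_sets[OF m A] by simp
  have sub: "A \<subseteq> topspace bd2"
    using sets.sets_into_space[OF A] by simp
  have "indicator (prod.swap -` A \<inter> topspace bd2) x = (indicator A (prod.swap x) :: ennreal)" for x
    using sub by (cases x) (auto simp: topspace_bd2 indicator_def)
  then have "hits h (prod.swap -` A \<inter> topspace bd2) = hits h A" for h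
    by (simp only: swap_swap add.commute)
  then show "emeasure (distr (counting_current F X g) (borel_of bd2) prod.swap) A = emeasure (counting_current F X g) A"
    using emeasure_distr[OF m A] emeasure_counting_current[OF V] emeasure_counting_current[OF A] by simp
qed simp

text \<open>Letters of the conjugator at its end that belong to \<open>c\<close> commute with \<open>c\<close> and can be
  dropped.\<close>

lemma conj_class_reduced_conjugator:
  assumes c: "c \<in> X" and "k \<in> carrier F"
  shows "\<exists>g\<in>carrier F. k \<otimes> c \<otimes> inv k = g \<otimes> c \<otimes> inv g \<and> (nf g = [] \<or> fst (last (nf g)) \<noteq> c)"
  using assms(2)
proof (induction "length (nf k)" arbitrary: k rule: less_induct)
  case less
  have cc: "c \<in> carrier F"
    using c basis_carrier by blast
  show ?case
  proof (cases "nf k = [] \<or> fst (last (nf k)) \<noteq> c")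
    case False
    define w l where "w = butlast (nf k)" and "l = last (nf k)"
    have wl: "nf k = w @ [l]"
      using False by (simp add: w_def l_def)
    have w: "w \<in> lists letters" "reduced w" "l \<in> letters"
      using nf_lists[OF less.prems] nf_reduced[OF less.prems] wl by (auto simp: reduced_append)
    have k: "k = wval w \<otimes> lval l"
      using wval_nf[OF less.prems] wl w wval_append[of w "[l]"] by simp
    have "lval l = c \<or> lval l = inv c"
      using False unfolding l_def by (auto simp: letter_val_def)
    then have "lval l \<otimes> c \<otimes> inv (lval l) = c"
      using cc by (auto simp: m_assoc)
    then have "k \<otimes> c \<otimes> inv k = wval w \<otimes> c \<otimes> inv (wval w)"
      using k w cc by (metis (no_types, lifting) inv_closed inv_mult_group lval_closed m_assoc m_closed wval_closed)
    moreover have "length (nf (wval w)) < length (nf k)"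
      using w wl by simp
    ultimately show ?thesis
      using less.hyps[of "wval w"] w by simp
  qed (use less.prems in blast)
qed

text \<open>A conjugate of \<open>c\<close> other than \<open>c\<close> itself has its axis away from the identity, so both
  of its poles lie behind the same letter.\<close>

lemma conjugate_poles:
  assumes c: "c \<in> X" and h: "h \<in> conj_class F c" "h \<noteq> c"
  shows "fst (pole_pair F X h) \<in> bdset (cyl [y]) \<longleftrightarrow> snd (pole_pair F X h) \<in> bdset (cyl [y])"
proof -
  obtain g where g: "g \<in> carrier F" "h = g \<otimes> c \<otimes> inv g" "nf g = [] \<or> fst (last (nf g)) \<noteq> c"
    using h(1) conj_class_reduced_conjugator[OF c] by (auto simp: conj_class_def)
  have cc: "c \<in> carrier F"
    using c basis_carrier by blast
  have "nf g \<noteq> []"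
  proof
    assume "nf g = []"
    then have "g = \<one>"
      using nf_eq_Nil g(1) by blast
    then show False
      using g(2) h(2) cc by simp
  qed
  have in_cyl: "bd_map F X (\<lambda>x. g \<otimes> x) (bd_limit F X (\<lambda>n. lval l [^] (n::nat))) \<in> bdset (cyl [hd (nf g)])"
    if l: "l \<in> letters" "fst l = c" for l
  proof -
    have red: "reduced (nf g @ [l])"
      using g(1,3) \<open>nf g \<noteq> []\<close> l(2) by (auto simp: reduced_append)
    have "g \<otimes> lval l [^] n \<in> cyl [hd (nf g)]" if "n \<ge> 1" for n :: nat
    proof -
      have "lval l [^] n \<in> cyl [l]"
        using letter_powers_in_cyl[OF l(1), of 1 n] that by simp
      then have "wval (nf g) \<otimes> lval l [^] n \<in> cyl (nf g @ [l])"
        using cyl_translate[of "nf g" "[l]"] red g(1) l(1) nf_lists[OF g(1)] by auto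
      then show ?thesis
        using g(1) cyl_subset_hd[of "nf g @ [l]"] \<open>nf g \<noteq> []\<close> by auto
    qed
    then have "\<forall>\<^sub>F n in sequentially. ((\<lambda>x. g \<otimes> x) \<circ> (\<lambda>n. lval l [^] (n::nat))) n \<in> cyl [hd (nf g)]"
      unfolding eventually_sequentially by auto
    then show ?thesis
      using bd_map_limit[OF end_iso_translation[OF g(1)] letter_powers_seq[OF l(1)]]
        bd_limit_in_bdset_iff[OF end_iso_seqs[OF end_iso_translation[OF g(1)] letter_powers_seq[OF l(1)]] almost_invariant_cyl]
      by simp
  qed
  have "pole_pair F X h = bd2_map (\<lambda>x. g \<otimes> x \<otimes> inv g) (pole_pair F X c)"
    using pole_pair_image[OF mutually_inverse_conjugation[OF g(1)] axial_basis[OF c]] g(2) by simp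
  moreover have "fst (pole_pair F X c) \<in> bd" "snd (pole_pair F X c) \<in> bd"
    using axial_basis[OF c] by (auto simp: axial_def topspace_bd2)
  ultimately have "pole_pair F X h = bd2_map (\<lambda>x. g \<otimes> x) (pole_pair F X c)"
    using bd_map_conjugation[OF g(1)] by (simp add: prod_eq_iff)
  then have "fst (pole_pair F X h) \<in> bdset (cyl [hd (nf g)])" "snd (pole_pair F X h) \<in> bdset (cyl [hd (nf g)])"
    using in_cyl[OF basis_letter(1)[OF c], of False] in_cyl[OF basis_letter(1)[OF c], of True]
    by (simp_all add: pole_pair_def basis_letter(2,3))
  then show ?thesis
    using bdset_cyl_unique[of _ "[hd (nf g)]" "[y]"] by auto
qed

lemma edge_lines_borel: "lines (cyl [y]) (carrier F - cyl [y]) \<in> sets (borel_of bd2)"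
  by (rule lines_sets[OF refl almost_invariant_cyl almost_invariant_co_cyl]) blast

lemma counting_current_edge:
  assumes c: "c \<in> X"
  shows "emeasure (counting_current F X c) (lines (cyl [y]) (carrier F - cyl [y])) = (if fst y = c then 1 else 0)"
proof -
  let ?E = "lines (cyl [y]) (carrier F - cyl [y])"
  have cc: "c \<in> carrier F"
    using c basis_carrier by blast
  have "c \<in> conj_class F c"
    unfolding conj_class_def using cc by (auto intro!: exI[of _ \<one>])
  have in_bd: "fst (pole_pair F X h) \<in> bd" "snd (pole_pair F X h) \<in> bd" if "h \<in> conj_class F c" for h
    using axial_conj_class[OF axial_basis[OF c] that] by (auto simp: axial_def topspace_bd2)
  have E: "x \<in> ?E \<longleftrightarrow> fst x \<in> bdset (cyl [y]) \<and> snd x \<in> bd - bdset (cyl [y])" for x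
    using bdset_compl[OF almost_invariant_cyl] by (cases x) (simp add: lines_def)
  have other: "hits h ?E = 0" if "h \<in> conj_class F c" "h \<noteq> c" for h
    using conjugate_poles[OF c that] by (simp add: indicator_def E)
  have "pole_pair F X c \<in> ?E \<longleftrightarrow> y = (c, False)" "prod.swap (pole_pair F X c) \<in> ?E \<longleftrightarrow> y = (c, True)"
    using in_bd[OF \<open>c \<in> conj_class F c\<close>] unfolding E by (auto simp: basis_poles[OF c])
  then have "hits c ?E = (if y = (c, False) then 1 else 0) + (if y = (c, True) then 1 else 0)"
    by (simp only: indicator_def of_bool_def)
  then have self: "hits c ?E = (if fst y = c then 1 else 0)"
    by (cases y) auto
  have "emeasure (counting_current F X c) ?E = (\<integral>\<^sup>+h. hits h ?E \<partial>count_space (conj_class F c))"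
    by (rule emeasure_counting_current[OF edge_lines_borel])
  also have "\<dots> = (\<Sum>h\<in>{c}. hits h ?E)"
    using other \<open>c \<in> conj_class F c\<close> by (intro nn_integral_count_space') auto
  finally show ?thesis
    using self by simp
qed

definition edge_lines :: "'a \<Rightarrow> 'a \<times> bool \<Rightarrow> 'a bd_pair set" where
  "edge_lines g y = lines ((\<lambda>x. g \<otimes> x) ` cyl [y]) (carrier F - (\<lambda>x. g \<otimes> x) ` cyl [y])"

text \<open>The two ends of a line have different normal forms; where these first differ, the line
  passes an edge.\<close>

lemma line_crosses_edge:
  assumes "x \<in> topspace bd2"
  obtains g y where "g \<in> carrier F" "y \<in> letters" "x \<in> edge_lines g y"
proof -
  obtain \<zeta> \<xi> where x: "x = (\<zeta>, \<xi>)" "\<zeta> \<in> bd" "\<xi> \<in> bd" "\<zeta> \<noteq> \<xi>"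
    using assms by (auto simp: topspace_bd2)
  obtain p q where pq: "length p = length q" "p \<noteq> q" "\<zeta> \<in> bdset (cyl p)" "\<xi> \<in> bdset (cyl q)"
    using bd_separate[OF x(2-4)] by blast
  obtain r a p' b q' where r: "p = r @ a # p'" "q = r @ b # q'" "a \<noteq> b"
    using split_at_first_difference[OF pq(1,2)] .
  have "cyl p \<subseteq> cyl (r @ [a])" "cyl q \<subseteq> cyl (r @ [b])"
    using cyl_append_subset[of "r @ [a]" p'] cyl_append_subset[of "r @ [b]" q'] r by simp_all
  then have z: "\<zeta> \<in> bdset (cyl (r @ [a]))" and "\<xi> \<in> bdset (cyl (r @ [b]))"
    using pq(3,4) bdset_mono by blast+
  then have "\<xi> \<notin> bdset (cyl (r @ [a]))"
    using bdset_cyl_unique[of \<xi> "r @ [a]" "r @ [b]"] r(3) by auto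
  then have "x \<in> lines (cyl (r @ [a])) (carrier F - cyl (r @ [a]))"
    using x z bdset_compl[OF almost_invariant_cyl] by (simp add: lines_def)
  moreover have w: "r @ [a] \<in> lists letters" "reduced (r @ [a])"
    using bdset_cyl_word[OF z] by simp_all
  ultimately have "x \<in> edge_lines (wval r) a"
    using cyl_translate[OF w] by (simp add: edge_lines_def)
  moreover have "wval r \<in> carrier F" "a \<in> letters"
    using w(1) by simp_all
  ultimately show ?thesis
    using that by blast
qed

lemma translate_cyl_almost_invariant:
  "g \<in> carrier F \<Longrightarrow> almost_invariant ((\<lambda>x. g \<otimes> x) ` cyl p)"
  by (rule almost_invariant_image[OF end_iso_translation almost_invariant_cyl])

lemma openin_edge_lines: "g \<in> carrier F \<Longrightarrow> openin bd2 (edge_lines g y)"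
  unfolding edge_lines_def
  by (rule openin_lines[OF translate_cyl_almost_invariant almost_invariant_compl[OF translate_cyl_almost_invariant]]) auto

lemma emeasure_edge_lines:
  assumes g: "g \<in> carrier F" and s: "sets \<nu> = sets (borel_of bd2)"
    and inv: "push F X (\<lambda>x. inv g \<otimes> x) \<nu> = \<nu>"
  shows "emeasure \<nu> (edge_lines g y) = emeasure \<nu> (lines (cyl [y]) (carrier F - cyl [y]))"
proof -
  note t = end_iso_translation[OF g]
  have "emeasure \<nu> (lines (cyl [y]) (carrier F - cyl [y])) =
      emeasure (push F X (\<lambda>x. inv g \<otimes> x) \<nu>) (lines (cyl [y]) (carrier F - cyl [y]))"
    by (simp add: inv)
  also have "\<dots> = emeasure \<nu> (lines {x \<in> carrier F. inv g \<otimes> x \<in> cyl [y]} {x \<in> carrier F. inv g \<otimes> x \<in> carrier F - cyl [y]})"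
    by (rule push_lines[OF s end_iso_sym[OF t] almost_invariant_cyl almost_invariant_co_cyl]) blast
  also have "{x \<in> carrier F. inv g \<otimes> x \<in> cyl [y]} = (\<lambda>x. g \<otimes> x) ` cyl [y]"
    by (rule end_iso_image_eq[OF t cyl_carrier, symmetric])
  also have "{x \<in> carrier F. inv g \<otimes> x \<in> carrier F - cyl [y]} = carrier F - (\<lambda>x. g \<otimes> x) ` cyl [y]"
    using end_iso_image_eq[OF t cyl_carrier, of "[y]"] g by auto
  finally show ?thesis
    by (simp add: edge_lines_def)
qed

text \<open>A compact set is covered by finitely many edges, each of which is crossed by at most one
  line of the class of \<open>c\<close>. Inner regularity holds because finite sets of lines are
  compact.\<close>

lemma radon_counting_current:
  assumes c: "c \<in> X"
  shows "radon_measure bd2 (counting_current F X c)"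
  unfolding radon_measure_def
proof (intro conjI allI impI ballI)
  let ?M = "counting_current F X c"
  have edge: "emeasure ?M (edge_lines g y) \<le> 1" if "g \<in> carrier F" for g y
    using emeasure_edge_lines[OF that sets_counting_current counting_current_translate[OF axial_basis[OF c]]]
      counting_current_edge[OF c, of y] that by simp
  fix K assume K: "compactin bd2 K"
  let ?C = "(\<lambda>(g, y). edge_lines g y) ` (carrier F \<times> letters)"
  have "K \<subseteq> \<Union> ?C"
  proof
    fix x assume "x \<in> K"
    then obtain g y where "g \<in> carrier F" "y \<in> letters" "x \<in> edge_lines g y"
      using compactin_subset_topspace[OF K] line_crosses_edge by blast
    then show "x \<in> \<Union> ?C"
      by (intro UnionI[of "edge_lines g y"] image_eqI[of _ _ "(g, y)"]) simp_all
  qed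
  moreover have C_open: "openin bd2 U" if "U \<in> ?C" for U
    using that openin_edge_lines by auto
  ultimately obtain \<F> where F: "finite \<F>" "\<F> \<subseteq> ?C" "K \<subseteq> \<Union> \<F>"
    using compactinD[OF K, of ?C] by blast
  have F_sets: "\<F> \<subseteq> sets ?M"
    unfolding sets_counting_current using F(2) openin_borel_of[OF C_open] by blast
  have "emeasure ?M K \<le> emeasure ?M (\<Union> \<F>)"
    using F F_sets by (intro emeasure_mono) auto
  also have "\<dots> \<le> (\<Sum>E\<in>\<F>. emeasure ?M E)"
    using emeasure_subadditive_finite[of \<F> "\<lambda>E. E" ?M] F(1) F_sets by simp
  also have "\<dots> \<le> (\<Sum>E\<in>\<F>. 1)"
    using F(2) edge by (intro sum_mono) auto
  also have "\<dots> < \<infinity>"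
    using F(1) by (simp add: of_nat_less_top)
  finally show "emeasure ?M K < \<infinity>" .
next
  let ?M = "counting_current F X c"
  fix A assume "A \<in> sets ?M"
  then have A: "A \<in> sets (borel_of bd2)"
    by simp
  have cc: "c \<in> carrier F"
    using c basis_carrier by blast
  have cnt: "countable (conj_class F c)"
    using countable_subset[OF conj_class_carrier[OF cc] countable_carrier] .
  show "emeasure ?M A = (SUP K\<in>{K. compactin bd2 K \<and> K \<subseteq> A}. emeasure ?M K)"
  proof (rule antisym)
    obtain S :: "nat \<Rightarrow> 'a set" where S: "\<forall>n. finite (S n) \<and> S n \<subseteq> conj_class F c"
      and sup: "(\<integral>\<^sup>+h. hits h A \<partial>count_space (conj_class F c)) =
        (SUP n. \<integral>\<^sup>+h. hits h A * indicator (S n) h \<partial>count_space (conj_class F c))"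
      by (rule nn_integral_count_space_exhaustion[of _ "\<lambda>h. hits h A", OF cnt])
    show "emeasure ?M A \<le> (SUP K\<in>{K. compactin bd2 K \<and> K \<subseteq> A}. emeasure ?M K)"
      unfolding emeasure_counting_current[OF A] sup
    proof (rule SUP_least)
      fix n
      define K where "K = (pole_pair F X ` S n \<union> (prod.swap \<circ> pole_pair F X) ` S n) \<inter> A"
      have fin: "finite K" and KA: "K \<subseteq> A"
        using S by (simp_all add: K_def)
      have K_top: "K \<subseteq> topspace bd2"
        using KA sets.sets_into_space[OF A] by simp
      have "(\<integral>\<^sup>+h. hits h A * indicator (S n) h \<partial>count_space (conj_class F c)) \<le>
          (\<integral>\<^sup>+h. hits h K \<partial>count_space (conj_class F c))"
        by (intro nn_integral_mono) (auto simp: K_def indicator_def)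
      also have "\<dots> = emeasure ?M K"
        by (rule emeasure_counting_current[OF finite_borel[OF fin K_top], symmetric])
      also have "\<dots> \<le> (SUP K\<in>{K. compactin bd2 K \<and> K \<subseteq> A}. emeasure ?M K)"
        using finite_imp_compactin[OF K_top fin] KA by (intro SUP_upper) simp
      finally show "(\<integral>\<^sup>+h. hits h A * indicator (S n) h \<partial>count_space (conj_class F c)) \<le>
          (SUP K\<in>{K. compactin bd2 K \<and> K \<subseteq> A}. emeasure ?M K)" .
    qed
    show "(SUP K\<in>{K. compactin bd2 K \<and> K \<subseteq> A}. emeasure ?M K) \<le> emeasure ?M A"
      using A by (auto intro!: SUP_least emeasure_mono)
  qed
qed simp

lemma counting_current_basis_current:
  assumes c: "c \<in> X"
  shows "counting_current F X c \<in> currents F X"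
  using radon_counting_current[OF c] counting_current_translate[OF axial_basis[OF c]] counting_current_flip
  by (simp add: currents_def)

end

section \<open>The action on projectivized currents\<close>

context finite_rank_free_group
begin

abbreviation curr_top :: "'a bd_pair measure topology" where
  "curr_top \<equiv> subtopology (currents_topology F X) (nonzero_currents F X)"

lemma nonzero_current: "\<nu> \<in> nonzero_currents F X \<Longrightarrow> \<nu> \<in> currents F X"
  by (simp add: nonzero_currents_def)

lemma push_compose:
  assumes "end_iso f f'" "end_iso k k'" "sets \<nu> = sets (borel_of bd2)"
  shows "push F X k (push F X f \<nu>) = push F X (\<lambda>g. k (f g)) \<nu>"
proof -
  have "space \<nu> = topspace bd2"
    using sets_eq_imp_space_eq[OF assms(3)] by simp
  have "push F X k (push F X f \<nu>) = distr \<nu> (borel_of bd2) (bd2_map k \<circ> bd2_map f)"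
    unfolding push_def
    by (intro distr_distr measurable_borel_of[OF continuous_map_bd2_map[OF assms(1)]]
        measurable_borel_of[OF continuous_map_bd2_map[OF assms(2)]] assms(3) refl)
  also have "\<dots> = push F X (\<lambda>g. k (f g)) \<nu>"
    unfolding push_def
    by (intro distr_cong) (auto simp: \<open>space \<nu> = topspace bd2\<close> topspace_bd2 bd_map_compose[OF assms(1,2)])
  finally show ?thesis .
qed

lemma push_cong_carrier:
  assumes "\<And>g. g \<in> carrier F \<Longrightarrow> f g = k g" "sets \<nu> = sets (borel_of bd2)"
  shows "push F X f \<nu> = push F X k \<nu>"
  by (rule push_cong[OF bd_map_cong assms(2)]) (use assms(1) in auto)

lemma sets_push [simp]: "sets (push F X f \<nu>) = sets (borel_of bd2)"
  by (simp add: push_def)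

lemma push_conjugate:
  assumes f: "mutually_inverse_homs f f'" and \<nu>: "push F X f \<nu> \<in> currents F X" "sets \<nu> = sets (borel_of bd2)"
    and h: "h \<in> carrier F" and k: "\<And>g. g \<in> carrier F \<Longrightarrow> k g = h \<otimes> f g \<otimes> inv h"
  shows "push F X k \<nu> = push F X f \<nu>"
proof -
  have "push F X k \<nu> = push F X (\<lambda>g. h \<otimes> f g \<otimes> inv h) \<nu>"
    by (rule push_cong_carrier[OF k \<nu>(2)])
  also have "\<dots> = push F X (\<lambda>x. h \<otimes> x \<otimes> inv h) (push F X f \<nu>)"
    by (rule push_compose[OF end_iso_automorphism[OF f]
          end_iso_automorphism[OF mutually_inverse_conjugation[OF h]] \<nu>(2), symmetric])
  also have "\<dots> = push F X (\<lambda>x. h \<otimes> x) (push F X f \<nu>)"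
    by (rule push_cong) (simp_all add: bd_map_conjugation[OF h])
  also have "\<dots> = push F X f \<nu>"
    using \<nu>(1) h by (simp add: currents_def)
  finally show ?thesis .
qed

text \<open>Pushing by an automorphism \<open>f\<close> intertwines the translation by \<open>f h\<close> with the translation
  by \<open>h\<close>.\<close>

lemma push_current:
  assumes f: "mutually_inverse_homs f f'" and \<nu>: "\<nu> \<in> currents F X"
  shows "push F X f \<nu> \<in> currents F X"
proof -
  note e = end_iso_automorphism[OF f]
  note D = mutually_inverse_homsD[OF f]
  note s = current_sets(1)[OF \<nu>] and sp = current_sets(2)[OF \<nu>]
  have r: "radon_measure bd2 (push F X f \<nu>)"
    unfolding push_def
    by (rule radon_measure_homeomorphic_image[OF _ continuous_map_bd2_map[OF e] continuous_map_bd2_map[OF end_iso_sym[OF e]]])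
      (use \<nu> bd2_map_inverse[OF e] bd2_map_inverse[OF end_iso_sym[OF e]] in \<open>auto simp: currents_def\<close>)
  have t: "push F X (\<lambda>x. h \<otimes> x) (push F X f \<nu>) = push F X f \<nu>" if h: "h \<in> carrier F" for h
  proof -
    note h' = D(4)[OF h]
    have "push F X (\<lambda>x. h \<otimes> x) (push F X f \<nu>) = push F X (\<lambda>x. h \<otimes> f x) \<nu>"
      by (rule push_compose[OF e end_iso_translation[OF h] s])
    also have "\<dots> = push F X (\<lambda>x. f (f' h \<otimes> x)) \<nu>"
      by (rule push_cong_carrier[OF _ s]) (use D(6,7) h h' in simp)
    also have "\<dots> = push F X f (push F X (\<lambda>x. f' h \<otimes> x) \<nu>)"
      by (rule push_compose[OF end_iso_translation[OF h'] e s, symmetric])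
    also have "push F X (\<lambda>x. f' h \<otimes> x) \<nu> = \<nu>"
      using \<nu> h' by (simp add: currents_def)
    finally show ?thesis .
  qed
  have m: "bd2_map f \<in> measurable \<nu> (borel_of bd2)" "bd2_map f \<in> measurable (borel_of bd2) (borel_of bd2)"
    "prod.swap \<in> measurable \<nu> (borel_of bd2)" "prod.swap \<in> measurable (borel_of bd2) (borel_of bd2)"
    using s by (auto intro!: measurable_borel_of continuous_map_bd2_map[OF e] continuous_map_bd2_swap)
  have "distr (push F X f \<nu>) (borel_of bd2) prod.swap = distr \<nu> (borel_of bd2) (prod.swap \<circ> bd2_map f)"
    unfolding push_def by (rule distr_distr[OF m(4,1)])
  also have "prod.swap \<circ> bd2_map f = bd2_map f \<circ> prod.swap"
    by (auto simp: fun_eq_iff)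
  also have "distr \<nu> (borel_of bd2) (bd2_map f \<circ> prod.swap) = push F X f (distr \<nu> (borel_of bd2) prod.swap)"
    unfolding push_def by (rule distr_distr[OF m(2,3), symmetric])
  also have "distr \<nu> (borel_of bd2) prod.swap = \<nu>"
    using \<nu> by (simp add: currents_def)
  finally show ?thesis
    using r t by (simp add: currents_def)
qed

lemma push_nonzero:
  assumes f: "mutually_inverse_homs f f'" and \<nu>: "\<nu> \<in> nonzero_currents F X"
  shows "push F X f \<nu> \<in> nonzero_currents F X"
proof -
  note c = nonzero_current[OF \<nu>]
  have m: "bd2_map f \<in> measurable \<nu> (borel_of bd2)"
    by (rule measurable_borel_of[OF continuous_map_bd2_map[OF end_iso_automorphism[OF f]] current_sets(1)[OF c]])
  have "emeasure (push F X f \<nu>) (topspace bd2) = emeasure \<nu> (bd2_map f -` topspace bd2 \<inter> space \<nu>)"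
    unfolding push_def using sets.top[of "borel_of bd2"] by (intro emeasure_distr[OF m]) simp
  also have "bd2_map f -` topspace bd2 \<inter> space \<nu> = space \<nu>"
    using measurable_space[OF m] by auto
  finally show ?thesis
    using \<nu> push_current[OF f c] by (simp add: nonzero_currents_def push_def)
qed

lemma push_scale:
  assumes "end_iso f f'" "sets \<nu> = sets (borel_of bd2)"
  shows "push F X f (scale_measure r \<nu>) = scale_measure r (push F X f \<nu>)"
proof (rule measure_eqI)
  fix A assume "A \<in> sets (push F X f (scale_measure r \<nu>))"
  then have A: "A \<in> sets (borel_of bd2)"
    by simp
  have m: "bd2_map f \<in> measurable \<nu> (borel_of bd2)" "bd2_map f \<in> measurable (scale_measure r \<nu>) (borel_of bd2)"
    by (auto intro!: measurable_borel_of[OF continuous_map_bd2_map[OF assms(1)]] simp: assms(2))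
  show "emeasure (push F X f (scale_measure r \<nu>)) A = emeasure (scale_measure r (push F X f \<nu>)) A"
    unfolding push_def using emeasure_distr[OF m(1) A] emeasure_distr[OF m(2) A]
    by (simp add: space_scale_measure)
qed simp

lemma scale_current:
  assumes \<nu>: "\<nu> \<in> currents F X"
  shows "scale_measure (ennreal r) \<nu> \<in> currents F X"
proof -
  note s = current_sets(1)[OF \<nu>]
  have "radon_measure bd2 (scale_measure (ennreal r) \<nu>)"
    using \<nu> by (intro radon_measure_scale) (simp add: currents_def)
  moreover have "push F X (\<lambda>x. h \<otimes> x) (scale_measure (ennreal r) \<nu>) = scale_measure (ennreal r) \<nu>"
    if h: "h \<in> carrier F" for h
    using push_scale[OF end_iso_translation[OF h] s] \<nu> h by (simp add: currents_def)
  moreover have "distr (scale_measure (ennreal r) \<nu>) (borel_of bd2) prod.swap = scale_measure (ennreal r) \<nu>"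
  proof (rule measure_eqI)
    fix A assume "A \<in> sets (distr (scale_measure (ennreal r) \<nu>) (borel_of bd2) prod.swap)"
    then have A: "A \<in> sets (borel_of bd2)"
      by simp
    have m: "prod.swap \<in> measurable \<nu> (borel_of bd2)" "prod.swap \<in> measurable (scale_measure (ennreal r) \<nu>) (borel_of bd2)"
      by (auto intro!: measurable_borel_of[OF continuous_map_bd2_swap] simp: s)
    have "emeasure \<nu> A = emeasure (distr \<nu> (borel_of bd2) prod.swap) A"
      using \<nu> by (simp add: currents_def)
    then show "emeasure (distr (scale_measure (ennreal r) \<nu>) (borel_of bd2) prod.swap) A = emeasure (scale_measure (ennreal r) \<nu>) A"
      using emeasure_distr[OF m(1) A] emeasure_distr[OF m(2) A] by (simp add: space_scale_measure)
  qed (simp add: s)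
  ultimately show ?thesis
    by (simp add: currents_def)
qed

lemma scale_nonzero:
  assumes "\<nu> \<in> nonzero_currents F X" "r > 0"
  shows "scale_measure (ennreal r) \<nu> \<in> nonzero_currents F X"
  using assms scale_current[OF nonzero_current[OF assms(1)]]
  by (simp add: nonzero_currents_def space_scale_measure)

lemma mass_scale: "r \<ge> 0 \<Longrightarrow> mass (scale_measure (ennreal r) \<nu>) A C = r * mass \<nu> A C"
  by (simp add: mass_def)

lemma equiv_proj_rel: "equiv (nonzero_currents F X) (proj_rel F X)"
proof (intro equivI refl_onI symI transI)
  show "proj_rel F X \<subseteq> nonzero_currents F X \<times> nonzero_currents F X"
    by (auto simp: proj_rel_def)
  show "(\<nu>, \<nu>) \<in> proj_rel F X" if "\<nu> \<in> nonzero_currents F X" for \<nu>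
    using that by (auto simp: proj_rel_def intro!: exI[of _ 1])
  show "(\<nu>, \<mu>) \<in> proj_rel F X" if "(\<mu>, \<nu>) \<in> proj_rel F X" for \<mu> \<nu>
  proof -
    obtain r where r: "r > 0" "\<nu> = scale_measure (ennreal r) \<mu>"
      using \<open>(\<mu>, \<nu>) \<in> proj_rel F X\<close> by (auto simp: proj_rel_def)
    then have "\<mu> = scale_measure (ennreal (1 / r)) \<nu>"
      by (simp add: ennreal_mult[symmetric])
    then show ?thesis
      using that r(1) unfolding proj_rel_def by (auto intro!: exI[of _ "1 / r"])
  qed
  fix \<mu> \<nu> \<rho> assume 1: "(\<mu>, \<nu>) \<in> proj_rel F X" and 2: "(\<nu>, \<rho>) \<in> proj_rel F X"
  obtain r where r: "r > 0" "\<nu> = scale_measure (ennreal r) \<mu>"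
    using 1 by (auto simp: proj_rel_def)
  obtain q where q: "q > 0" "\<rho> = scale_measure (ennreal q) \<nu>"
    using 2 by (auto simp: proj_rel_def)
  have "q * r > 0" "\<rho> = scale_measure (ennreal (q * r)) \<mu>"
    using r q by (simp_all add: ennreal_mult)
  then have "\<exists>a>0. \<rho> = scale_measure (ennreal a) \<mu>"
    by blast
  then show "(\<mu>, \<rho>) \<in> proj_rel F X"
    using 1 2 by (simp add: proj_rel_def)
qed

lemma proj_class_scale:
  assumes "\<nu> \<in> nonzero_currents F X" "r > 0"
  shows "proj_class F X (scale_measure (ennreal r) \<nu>) = proj_class F X \<nu>"
proof -
  have "(\<nu>, scale_measure (ennreal r) \<nu>) \<in> proj_rel F X"
    using assms scale_nonzero[OF assms] by (auto simp: proj_rel_def)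
  from equiv_class_eq[OF equiv_proj_rel this] show ?thesis
    by (simp add: proj_class_def)
qed

text \<open>An outer automorphism, as a coset of inner automorphisms, acts through any automorphism
  that represents it.\<close>

definition represents :: "('a \<Rightarrow> 'a) set \<Rightarrow> ('a \<Rightarrow> 'a) \<Rightarrow> bool" where
  "represents \<Phi> f \<longleftrightarrow> \<Phi> \<noteq> {} \<and>
     (\<forall>k\<in>\<Phi>. \<exists>h\<in>carrier F. \<forall>g\<in>carrier F. k g = h \<otimes> f g \<otimes> inv h)"

lemma Inn_coset_represents:
  assumes f: "f \<in> auto F"
  shows "represents (Inn F #>\<^bsub>AutoGroup F\<^esub> f) f"
proof -
  have fB: "f \<in> Bij (carrier F)"
    using f by (simp add: auto_def)
  have fc: "f g \<in> carrier F" if "g \<in> carrier F" for g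
    using Bij_imp_funcset[OF fB] that by blast
  have inner: "(\<lambda>x\<in>carrier F. h \<otimes> x \<otimes> inv h) \<in> Bij (carrier F)" if h: "h \<in> carrier F" for h
    unfolding Bij_def
  proof (intro IntI CollectI bij_betwI[where g = "\<lambda>x. inv h \<otimes> x \<otimes> h"])
    show "inv h \<otimes> (\<lambda>x\<in>carrier F. h \<otimes> x \<otimes> inv h) x \<otimes> h = x" if "x \<in> carrier F" for x
      using mutually_inverse_homsD(5)[OF mutually_inverse_conjugation[OF h] that] that by simp
    show "(\<lambda>x\<in>carrier F. h \<otimes> x \<otimes> inv h) (inv h \<otimes> x \<otimes> h) = x" if "x \<in> carrier F" for x
      using mutually_inverse_homsD(6)[OF mutually_inverse_conjugation[OF h] that] that h by simp
  qed (use h in auto)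
  have mult: "(\<lambda>x\<in>carrier F. h \<otimes> x \<otimes> inv h) \<otimes>\<^bsub>AutoGroup F\<^esub> f = (\<lambda>x\<in>carrier F. h \<otimes> f x \<otimes> inv h)"
    if "h \<in> carrier F" for h
    using inner[OF that] fB fc by (auto simp: AutoGroup_def BijGroup_def compose_def fun_eq_iff)
  have "k \<in> Inn F #>\<^bsub>AutoGroup F\<^esub> f \<longleftrightarrow> (\<exists>h\<in>carrier F. k = (\<lambda>x\<in>carrier F. h \<otimes> f x \<otimes> inv h))" for k
    using mult by (auto simp: r_coset_def Inn_def)
  then show ?thesis
    unfolding represents_def by (metis (no_types, lifting) empty_iff one_closed restrict_apply')
qed

lemma auto_mutually_inverse:
  assumes "f \<in> auto F"
  obtains f' where "mutually_inverse_homs f f'"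
proof -
  have f: "f \<in> hom F F" "f \<in> Bij (carrier F)"
    using assms by (simp_all add: auto_def)
  then have b: "bij_betw f (carrier F) (carrier F)"
    by (simp add: Bij_def)
  have "mutually_inverse_homs f (restrict (inv_into (carrier F) f) (carrier F))"
    unfolding mutually_inverse_homs_def
    using f restrict_inv_into_hom[OF f] b
    by (auto simp: bij_betw_inv_into_left bij_betw_inv_into_right bij_betw_apply)
  then show ?thesis
    by (rule that)
qed

lemma OutGroup_represented:
  assumes "\<Phi> \<in> carrier (OutGroup F)"
  obtains f f' where "mutually_inverse_homs f f'" "represents \<Phi> f"
proof -
  have "carrier (AutoGroup F) = auto F"
    by (simp add: AutoGroup_def)
  then obtain f where "f \<in> auto F" "\<Phi> = Inn F #>\<^bsub>AutoGroup F\<^esub> f"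
    using assms by (auto simp: OutGroup_def FactGroup_def RCOSETS_def)
  then show ?thesis
    using that auto_mutually_inverse Inn_coset_represents by metis
qed

lemma represented_in_OutGroup:
  assumes f: "mutually_inverse_homs f f'"
  obtains \<Phi> where "\<Phi> \<in> carrier (OutGroup F)" "represents \<Phi> f"
proof -
  let ?r = "restrict f (carrier F)"
  note D = mutually_inverse_homsD[OF f]
  have "bij_betw ?r (carrier F) (carrier F)"
    by (rule bij_betwI[where g = f']) (use D in auto)
  moreover have "?r \<in> hom F F"
    using D(1) by (auto simp: hom_def)
  ultimately have r: "?r \<in> auto F"
    by (simp add: auto_def Bij_def)
  then have "Inn F #>\<^bsub>AutoGroup F\<^esub> ?r \<in> carrier (OutGroup F)"
    by (auto simp: OutGroup_def FactGroup_def RCOSETS_def AutoGroup_def)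
  moreover have "represents (Inn F #>\<^bsub>AutoGroup F\<^esub> ?r) f"
    using Inn_coset_represents[OF r] by (simp add: represents_def)
  ultimately show ?thesis
    by (rule that)
qed

lemma out_act_proj_class:
  assumes f: "mutually_inverse_homs f f'" and rep: "represents \<Phi> f" and \<nu>: "\<nu> \<in> nonzero_currents F X"
  shows "out_act F X \<Phi> (proj_class F X \<nu>) = proj_class F X (push F X f \<nu>)"
proof -
  have "proj_class F X (push F X k \<mu>) = proj_class F X (push F X f \<nu>)"
    if k: "k \<in> \<Phi>" and \<mu>: "\<mu> \<in> proj_class F X \<nu>" for k \<mu>
  proof -
    obtain r where r: "r > 0" "\<mu> = scale_measure (ennreal r) \<nu>" and \<mu>n: "\<mu> \<in> nonzero_currents F X"
      using \<mu> by (auto simp: proj_class_def proj_rel_def)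
    note \<mu>c = nonzero_current[OF \<mu>n]
    obtain h where "h \<in> carrier F" "\<And>g. g \<in> carrier F \<Longrightarrow> k g = h \<otimes> f g \<otimes> inv h"
      using rep k unfolding represents_def by blast
    then have "push F X k \<mu> = push F X f \<mu>"
      by (rule push_conjugate[OF f push_current[OF f \<mu>c] current_sets(1)[OF \<mu>c]])
    also have "\<dots> = scale_measure (ennreal r) (push F X f \<nu>)"
      unfolding r(2)
      by (rule push_scale[OF end_iso_automorphism[OF f] current_sets(1)[OF nonzero_current[OF \<nu>]]])
    finally show ?thesis
      using proj_class_scale[OF push_nonzero[OF f \<nu>] r(1)] by simp
  qed
  moreover have "\<nu> \<in> proj_class F X \<nu>"
    using equiv_class_self[OF equiv_proj_rel \<nu>] by (simp add: proj_class_def)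
  moreover have "\<Phi> \<noteq> {}"
    using rep by (simp add: represents_def)
  ultimately show ?thesis
    unfolding out_act_def by blast
qed

lemma topspace_currents_topology: "topspace (currents_topology F X) = currents F X"
  by (auto simp: currents_topology_def topspace_pullback_topology split_def)

lemma topspace_curr_top: "topspace curr_top = nonzero_currents F X"
  by (auto simp: topspace_currents_topology nonzero_currents_def)

lemma quotient_map_proj_class: "quotient_map curr_top (PCurr F X) (proj_class F X)"
  unfolding PCurr_def by (rule quotient_map_quotient_topology)

lemma topspace_PCurr: "topspace (PCurr F X) = proj_class F X ` nonzero_currents F X"
  using quotient_imp_surjective_map[OF quotient_map_proj_class] topspace_curr_top by simp

lemma continuous_map_evaluation:
  assumes "S \<in> disjoint_clopens F X"
  shows "continuous_map (currents_topology F X) euclideanreal (\<lambda>\<nu>. measure \<nu> (fst S \<times> snd S))"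
proof -
  let ?ev = "\<lambda>\<nu> :: 'a bd_pair measure. \<lambda>(S, S')\<in>disjoint_clopens F X. measure \<nu> (S \<times> S')"
  have "continuous_map (currents_topology F X) euclideanreal ((\<lambda>x. x S) \<circ> ?ev)"
    unfolding currents_topology_def
    by (intro continuous_map_pullback continuous_map_product_projection assms)
  moreover have "(\<lambda>x. x S) \<circ> ?ev = (\<lambda>\<nu>. measure \<nu> (fst S \<times> snd S))"
    using assms by (auto simp: fun_eq_iff split_def)
  ultimately show ?thesis by simp
qed

lemma continuous_map_push:
  assumes f: "mutually_inverse_homs f f'"
  shows "continuous_map curr_top curr_top (push F X f)"
proof -
  note e = end_iso_automorphism[OF f]
  let ?ev = "\<lambda>\<nu> :: 'a bd_pair measure. \<lambda>(S, S')\<in>disjoint_clopens F X. measure \<nu> (S \<times> S')"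
  have comp: "continuous_map curr_top euclideanreal (\<lambda>\<nu>. (?ev \<circ> push F X f) \<nu> S)"
    if S: "S \<in> disjoint_clopens F X" for S
  proof -
    define pre where "pre T = {\<zeta> \<in> topspace (bd_topology F X). bd_map F X f \<zeta> \<in> T}" for T
    define T where "T = (pre (fst S), pre (snd S))"
    have S': "openin (bd_topology F X) (fst S)" "closedin (bd_topology F X) (fst S)"
      "openin (bd_topology F X) (snd S)" "closedin (bd_topology F X) (snd S)" "fst S \<inter> snd S = {}"
      using S by (auto simp: disjoint_clopens_def)
    have T: "T \<in> disjoint_clopens F X"
      using S' openin_continuous_map_preimage[OF continuous_map_bd_map[OF e]]
        closedin_continuous_map_preimage[OF continuous_map_bd_map[OF e]]
      by (auto simp: T_def pre_def disjoint_clopens_def)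
    have eq: "(?ev \<circ> push F X f) \<nu> S = measure \<nu> (fst T \<times> snd T)" if \<nu>: "\<nu> \<in> topspace curr_top" for \<nu>
    proof -
      have c: "\<nu> \<in> currents F X"
        using \<nu> topspace_curr_top nonzero_current by blast
      have m: "bd2_map f \<in> measurable \<nu> (borel_of bd2)"
        by (rule measurable_borel_of[OF continuous_map_bd2_map[OF e] current_sets(1)[OF c]])
      have "fst S \<times> snd S \<in> sets (borel_of bd2)"
        by (rule openin_borel_of[OF disjoint_clopen_Times(1)[OF S']])
      from measure_distr[OF m this]
      have "measure (push F X f \<nu>) (fst S \<times> snd S) = measure \<nu> (bd2_map f -` (fst S \<times> snd S) \<inter> topspace bd2)"
        by (simp add: push_def current_sets(2)[OF c])
      also have "bd2_map f -` (fst S \<times> snd S) \<inter> topspace bd2 = fst T \<times> snd T"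
        using S'(5) by (auto simp: T_def pre_def topspace_bd2)
      finally show ?thesis
        using S by (simp add: split_def)
    qed
    have "continuous_map curr_top euclideanreal (\<lambda>\<nu>. measure \<nu> (fst T \<times> snd T))"
      by (rule continuous_map_from_subtopology[OF continuous_map_evaluation[OF T]])
    then show ?thesis
      by (rule continuous_map_eq) (rule eq[symmetric])
  qed
  have "continuous_map curr_top (product_topology (\<lambda>_. euclideanreal) (disjoint_clopens F X)) (?ev \<circ> push F X f)"
    using comp by (subst continuous_map_componentwise) auto
  then have "continuous_map curr_top (pullback_topology (currents F X) ?ev
      (product_topology (\<lambda>_. euclideanreal) (disjoint_clopens F X))) (push F X f)"
    by (rule continuous_map_pullback') (use push_current[OF f] nonzero_current topspace_curr_top in blast)
  then have "continuous_map curr_top (currents_topology F X) (push F X f)"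
    by (simp only: currents_topology_def)
  then show ?thesis
    unfolding continuous_map_in_subtopology using push_nonzero[OF f] topspace_curr_top by auto
qed

lemma continuous_map_out_act:
  assumes f: "mutually_inverse_homs f f'" and rep: "represents \<Phi> f"
  shows "continuous_map (PCurr F X) (PCurr F X) (out_act F X \<Phi>)"
proof (rule continuous_compose_quotient_map[OF quotient_map_proj_class])
  have "continuous_map curr_top (PCurr F X) (proj_class F X \<circ> push F X f)"
    by (rule continuous_map_compose[OF continuous_map_push[OF f] quotient_imp_continuous_map[OF quotient_map_proj_class]])
  then show "continuous_map curr_top (PCurr F X) (out_act F X \<Phi> \<circ> proj_class F X)"
    by (rule continuous_map_eq) (use out_act_proj_class[OF f rep] topspace_curr_top in simp)
qed

text \<open>The preimage of \<open>Z\<close> under the quotient map is closed in a topology that is induced by the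
  evaluations at pairs of disjoint clopen sets, so limits may be tested on these.\<close>

lemma closed_proj_class_limit:
  assumes Z: "closedin (PCurr F X) Z"
    and \<nu>: "\<And>n. \<nu> n \<in> nonzero_currents F X" "\<And>n. proj_class F X (\<nu> n) \<in> Z"
    and \<mu>: "\<mu> \<in> nonzero_currents F X"
    and lim: "\<And>S. S \<in> disjoint_clopens F X \<Longrightarrow>
      (\<lambda>n. measure (\<nu> n) (fst S \<times> snd S)) \<longlonglongrightarrow> measure \<mu> (fst S \<times> snd S)"
  shows "proj_class F X \<mu> \<in> Z"
proof -
  let ?ev = "\<lambda>\<nu> :: 'a bd_pair measure. \<lambda>(S, S')\<in>disjoint_clopens F X. measure \<nu> (S \<times> S')"
  let ?P = "product_topology (\<lambda>_. euclideanreal) (disjoint_clopens F X)"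
  have prod_lim: "limitin ?P (\<lambda>n. ?ev (\<nu> n)) (?ev \<mu>) sequentially"
    unfolding limitin_componentwise using lim by (auto simp: split_def)
  have "limitin (currents_topology F X) \<nu> \<mu> sequentially"
    unfolding limitin_def
  proof (intro conjI allI impI)
    show "\<mu> \<in> topspace (currents_topology F X)"
      using \<mu> nonzero_current topspace_currents_topology by simp
    fix U assume U: "openin (currents_topology F X) U \<and> \<mu> \<in> U"
    then obtain V where V: "openin ?P V" "U = ?ev -` V \<inter> currents F X"
      unfolding currents_topology_def openin_pullback_topology by blast
    then have "\<forall>\<^sub>F n in sequentially. ?ev (\<nu> n) \<in> V"
      using prod_lim U unfolding limitin_def by blast
    then show "\<forall>\<^sub>F n in sequentially. \<nu> n \<in> U"
      by eventually_elim (use V(2) \<nu>(1) nonzero_current in auto)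
  qed
  then have "limitin curr_top \<nu> \<mu> sequentially"
    unfolding limitin_subtopology using \<nu>(1) \<mu> by simp
  moreover have "closedin curr_top {\<nu> \<in> topspace curr_top. proj_class F X \<nu> \<in> Z}"
    by (rule closedin_continuous_map_preimage[OF quotient_imp_continuous_map[OF quotient_map_proj_class] Z])
  ultimately have "\<mu> \<in> {\<nu> \<in> topspace curr_top. proj_class F X \<nu> \<in> Z}"
    by (rule limitin_closedin) (use \<nu> topspace_curr_top in auto)
  then show ?thesis by simp
qed

end

section \<open>The minimal set\<close>

context finite_rank_free_group
begin

lemma counting_current_basis_nonzero:
  assumes c: "c \<in> X"
  shows "counting_current F X c \<in> nonzero_currents F X"
proof -
  let ?E = "lines (cyl [(c, True)]) (carrier F - cyl [(c, True)])"
  have "emeasure (counting_current F X c) ?E \<le> emeasure (counting_current F X c) (space (counting_current F X c))"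
    by (rule emeasure_space)
  then have "emeasure (counting_current F X c) (space (counting_current F X c)) \<noteq> 0"
    using counting_current_edge[OF c, of "(c, True)"] by auto
  then show ?thesis
    using counting_current_basis_current[OF c] by (simp add: nonzero_currents_def)
qed

lemma edge_mass_counting_current:
  assumes c: "c \<in> X"
  shows "edge_mass (counting_current F X c) y = (if fst y = c then 1 else 0)"
  using counting_current_edge[OF c, of y] by (simp add: edge_mass_def mass_def measure_def)

text \<open>A line that crosses an edge continues behind the next vertex into one of finitely many
  half-trees. So a non-zero current charges, up to a translation, the lines between two different
  letters.\<close>

lemma nonzero_current_charges_turn:
  assumes \<nu>: "\<nu> \<in> nonzero_currents F X"
  obtains u y where "u \<in> letters" "y \<in> letters" "u \<noteq> y" "mass \<nu> (cyl [u]) (cyl [y]) > 0"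
proof -
  note c = nonzero_current[OF \<nu>]
  have "\<exists>y\<in>letters. edge_mass \<nu> y > 0"
  proof (rule ccontr)
    assume "\<not> ?thesis"
    then have zero: "edge_mass \<nu> y = 0" if "y \<in> letters" for y
      using that mass_nonneg[of \<nu>] unfolding edge_mass_def by (metis order_le_less)
    have "edge_lines g y \<in> null_sets \<nu>" if g: "g \<in> carrier F" and y: "y \<in> letters" for g y
    proof -
      have "push F X (\<lambda>x. inv g \<otimes> x) \<nu> = \<nu>"
        using c g by (simp add: currents_def)
      then have "emeasure \<nu> (edge_lines g y) = emeasure \<nu> (lines (cyl [y]) (carrier F - cyl [y]))"
        by (rule emeasure_edge_lines[OF g current_sets(1)[OF c]])
      also have "\<dots> = ennreal (edge_mass \<nu> y)"
        unfolding edge_mass_def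
        by (rule emeasure_lines_eq_mass[OF c almost_invariant_cyl almost_invariant_co_cyl]) blast
      finally have "emeasure \<nu> (edge_lines g y) = 0"
        using zero[OF y] by simp
      moreover have "edge_lines g y \<in> sets \<nu>"
        using openin_borel_of[OF openin_edge_lines[OF g]] current_sets(1)[OF c] by blast
      ultimately show ?thesis
        by (rule null_setsI)
    qed
    then have "(\<Union>g\<in>carrier F. \<Union>y\<in>letters. edge_lines g y) \<in> null_sets \<nu>"
      using finite_letters by (intro null_sets_UN' countable_carrier countable_finite) simp_all
    moreover have "space \<nu> \<subseteq> (\<Union>g\<in>carrier F. \<Union>y\<in>letters. edge_lines g y)"
    proof
      fix x assume "x \<in> space \<nu>"
      then have "x \<in> topspace bd2"
        by (simp add: current_sets(2)[OF c])
      then obtain g y where "g \<in> carrier F" "y \<in> letters" "x \<in> edge_lines g y"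
        by (rule line_crosses_edge)
      then show "x \<in> (\<Union>g\<in>carrier F. \<Union>y\<in>letters. edge_lines g y)"
        by blast
    qed
    ultimately have "space \<nu> \<in> null_sets \<nu>"
      by (rule null_sets_subset[OF _ sets.top])
    then show False
      using \<nu> by (auto simp: nonzero_currents_def)
  qed
  then obtain y where y: "y \<in> letters" "edge_mass \<nu> y > 0"
    by blast
  let ?L = "{z \<in> letters. z \<noteq> y}"
  have cover: "(carrier F - cyl [y]) - {\<one>} \<subseteq> (\<Union>z\<in>?L. cyl [z])"
  proof
    fix g assume g: "g \<in> (carrier F - cyl [y]) - {\<one>}"
    then have "nf g \<noteq> []"
      using nf_eq_Nil by blast
    then have "g \<in> cyl [hd (nf g)]" "hd (nf g) \<in> letters" "hd (nf g) \<noteq> y"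
      using g nf_set[of g] hd_in_set[of "nf g"] by (auto simp: in_cyl_single)
    then show "g \<in> (\<Union>z\<in>?L. cyl [z])"
      by (intro UN_I[of "hd (nf g)"]) simp_all
  qed
  have "edge_mass \<nu> y \<le> (\<Sum>z\<in>?L. mass \<nu> (cyl [y]) (cyl [z]))"
    unfolding edge_mass_def
  proof (rule mass_finite_Union_le[OF c almost_invariant_cyl _ _ _ cover])
    show "almost_invariant (cyl [z]) \<and> cyl [y] \<inter> cyl [z] = {}" if "z \<in> ?L" for z
      using almost_invariant_cyl cyl_disjoint[of "[y]" "[z]"] that by auto
  qed (use finite_letters in simp_all)
  then have "(\<Sum>z\<in>?L. mass \<nu> (cyl [y]) (cyl [z])) > 0"
    using y(2) by linarith
  then have "\<exists>z\<in>?L. mass \<nu> (cyl [y]) (cyl [z]) > 0"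
    using sum_nonpos[of ?L "\<lambda>z. mass \<nu> (cyl [y]) (cyl [z])"] by (meson not_le)
  then obtain z where "z \<in> letters" "y \<noteq> z" "mass \<nu> (cyl [y]) (cyl [z]) > 0"
    by blast
  then show ?thesis
    by (rule that[OF y(1)])
qed

text \<open>Powers of the twist along a basis element \<open>c\<close> that avoids the two letters of a charged turn
  push the whole projective mass towards the axis of \<open>c\<close>. The third basis element is what
  makes the choice of \<open>c\<close> possible.\<close>

lemma closed_invariant_contains_basis_class:
  assumes rank: "card X \<ge> 3"
    and Z: "Z \<noteq> {}" "closedin (PCurr F X) Z" "out_invariant F X Z"
  obtains c where "c \<in> X" "proj_class F X (counting_current F X c) \<in> Z"
proof -
  obtain p where p: "p \<in> Z"
    using Z(1) by blast
  then have "p \<in> proj_class F X ` nonzero_currents F X"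
    using closedin_subset[OF Z(2)] topspace_PCurr by auto
  then obtain \<nu> where \<nu>: "\<nu> \<in> nonzero_currents F X" "proj_class F X \<nu> \<in> Z"
    using p by blast
  note \<nu>c = nonzero_current[OF \<nu>(1)]
  obtain u y where uy: "u \<in> letters" "y \<in> letters" "u \<noteq> y" and pos: "mass \<nu> (cyl [u]) (cyl [y]) > 0"
    by (rule nonzero_current_charges_turn[OF \<nu>(1)])
  have "card {fst u, fst y} < card X"
    using rank by (simp add: card_insert_if)
  then have "\<not> X \<subseteq> {fst u, fst y}"
    using card_mono[of "{fst u, fst y}" X] by auto
  then obtain c where c: "c \<in> X" "fst u \<noteq> c" "fst y \<noteq> c"
    by auto
  define t :: "nat \<Rightarrow> 'a \<times> bool \<Rightarrow> int" where "t n z = (if z = u then int n else 0)" for n z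
  have "\<exists>f f'. is_twist c (t n) f \<and> is_twist c (\<lambda>z. - t n z) f'" for n
    using twist_exists[OF c(1), of "t n"] twist_exists[OF c(1), of "\<lambda>z. - t n z"] by metis
  then obtain f f' where f: "\<And>n. is_twist c (t n) (f n)" "\<And>n. is_twist c (\<lambda>z. - t n z) (f' n)"
    by metis
  note inv = twists_mutually_inverse[OF f c(1)]
  define \<rho> where "\<rho> n = push F X (f n) \<nu>" for n
  have \<rho>: "\<rho> n \<in> nonzero_currents F X" for n
    unfolding \<rho>_def by (rule push_nonzero[OF inv \<nu>(1)])
  have \<rho>Z: "proj_class F X (\<rho> n) \<in> Z" for n
  proof -
    obtain \<Phi> where \<Phi>: "\<Phi> \<in> carrier (OutGroup F)" "represents \<Phi> (f n)"
      by (rule represented_in_OutGroup[OF inv])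
    have "out_act F X \<Phi> (proj_class F X \<nu>) \<in> Z"
      using Z(3) \<Phi>(1) \<nu>(2) unfolding out_invariant_def by blast
    then show ?thesis
      by (simp add: out_act_proj_class[OF inv \<Phi>(2) \<nu>(1)] \<rho>_def)
  qed
  define m where "m n = edge_mass (\<rho> n) (c, True)" for n
  let ?\<delta> = "mass \<nu> (cyl [u]) (cyl [y])"
  have growth: "real n * ?\<delta> \<le> m n" for n
    unfolding m_def \<rho>_def
    by (rule edge_mass_twist_growth[OF \<nu>c push_current[OF inv \<nu>c] f c(1) uy(1) c(2) _ uy(2) c(3) _ uy(3)])
      (use uy(3) in \<open>auto simp: t_def\<close>)
  have other: "edge_mass (\<rho> n) z = edge_mass \<nu> z" if z: "z \<in> letters" "fst z \<noteq> c" for z n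
  proof (cases "z = u")
    case False
    then show ?thesis
      unfolding \<rho>_def by (intro edge_mass_twist[OF \<nu>c f c(1) z]) (simp add: t_def)
  next
    case True
    \<comment> \<open>Powers of \<open>c\<close> are inserted before \<open>u\<close>, but not before its inverse.\<close>
    have "edge_mass (\<rho> n) (linv z) = edge_mass \<nu> (linv z)"
      unfolding \<rho>_def using z True by (intro edge_mass_twist[OF \<nu>c f c(1)]) (auto simp: t_def)
    then show ?thesis
      using edge_mass_linv[OF \<nu>c z(1)] edge_mass_linv[OF nonzero_current[OF \<rho>] z(1)] by simp
  qed
  have m_pos: "m (Suc n) > 0" for n
    using growth[of "Suc n"] pos by (smt (verit) mult_pos_pos of_nat_0_less_iff zero_less_Suc)
  \<comment> \<open>Normalised to mass one on the \<open>c\<close>-edge; the index is shifted because \<open>m 0\<close> may vanish.\<close>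
  define \<kappa> where "\<kappa> n = scale_measure (ennreal (1 / m (Suc n))) (\<rho> (Suc n))" for n
  have \<kappa>: "\<kappa> n \<in> nonzero_currents F X" for n
    unfolding \<kappa>_def using m_pos by (intro scale_nonzero[OF \<rho>]) simp
  have \<kappa>Z: "proj_class F X (\<kappa> n) \<in> Z" for n
    unfolding \<kappa>_def using m_pos \<rho>Z by (subst proj_class_scale[OF \<rho>]) simp_all
  have \<kappa>_edge: "edge_mass (\<kappa> n) z = edge_mass (\<rho> (Suc n)) z / m (Suc n)" for n z
    using m_pos[of n] by (simp add: edge_mass_def \<kappa>_def mass_scale)
  have c1: "(\<lambda>n. edge_mass (\<kappa> n) z) \<longlonglongrightarrow> edge_mass (counting_current F X c) z" if z: "z \<in> letters" for z
  proof (cases "fst z = c")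
    case True
    then have "z = (c, True) \<or> z = linv (c, True)"
      using same_fst_letters[of z "(c, True)"] by simp
    then have "edge_mass (\<rho> (Suc n)) z = m (Suc n)" for n
      using edge_mass_linv[OF nonzero_current[OF \<rho>], of "(c, True)"] c(1) by (auto simp: m_def)
    then have "edge_mass (\<kappa> n) z = 1" for n
      using \<kappa>_edge m_pos[of n] by simp
    then show ?thesis
      using True by (simp add: edge_mass_counting_current[OF c(1)])
  next
    case False
    have lim0: "(\<lambda>n. (edge_mass \<nu> z / ?\<delta>) * inverse (real (Suc n))) \<longlonglongrightarrow> 0"
      by (intro tendsto_mult_right_zero LIMSEQ_inverse_real_of_nat)
    have "(\<lambda>n. edge_mass (\<kappa> n) z) \<longlonglongrightarrow> 0"
    proof (rule tendsto_sandwich[OF always_eventually always_eventually tendsto_const lim0]; intro allI)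
      fix n
      show "0 \<le> edge_mass (\<kappa> n) z"
        by (simp add: edge_mass_def)
      have "edge_mass (\<kappa> n) z = edge_mass \<nu> z / m (Suc n)"
        using \<kappa>_edge other[OF z False] by simp
      also have "\<dots> \<le> edge_mass \<nu> z / (real (Suc n) * ?\<delta>)"
        using growth[of "Suc n"] pos m_pos[of n] by (intro divide_left_mono) (auto simp: edge_mass_def)
      also have "\<dots> = (edge_mass \<nu> z / ?\<delta>) * inverse (real (Suc n))"
        by (simp add: divide_simps)
      finally show "edge_mass (\<kappa> n) z \<le> (edge_mass \<nu> z / ?\<delta>) * inverse (real (Suc n))" .
    qed
    then show ?thesis
      using False by (simp add: edge_mass_counting_current[OF c(1)])
  qed
  interpret edge_convergence F X \<kappa> "counting_current F X c" c
    by unfold_locales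
      (use nonzero_current[OF \<kappa>] counting_current_basis_current[OF c(1)] c(1) c1
        edge_mass_counting_current[OF c(1)] in auto)
  have "proj_class F X (counting_current F X c) \<in> Z"
  proof (rule closed_proj_class_limit[OF Z(2) \<kappa> \<kappa>Z counting_current_basis_nonzero[OF c(1)]])
    fix S assume "S \<in> disjoint_clopens F X"
    then show "(\<lambda>n. measure (\<kappa> n) (fst S \<times> snd S)) \<longlonglongrightarrow> measure (counting_current F X c) (fst S \<times> snd S)"
      by (intro clopen_converges) (auto simp: disjoint_clopens_def)
  qed
  then show ?thesis
    using that c(1) by blast
qed

lemma rational_current_primitive:
  "primitive_element F g \<Longrightarrow> rational_current F X g = counting_current F X g"
  using primitive_not_proper_power by (simp add: rational_current_def)

lemma primitive_counting_current:
  assumes g: "primitive_element F g" and c: "c \<in> X"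
  obtains f f' where "mutually_inverse_homs f f'" "f c = g"
    "push F X f (counting_current F X c) = counting_current F X g"
proof -
  obtain f f' where f: "mutually_inverse_homs f f'" "f c = g"
    by (rule primitive_transitive[OF g c])
  moreover have "push F X f (counting_current F X c) = counting_current F X g"
    using push_counting_current[OF f(1) axial_basis[OF c]] f(2) by simp
  ultimately show ?thesis
    by (rule that)
qed

definition primitive_classes :: "'a bd_pair measure set set" where
  "primitive_classes = {proj_class F X (rational_current F X g) |g. primitive_element F g}"

lemma M_PCurr_eq: "M_PCurr F X = PCurr F X closure_of primitive_classes"
  by (simp add: M_PCurr_def primitive_classes_def)

text \<open>All primitive elements are equivalent under automorphisms, so one class yields all.\<close>

lemma primitive_classes_subset:
  assumes c: "c \<in> X" and cZ: "proj_class F X (counting_current F X c) \<in> Z" and Z: "out_invariant F X Z"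
  shows "primitive_classes \<subseteq> Z"
proof
  fix p assume "p \<in> primitive_classes"
  then obtain g where g: "primitive_element F g" "p = proj_class F X (counting_current F X g)"
    using rational_current_primitive by (auto simp: primitive_classes_def)
  obtain f f' where f: "mutually_inverse_homs f f'" "f c = g"
      and push: "push F X f (counting_current F X c) = counting_current F X g"
    by (rule primitive_counting_current[OF g(1) c])
  obtain \<Phi> where \<Phi>: "\<Phi> \<in> carrier (OutGroup F)" "represents \<Phi> f"
    by (rule represented_in_OutGroup[OF f(1)])
  have "out_act F X \<Phi> (proj_class F X (counting_current F X c)) = p"
    using out_act_proj_class[OF f(1) \<Phi>(2) counting_current_basis_nonzero[OF c]] push g(2) by simp
  then show "p \<in> Z"
    using Z \<Phi>(1) cZ unfolding out_invariant_def by blast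
qed

lemma out_invariant_M_PCurr:
  assumes c: "c \<in> X"
  shows "out_invariant F X (M_PCurr F X)"
  unfolding out_invariant_def
proof
  fix \<Phi> assume "\<Phi> \<in> carrier (OutGroup F)"
  then obtain f f' where f: "mutually_inverse_homs f f'" "represents \<Phi> f"
    by (rule OutGroup_represented)
  have "out_act F X \<Phi> p \<in> primitive_classes" if p: "p \<in> primitive_classes" for p
  proof -
    obtain g where g: "primitive_element F g" "p = proj_class F X (counting_current F X g)"
      using p rational_current_primitive by (auto simp: primitive_classes_def)
    obtain k k' where k: "mutually_inverse_homs k k'" "k c = g"
        and push: "push F X k (counting_current F X c) = counting_current F X g"
      by (rule primitive_counting_current[OF g(1) c])
    have "counting_current F X g \<in> nonzero_currents F X"
      using push_nonzero[OF k(1) counting_current_basis_nonzero[OF c]] push by simp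
    moreover have "axial g"
      using axial_image[OF k(1) axial_basis[OF c]] k(2) by simp
    ultimately have "out_act F X \<Phi> p = proj_class F X (counting_current F X (f g))"
      using out_act_proj_class[OF f] push_counting_current[OF f(1)] g(2) by simp
    moreover have "primitive_element F (f g)"
      by (rule primitive_image[OF f(1) g(1)])
    ultimately show ?thesis
      using rational_current_primitive unfolding primitive_classes_def by (metis (mono_tags, lifting) mem_Collect_eq)
  qed
  then have "out_act F X \<Phi> ` primitive_classes \<subseteq> primitive_classes"
    by blast
  then have "PCurr F X closure_of (out_act F X \<Phi> ` primitive_classes) \<subseteq> M_PCurr F X"
    unfolding M_PCurr_eq by (rule closure_of_mono)
  then show "out_act F X \<Phi> ` M_PCurr F X \<subseteq> M_PCurr F X"
    using continuous_map_image_closure_subset[OF continuous_map_out_act[OF f], of primitive_classes]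
    unfolding M_PCurr_eq by (rule order_trans[rotated])
qed

lemma M_PCurr_nonempty:
  assumes c: "c \<in> X"
  shows "M_PCurr F X \<noteq> {}"
proof -
  let ?p = "proj_class F X (counting_current F X c)"
  have "primitive_element F c"
    using basis c by (auto simp: primitive_element_def)
  then have "?p \<in> primitive_classes"
    unfolding primitive_classes_def using rational_current_primitive by (metis (mono_tags, lifting) mem_Collect_eq)
  moreover have "?p \<in> topspace (PCurr F X)"
    using counting_current_basis_nonzero[OF c] by (simp add: topspace_PCurr)
  ultimately show ?thesis
    unfolding M_PCurr_eq using closure_of_subset_Int[of "PCurr F X" primitive_classes] by blast
qed

end

theorem theorem2:
  fixes F :: "('a, 'b) monoid_scheme" and X :: "'a set" and k :: nat
  assumes "group F"
    and "free_basis F X" and "finite X" and "card X = k"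
    and "k \<ge> 3"
  shows "(M_PCurr F X \<noteq> {} \<and> closedin (PCurr F X) (M_PCurr F X) \<and> out_invariant F X (M_PCurr F X)) \<and>
    (\<forall>Z. Z \<noteq> {} \<and> closedin (PCurr F X) Z \<and> out_invariant F X Z \<longrightarrow> M_PCurr F X \<subseteq> Z)"
proof -
  interpret group F by fact
  interpret finite_rank_free_group F X
    by unfold_locales (use assms in auto)
  have rank: "card X \<ge> 3"
    using assms by simp
  then obtain c where c: "c \<in> X"
    by fastforce
  have "M_PCurr F X \<subseteq> Z"
    if Z: "Z \<noteq> {}" "closedin (PCurr F X) Z" "out_invariant F X Z" for Z
  proof -
    obtain a where "a \<in> X" "proj_class F X (counting_current F X a) \<in> Z"
      by (rule closed_invariant_contains_basis_class[OF rank Z])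
    then have "primitive_classes \<subseteq> Z"
      using primitive_classes_subset Z(3) by blast
    then show ?thesis
      unfolding M_PCurr_eq using Z(2) by (rule closure_of_minimal)
  qed
  moreover have "closedin (PCurr F X) (M_PCurr F X)"
    by (simp add: M_PCurr_def)
  ultimately show ?thesis
    using M_PCurr_nonempty[OF c] out_invariant_M_PCurr[OF c] by blast
qed

end
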